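(* Let $\mathcal{L}=\frac12\left(\partial_{x_1}^2+x_1^2\,\partial_{x_2}^2\right)$ be the Grushin operator on $\mathbb{R}^2$, with $x=(x_1,x_2)$, let $p>0$, and consider the Cauchy problem $$u_t=\mathcal{L}u+u^p,\quad x\in\mathbb{R}^2,\ t>0,\qquad u(0,x)=u_0(x)\ge 0,\quad x\in\mathbb{R}^2.$$ Assume that $u_0:\mathbb{R}^2\to[0,\infty)$ is a bounded continuous non-negative function. (i) If $0<p<1$, then the solution of the Cauchy problem exists globally. (ii) If $1<p\le 1+\frac23$, then all nontrivial solutions of the Cauchy problem blow up in finite time; that is, for each such solution $u$ there exists $T^*>0$ such that $u(t,x)=\infty$ for all $t>T^*$ and all $x\in\mathbb{R}^2$. (iii) If $p>1$, then the solution of the Cauchy problem blows up in finite time provided that the initial datum satisfies $$\inf_{x\in\mathbb{R}^2}u_0(x)\ge\mu>0,$$ where $\mu$ is a constant.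
   Context: Solutions are non-negative and are understood through the integral (Duhamel) formula $$u(t,x)=\int_{\mathbb{R}^2}K(t,x,y)u_0(y)\,dy+\int_0^t\int_{\mathbb{R}^2}K(t-s,x,y)\,u^p(s,y)\,dy\,ds,$$ where $K(t,x,y)$, for $t>0$ and $x,y\in\mathbb{R}^2$, is the heat kernel of $\mathcal{L}$, i.e. the transition density of the diffusion process on $\mathbb{R}^2$ generated by $\mathcal{L}$, which solves $dX^1_t=dW^1_t$, $dX^2_t=X^1_t\,dW^2_t$ with independent standard Brownian motions $W^1,W^2$. A solution may take the value $+\infty$ (with the integral formula read in $[0,\infty]$). "The solution exists globally" means that there is a solution defined and finite for all $(t,x)\in[0,\infty)\times\mathbb{R}^2$. "Blows up in finite time" means that there exists $T^*>0$ such that $u(t,x)=\infty$ for all $t>T^*$ and all $x\in\mathbb{R}^2$. "Nontrivial" means not identically zero. *)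

theory Defs
  imports "HOL-Probability.Probability"
begin

section \<open>The diffusion generated by the Grushin operator and its heat kernel\<close>

text \<open>Points \<open>x = (x\<^sub>1, x\<^sub>2)\<close> of the plane are pairs of type \<^typ>\<open>real \<times> real\<close>. Stochastic processes are
  indexed by \<^typ>\<open>real\<close>; only nonnegative times matter.\<close>

definition brownian_motion :: "'w measure \<Rightarrow> (real \<Rightarrow> 'w \<Rightarrow> real) \<Rightarrow> bool" where
  "brownian_motion M W \<longleftrightarrow>
     prob_space M \<and>
     (\<forall>t\<ge>0. W t \<in> borel_measurable M) \<and>
     (AE \<omega> in M. W 0 \<omega> = 0) \<and>
     (\<forall>(n::nat) (\<tau>::nat \<Rightarrow> real). 0 \<le> \<tau> 0 \<and> mono \<tau> \<longrightarrow>
        prob_space.indep_vars M (\<lambda>_. borel) (\<lambda>i \<omega>. W (\<tau> (Suc i)) \<omega> - W (\<tau> i) \<omega>) {..<n}) \<and>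
     (\<forall>s t. 0 \<le> s \<and> s < t \<longrightarrow>
        distributed M lborel (\<lambda>\<omega>. W t \<omega> - W s \<omega>)
          (\<lambda>z. ennreal (normal_density 0 (sqrt (t - s)) z))) \<and>
     (AE \<omega> in M. continuous_on {0..} (\<lambda>t. W t \<omega>))"

definition independent_processes ::
  "'w measure \<Rightarrow> (real \<Rightarrow> 'w \<Rightarrow> real) \<Rightarrow> (real \<Rightarrow> 'w \<Rightarrow> real) \<Rightarrow> bool" where
  "independent_processes M V W \<longleftrightarrow>
     prob_space.indep_var M
       (\<Pi>\<^sub>M t\<in>{0..}. borel) (\<lambda>\<omega>. \<lambda>t\<in>{0..}. V t \<omega>)
       (\<Pi>\<^sub>M t\<in>{0..}. borel) (\<lambda>\<omega>. \<lambda>t\<in>{0..}. W t \<omega>)"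

text \<open>\<open>I\<close> is the Ito integral over \<open>[0,t]\<close> of a continuous adapted process \<open>H\<close> against a Brownian
  motion \<open>W\<close>: the limit in probability of the left-endpoint Riemann sums as the mesh of the
  partition \<open>0 = \<tau> 0 \<le> \<dots> \<le> \<tau> n = t\<close> tends to \<open>0\<close>.\<close>

definition is_ito_integral ::
  "'w measure \<Rightarrow> (real \<Rightarrow> 'w \<Rightarrow> real) \<Rightarrow> (real \<Rightarrow> 'w \<Rightarrow> real) \<Rightarrow> real \<Rightarrow> ('w \<Rightarrow> real) \<Rightarrow> bool" where
  "is_ito_integral M H W t I \<longleftrightarrow>
     I \<in> borel_measurable M \<and>
     (\<forall>\<epsilon>>0. \<exists>\<delta>>0. \<forall>(n::nat) (\<tau>::nat \<Rightarrow> real).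
        \<tau> 0 = 0 \<and> \<tau> n = t \<and> (\<forall>i<n. \<tau> i \<le> \<tau> (Suc i) \<and> \<tau> (Suc i) - \<tau> i < \<delta>) \<longrightarrow>
        measure M {\<omega> \<in> space M.
          \<bar>(\<Sum>i<n. H (\<tau> i) \<omega> * (W (\<tau> (Suc i)) \<omega> - W (\<tau> i) \<omega>)) - I \<omega>\<bar> > \<epsilon>} < \<epsilon>)"

text \<open>\<open>X\<close> solves \<open>dX\<^sub>1 = dW\<^sub>1\<close>, \<open>dX\<^sub>2 = X\<^sub>1 dW\<^sub>2\<close>, \<open>X 0 = x\<close>. The generator of this diffusion is the
  Grushin operator \<open>(\<partial>\<^sub>1\<^sup>2 + x\<^sub>1\<^sup>2 \<partial>\<^sub>2\<^sup>2) / 2\<close>. Adaptedness of \<open>X\<^sub>1\<close> is automatic, since \<open>X\<^sub>1 = x\<^sub>1 + W\<^sub>1\<close> and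
  \<open>W\<^sub>1\<close>, \<open>W\<^sub>2\<close> will be independent.\<close>

definition grushin_diffusion ::
  "'w measure \<Rightarrow> (real \<Rightarrow> 'w \<Rightarrow> real) \<Rightarrow> (real \<Rightarrow> 'w \<Rightarrow> real) \<Rightarrow> real \<times> real \<Rightarrow>
   (real \<Rightarrow> 'w \<Rightarrow> real \<times> real) \<Rightarrow> bool" where
  "grushin_diffusion M W1 W2 x X \<longleftrightarrow>
     (\<forall>t\<ge>0. X t \<in> borel_measurable M) \<and>
     (AE \<omega> in M. continuous_on {0..} (\<lambda>t. X t \<omega>)) \<and>
     (AE \<omega> in M. \<forall>t\<ge>0. fst (X t \<omega>) = fst x + W1 t \<omega>) \<and>
     (\<forall>t\<ge>0. is_ito_integral M (\<lambda>s \<omega>. fst (X s \<omega>)) W2 t (\<lambda>\<omega>. snd (X t \<omega>) - snd x))"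

text \<open>\<open>K t x\<close> is the density of the law at time \<open>t > 0\<close> of the diffusion \<open>X x\<close> started at \<open>x\<close>. A density
  is determined only almost everywhere; continuity singles out the heat kernel.\<close>

definition grushin_heat_kernel ::
  "'w measure \<Rightarrow> (real \<Rightarrow> 'w \<Rightarrow> real) \<Rightarrow> (real \<Rightarrow> 'w \<Rightarrow> real) \<Rightarrow>
   (real \<times> real \<Rightarrow> real \<Rightarrow> 'w \<Rightarrow> real \<times> real) \<Rightarrow>
   (real \<Rightarrow> real \<times> real \<Rightarrow> real \<times> real \<Rightarrow> real) \<Rightarrow> bool" where
  "grushin_heat_kernel M W1 W2 X K \<longleftrightarrow>
     brownian_motion M W1 \<and> brownian_motion M W2 \<and> independent_processes M W1 W2 \<and>
     (\<forall>x. grushin_diffusion M W1 W2 x (X x)) \<and>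
     (\<forall>t>0. \<forall>x y. 0 \<le> K t x y) \<and>
     (\<forall>t>0. \<forall>x. distributed M lborel (X x t) (\<lambda>y. ennreal (K t x y))) \<and>
     continuous_on ({0<..} \<times> UNIV \<times> UNIV) (\<lambda>(t, x, y). K t x y)"


section \<open>Solutions of the Cauchy problem\<close>

definition ennpowr :: "ennreal \<Rightarrow> real \<Rightarrow> ennreal" where
  "ennpowr z p = (if z = \<infinity> then \<infinity> else ennreal (enn2real z powr p))"

definition cauchy_solution ::
  "(real \<Rightarrow> real \<times> real \<Rightarrow> real \<times> real \<Rightarrow> real) \<Rightarrow> real \<Rightarrow> (real \<times> real \<Rightarrow> real) \<Rightarrow>
   (real \<Rightarrow> real \<times> real \<Rightarrow> ennreal) \<Rightarrow> bool" where
  "cauchy_solution K p u0 u \<longleftrightarrow>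
     (\<lambda>(t, x). u t x) \<in> borel_measurable (restrict_space borel ({0..} \<times> UNIV)) \<and>
     (\<forall>x. u 0 x = ennreal (u0 x)) \<and>
     (\<forall>t>0. \<forall>x.
        u t x = (\<integral>\<^sup>+ y. ennreal (K t x y) * ennreal (u0 y) \<partial>lborel)
              + (\<integral>\<^sup>+ s\<in>{0<..<t}. (\<integral>\<^sup>+ y. ennreal (K (t - s) x y) * ennpowr (u s y) p \<partial>lborel) \<partial>lborel))"

definition finite_everywhere :: "(real \<Rightarrow> real \<times> real \<Rightarrow> ennreal) \<Rightarrow> bool" where
  "finite_everywhere u \<longleftrightarrow> (\<forall>t\<ge>0. \<forall>x. u t x < \<infinity>)"

definition nontrivial :: "(real \<Rightarrow> real \<times> real \<Rightarrow> ennreal) \<Rightarrow> bool" where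
  "nontrivial u \<longleftrightarrow> (\<exists>t\<ge>0. \<exists>x. u t x \<noteq> 0)"

definition blows_up_in_finite_time :: "(real \<Rightarrow> real \<times> real \<Rightarrow> ennreal) \<Rightarrow> bool" where
  "blows_up_in_finite_time u \<longleftrightarrow> (\<exists>T>0. \<forall>t>T. \<forall>x. u t x = \<infinity>)"

end

theory Submission
  imports Defs
begin

text \<open>
  Everything rests on three facts about the heat kernel. Write \<open>B(r)\<close> for the box
  \<open>[-\<surd>r, \<surd>r] \<times> [-r, r]\<close>. These boxes are permuted by the Grushin scaling
  \<open>(t, x\<^sub>1, x\<^sub>2) \<mapsto> (\<lambda>\<^sup>2t, \<lambda>x\<^sub>1, \<lambda>\<^sup>2x\<^sub>2)\<close>; the area of \<open>B(r)\<close> is of order \<open>r^(3/2)\<close>, and \<open>3\<close> is the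
  homogeneous dimension that makes \<open>1 + 2/3\<close> the critical exponent.

  \<^item> \<open>K(t, x, \<cdot>)\<close> has mass one (\<open>heat_kernel_mass\<close>).
  \<^item> For each \<open>\<rho> > 0\<close> there is \<open>c > 0\<close> with \<open>K(t, x, y) \<ge> c t^(-3/2)\<close> for all \<open>t > 0\<close> and \<open>x, y \<in> B(\<rho>t)\<close>
    (\<open>heat_kernel_lower_bound\<close>); in particular \<open>K > 0\<close>.
  \<^item> Started in \<open>B(T)\<close>, the diffusion is in \<open>B(T)\<close> with probability at least \<open>1/16\<close> at each time up
    to \<open>T/16\<close> (\<open>heat_kernel_stay\<close>).

  The last two come from conditioning on \<open>W\<^sub>1\<close>. Given \<open>W\<^sub>1\<close>, the Riemann sums approximating the Ito
  integral are centred Gaussian, with variance the Riemann sum of \<open>(x\<^sub>1 + W\<^sub>1(s))\<^sup>2\<close> over \<open>[0, t]\<close>. Even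
  after pinning \<open>W\<^sub>1(t)\<close> to a small interval, this variance is of order \<open>t\<^sup>2\<close> with positive
  probability; so the second coordinate has density at least of order \<open>1/t\<close> at distance of order
  \<open>t\<close>, and the first one contributes \<open>t^(-1/2)\<close>. All estimates are uniform in the
  partition, so they pass to the limit in probability (\<open>riemann_sum_limit\<close>).

  The engine of both blow-up statements is \<open>doubling_blow_up\<close>. Suppose that \<open>u \<ge> m\<close> on a set \<open>B\<close> during
  some time interval, and that the kernel, started in \<open>B\<close>, keeps a fraction \<open>c\<close> of its mass inside \<open>B\<close>.
  Then after waiting for a time \<open>2 m^(1-p) / c\<close> the Duhamel integral alone is at least \<open>2m\<close> on \<open>B\<close>. For
  \<open>p > 1\<close> the waiting times of successive doublings form a convergent geometric series, so \<open>u = \<infinity>\<close> on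
  \<open>B\<close> after a finite time of order \<open>m^(1-p)\<close>. If \<open>u\<^sub>0 \<ge> \<mu> > 0\<close>, this applies at once with \<open>B\<close> the whole
  plane.

  In the range \<open>1 < p \<le> 5/3\<close>, a nontrivial solution satisfies \<open>u(t) \<ge> a t^(-3/2)\<close> on \<open>B(t)\<close> for large
  \<open>t\<close>. Inserting this into the Duhamel integral produces the factor \<open>\<integral> s^(3/2 - 3p/2) ds\<close>, which diverges at
  least logarithmically (\<open>logarithmic_gain\<close>). Hence, for an arbitrarily large constant \<open>C\<close>,
  \<open>u(t) \<ge> C t^(-3/2)\<close> on \<open>B(t)\<close> for all \<open>t \<ge> T\<close>. Doubling on \<open>B(T)\<close> from a level \<open>m\<close> of order
  \<open>C T^(-3/2)\<close> takes a time of order \<open>C^(1-p) T^(3(p-1)/2) \<le> C^(1-p) T\<close>, which for large \<open>C\<close> fits into the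
  window \<open>[T, T + T/16]\<close> in which the third kernel fact is available. Once \<open>u = \<infinity>\<close> on a box for a
  positive time, positivity of \<open>K\<close> makes it infinite everywhere at all later times.

  For \<open>p < 1\<close> a solution is the increasing limit of Picard iterates, which the supersolution
  \<open>A e^t\<close> with \<open>A \<ge> 1 + sup u\<^sub>0\<close> keeps finite.
\<close>


section \<open>Centred Gaussian laws and Brownian motion\<close>

text \<open>Variance zero is included because a Brownian linear combination whose coefficients all
  vanish has this law.\<close>

definition centred_gaussian :: "real \<Rightarrow> real measure" where
  "centred_gaussian v =
     (if v = 0 then return borel 0 else density lborel (\<lambda>z. ennreal (normal_density 0 (sqrt v) z)))"

lemma sets_centred_gaussian [simp, measurable_cong]: "sets (centred_gaussian v) = sets borel"
  by (simp add: centred_gaussian_def)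

lemma space_centred_gaussian [simp]: "space (centred_gaussian v) = UNIV"
  by (simp add: centred_gaussian_def)

lemma prob_space_centred_gaussian: "v \<ge> 0 \<Longrightarrow> prob_space (centred_gaussian v)"
  by (auto simp: centred_gaussian_def intro!: prob_space_return prob_space_normal_density)

lemma nn_integral_centred_gaussian:
  assumes [measurable]: "f \<in> borel_measurable borel" and "v > 0"
  shows "(\<integral>\<^sup>+z. f z \<partial>centred_gaussian v) = (\<integral>\<^sup>+z. ennreal (normal_density 0 (sqrt v) z) * f z \<partial>lborel)"
  using assms(2) by (simp add: centred_gaussian_def nn_integral_density)

lemma second_moment_centred_gaussian:
  assumes "v \<ge> 0"
  shows "(\<integral>\<^sup>+z. ennreal (z\<^sup>2) \<partial>centred_gaussian v) = ennreal v"
proof (cases "v = 0")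
  case True
  then show ?thesis by (simp add: centred_gaussian_def nn_integral_return)
next
  case False
  then have v: "v > 0" using assms by simp
  have "has_bochner_integral lborel (\<lambda>z. normal_density 0 (sqrt v) z * (z - 0) ^ (2 * 1))
          (fact (2 * 1) / ((2 / (sqrt v)\<^sup>2) ^ 1 * fact 1))"
    by (rule normal_moment_even) (use v in simp)
  then have *: "has_bochner_integral lborel (\<lambda>z. normal_density 0 (sqrt v) z * z\<^sup>2) v"
    using v by simp
  have "(\<integral>\<^sup>+z. ennreal (z\<^sup>2) \<partial>centred_gaussian v) = (\<integral>\<^sup>+z. ennreal (normal_density 0 (sqrt v) z * z\<^sup>2) \<partial>lborel)"
    using v by (simp add: nn_integral_centred_gaussian ennreal_mult)
  also have "\<dots> = ennreal v"
    using * by (intro nn_integral_eq_integral[THEN trans])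
      (auto simp: has_bochner_integral_iff)
  finally show ?thesis .
qed

lemma shifted_second_moment_centred_gaussian:
  assumes "v \<ge> 0"
  shows "(\<integral>\<^sup>+z. ennreal ((x + z)\<^sup>2) \<partial>centred_gaussian v) \<le> ennreal (2 * x\<^sup>2 + 2 * v)"
proof -
  interpret prob_space "centred_gaussian v" by (rule prob_space_centred_gaussian[OF assms])
  have "(x + z)\<^sup>2 \<le> 2 * x\<^sup>2 + 2 * z\<^sup>2" for z
    using sum_squares_bound[of x z] by (simp add: power2_sum)
  then have "(\<integral>\<^sup>+z. ennreal ((x + z)\<^sup>2) \<partial>centred_gaussian v)
      \<le> (\<integral>\<^sup>+z. ennreal (2 * x\<^sup>2) + ennreal 2 * ennreal (z\<^sup>2) \<partial>centred_gaussian v)"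
    by (intro nn_integral_mono)
      (simp only: ennreal_mult[symmetric] ennreal_plus[symmetric] zero_le_power2 ennreal_leI
        zero_le_numeral mult_nonneg_nonneg)
  also have "\<dots> = ennreal (2 * x\<^sup>2) + ennreal 2 * ennreal v"
    using assms by (simp add: nn_integral_add nn_integral_cmult second_moment_centred_gaussian emeasure_space_1[simplified])
  also have "\<dots> = ennreal (2 * x\<^sup>2 + 2 * v)"
    using assms by (simp only: ennreal_mult[symmetric] ennreal_plus[symmetric] zero_le_power2
        zero_le_numeral mult_nonneg_nonneg)
  finally show ?thesis .
qed

lemma centred_gaussian_reflect:
  assumes [measurable]: "A \<in> sets borel"
  shows "emeasure (centred_gaussian v) (uminus -` A) = emeasure (centred_gaussian v) A"
proof -
  have [measurable]: "uminus -` A \<in> sets borel"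
    using measurable_sets[of uminus borel borel A] by simp
  show ?thesis
  proof (cases "v = 0")
    case True
    then show ?thesis by (simp add: centred_gaussian_def indicator_def)
  next
    case False
    have "emeasure (centred_gaussian v) A = (\<integral>\<^sup>+z. ennreal (normal_density 0 (sqrt v) z) * indicator A z \<partial>lborel)"
      using False by (simp add: centred_gaussian_def emeasure_density)
    also have "\<dots> = (\<integral>\<^sup>+z. ennreal (normal_density 0 (sqrt v) (-z)) * indicator A (-z) \<partial>lborel)"
      by (subst nn_integral_real_affine[where c="-1" and t=0]) auto
    also have "\<dots> = (\<integral>\<^sup>+z. ennreal (normal_density 0 (sqrt v) z) * indicator (uminus -` A) z \<partial>lborel)"
      by (intro nn_integral_cong) (auto simp: normal_density_def indicator_def)
    also have "\<dots> = emeasure (centred_gaussian v) (uminus -` A)"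
      using False by (simp add: centred_gaussian_def emeasure_density)
    finally show ?thesis by simp
  qed
qed

text \<open>By Chebyshev, \<open>[-\<rho>, \<rho>]\<close> has mass at least \<open>1 - v/\<rho>\<^sup>2\<close>, and by symmetry each half carries half of
  it. A one-sided interval is what remains available to a process that starts near the boundary of
  the interval in which it has to stay.\<close>

lemma centred_gaussian_one_sided:
  assumes v: "v \<ge> 0" and \<rho>: "\<rho> > 0" and A [measurable]: "A \<in> sets borel"
    and sub: "{-\<rho>..0} \<subseteq> A \<or> {0..\<rho>} \<subseteq> A"
  shows "emeasure (centred_gaussian v) A \<ge> ennreal ((1 - v / \<rho>\<^sup>2) / 2)"
proof -
  let ?G = "centred_gaussian v"
  interpret prob_space ?G by (rule prob_space_centred_gaussian[OF v])
  have split: "1 \<le> indicator {-\<rho>..0} z + indicator {0..\<rho>} z + ennreal (1 / \<rho>\<^sup>2) * ennreal (z\<^sup>2)" for z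
  proof (cases "\<bar>z\<bar> \<le> \<rho>")
    case True
    then show ?thesis by (auto simp: indicator_def split: if_splits)
  next
    case False
    then have "\<rho>\<^sup>2 \<le> z\<^sup>2" using \<rho> by (simp add: abs_le_square_iff[symmetric])
    then have "ennreal 1 \<le> ennreal (1 / \<rho>\<^sup>2 * z\<^sup>2)"
      using \<rho> by (intro ennreal_leI) (simp add: field_simps)
    then have "1 \<le> ennreal (1 / \<rho>\<^sup>2) * ennreal (z\<^sup>2)"
      using \<rho> by (simp only: ennreal_1 flip: ennreal_mult') (simp add: ennreal_mult'[symmetric])
    then show ?thesis by (simp add: add_increasing)
  qed
  have refl: "emeasure ?G {-\<rho>..0} = emeasure ?G {0..\<rho>}"
  proof -
    have "uminus -` {0..\<rho>} = {-\<rho>..0}" by auto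
    then show ?thesis using centred_gaussian_reflect[of "{0..\<rho>}" v] by simp
  qed
  have "1 = (\<integral>\<^sup>+z. 1 \<partial>?G)" using emeasure_space_1 by simp
  also have "\<dots> \<le> (\<integral>\<^sup>+z. indicator {-\<rho>..0} z + indicator {0..\<rho>} z + ennreal (1 / \<rho>\<^sup>2) * ennreal (z\<^sup>2) \<partial>?G)"
    by (intro nn_integral_mono split)
  also have "\<dots> = emeasure ?G {-\<rho>..0} + emeasure ?G {0..\<rho>} + ennreal (1 / \<rho>\<^sup>2) * ennreal v"
    by (simp add: nn_integral_add nn_integral_cmult second_moment_centred_gaussian[OF v])
  also have "\<dots> \<le> emeasure ?G A + emeasure ?G A + ennreal (1 / \<rho>\<^sup>2) * ennreal v"
    using sub refl by (metis A add_mono emeasure_mono order_refl sets_centred_gaussian)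
  also have "\<dots> = ennreal (2 * prob A + v / \<rho>\<^sup>2)"
    using v by (simp add: emeasure_eq_measure flip: ennreal_plus ennreal_mult)
  finally have "1 \<le> 2 * prob A + v / \<rho>\<^sup>2"
    by (subst (asm) ennreal_1[symmetric], subst (asm) ennreal_le_iff) (use v in auto)
  then show ?thesis by (simp add: emeasure_eq_measure ennreal_leI)
qed

text \<open>A sum of independent Gaussians; terms with zero coefficient are dropped first, since they have no
  density.\<close>

lemma brownian_linear_combination:
  assumes W: "brownian_motion M W" and \<tau>0: "0 \<le> \<tau> 0" and mono: "mono \<tau>"
    and strict: "\<And>i. i < n \<Longrightarrow> \<tau> i < \<tau> (Suc i)"
  shows "distr M borel (\<lambda>\<omega>. \<Sum>i<n. a i * (W (\<tau> (Suc i)) \<omega> - W (\<tau> i) \<omega>))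
           = centred_gaussian (\<Sum>i<n. (a i)\<^sup>2 * (\<tau> (Suc i) - \<tau> i))"
proof -
  interpret prob_space M using W by (simp add: brownian_motion_def)
  define I where "I = {i \<in> {..<n}. a i \<noteq> 0}"
  define D where "D = (\<lambda>i \<omega>. W (\<tau> (Suc i)) \<omega> - W (\<tau> i) \<omega>)"
  have \<tau>: "0 \<le> \<tau> i" for i using \<tau>0 mono by (meson le0 monoD order_trans)
  have ind: "indep_vars (\<lambda>_. borel) D {..<n}"
    using W \<tau>0 mono unfolding brownian_motion_def D_def by blast
  have S: "(\<Sum>i<n. a i * (W (\<tau> (Suc i)) \<omega> - W (\<tau> i) \<omega>)) = (\<Sum>i\<in>I. a i * D i \<omega>)" for \<omega>
    unfolding I_def D_def by (intro sum.mono_neutral_right) auto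
  have V: "(\<Sum>i<n. (a i)\<^sup>2 * (\<tau> (Suc i) - \<tau> i)) = (\<Sum>i\<in>I. (a i)\<^sup>2 * (\<tau> (Suc i) - \<tau> i))"
    unfolding I_def by (intro sum.mono_neutral_right) auto
  show ?thesis
  proof (cases "I = {}")
    case True
    then show ?thesis unfolding S V
      by (intro measure_eqI) (auto simp: centred_gaussian_def emeasure_distr indicator_def emeasure_space_1)
  next
    case False
    have fin: "finite I" by (simp add: I_def)
    have pos: "(\<Sum>i\<in>I. (a i)\<^sup>2 * (\<tau> (Suc i) - \<tau> i)) > 0"
      by (rule sum_pos[OF fin False]) (use strict in \<open>auto simp: I_def\<close>)
    have D: "distributed M lborel (D i) (\<lambda>z. ennreal (normal_density 0 (sqrt (\<tau> (Suc i) - \<tau> i)) z))" if "i < n" for i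
      using W strict[OF that] \<tau>[of i] unfolding brownian_motion_def D_def by blast
    have "distributed M lborel (\<lambda>\<omega>. \<Sum>i\<in>I. a i * D i \<omega>)
       (normal_density (\<Sum>i\<in>I. 0) (sqrt (\<Sum>i\<in>I. (\<bar>a i\<bar> * sqrt (\<tau> (Suc i) - \<tau> i))\<^sup>2)))"
    proof (rule sum_indep_normal[OF fin False])
      show "indep_vars (\<lambda>i. borel) (\<lambda>i \<omega>. a i * D i \<omega>) I"
        by (rule indep_vars_compose2[OF indep_vars_subset[OF ind]]) (auto simp: I_def)
      show "0 < \<bar>a i\<bar> * sqrt (\<tau> (Suc i) - \<tau> i)" if "i \<in> I" for i
        using that strict by (auto simp: I_def)
      show "distributed M lborel (\<lambda>\<omega>. a i * D i \<omega>) (\<lambda>x. ennreal (normal_density 0 (\<bar>a i\<bar> * sqrt (\<tau> (Suc i) - \<tau> i)) x))"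
        if "i \<in> I" for i
        using normal_density_affine[OF D[of i], of "a i" 0] that strict by (auto simp: I_def)
    qed
    also have "(\<Sum>i\<in>I. (\<bar>a i\<bar> * sqrt (\<tau> (Suc i) - \<tau> i))\<^sup>2) = (\<Sum>i\<in>I. (a i)\<^sup>2 * (\<tau> (Suc i) - \<tau> i))"
      by (intro sum.cong) (use strict in \<open>auto simp: I_def power_mult_distrib less_imp_le\<close>)
    finally have N: "distributed M lborel (\<lambda>\<omega>. \<Sum>i\<in>I. a i * D i \<omega>)
        (normal_density 0 (sqrt (\<Sum>i\<in>I. (a i)\<^sup>2 * (\<tau> (Suc i) - \<tau> i))))" by simp
    have "distr M borel (\<lambda>\<omega>. \<Sum>i\<in>I. a i * D i \<omega>) = distr M lborel (\<lambda>\<omega>. \<Sum>i\<in>I. a i * D i \<omega>)"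
      by (intro distr_cong) auto
    then show ?thesis unfolding S V using pos
      by (simp add: distributed_distr_eq_density[OF N] centred_gaussian_def)
  qed
qed

lemma brownian_marginal:
  assumes W: "brownian_motion M W" and t: "t > 0"
  shows "distr M borel (W t) = centred_gaussian t"
proof -
  have W0: "AE \<omega> in M. W 0 \<omega> = 0" and [measurable]: "W t \<in> borel_measurable M" "W 0 \<in> borel_measurable M"
    using W t by (auto simp: brownian_motion_def)
  let ?\<tau> = "\<lambda>i::nat. if i = 0 then 0 else t"
  have "distr M borel (W t) = distr M borel (\<lambda>\<omega>. \<Sum>i<1. 1 * (W (?\<tau> (Suc i)) \<omega> - W (?\<tau> i) \<omega>))"
    by (rule distr_cong_AE) (use W0 in auto)
  also have "\<dots> = centred_gaussian (\<Sum>i<1. 1\<^sup>2 * (?\<tau> (Suc i) - ?\<tau> i))"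
    by (rule brownian_linear_combination[OF W]) (use t in \<open>auto simp: mono_def\<close>)
  finally show ?thesis by simp
qed

lemma brownian_one_time:
  assumes W: "brownian_motion M W" and t: "t > 0" and [measurable]: "f \<in> borel_measurable borel"
  shows "(\<integral>\<^sup>+\<omega>. f (W t \<omega>) \<partial>M) = (\<integral>\<^sup>+z. f z \<partial>centred_gaussian t)"
proof -
  have [measurable]: "W t \<in> borel_measurable M" using W t by (simp add: brownian_motion_def)
  show ?thesis by (simp add: brownian_marginal[OF W t, symmetric] nn_integral_distr)
qed

lemma brownian_two_times:
  assumes W: "brownian_motion M W" and s: "0 < s" "s < t"
    and f [measurable]: "(\<lambda>(z, w). f z w) \<in> borel_measurable (borel \<Otimes>\<^sub>M borel)"
  shows "(\<integral>\<^sup>+\<omega>. f (W s \<omega>) (W t \<omega>) \<partial>M)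
       = (\<integral>\<^sup>+z. (\<integral>\<^sup>+w. f z (z + w) \<partial>centred_gaussian (t - s)) \<partial>centred_gaussian s)"
proof -
  interpret prob_space M using W by (simp add: brownian_motion_def)
  have W0: "AE \<omega> in M. W 0 \<omega> = 0" and [measurable]: "W t \<in> borel_measurable M" "W s \<in> borel_measurable M" "W 0 \<in> borel_measurable M"
    using W s by (auto simp: brownian_motion_def)
  let ?\<tau> = "\<lambda>i::nat. if i = 0 then 0 else if i = 1 then s else t"
  have "indep_vars (\<lambda>_. borel) (\<lambda>i \<omega>. W (?\<tau> (Suc i)) \<omega> - W (?\<tau> i) \<omega>) {..<2}"
  proof -
    have "mono ?\<tau>" using s by (auto simp: mono_def)
    have "\<forall>(n::nat) (\<tau>::nat \<Rightarrow> real). 0 \<le> \<tau> 0 \<and> mono \<tau> \<longrightarrow>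
        indep_vars (\<lambda>_. borel) (\<lambda>i \<omega>. W (\<tau> (Suc i)) \<omega> - W (\<tau> i) \<omega>) {..<n}"
      using W unfolding brownian_motion_def by blast
    from this[rule_format, of ?\<tau> 2] show ?thesis using \<open>mono ?\<tau>\<close> by simp
  qed
  \<comment> \<open>A sum over the singleton \<open>{1}\<close> turns the independent family into an independent pair.\<close>
  moreover have "{..<2} = insert 0 {1::nat}" by auto
  ultimately have "indep_var borel (\<lambda>\<omega>. W (?\<tau> (Suc 0)) \<omega> - W (?\<tau> 0) \<omega>)
      borel (\<lambda>\<omega>. \<Sum>i\<in>{1::nat}. W (?\<tau> (Suc i)) \<omega> - W (?\<tau> i) \<omega>)"
    by (intro indep_vars_sum) auto
  then have "indep_var borel (\<lambda>\<omega>. W s \<omega> - W 0 \<omega>) borel (\<lambda>\<omega>. W t \<omega> - W s \<omega>)" by simp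
  then have prod: "distr M borel (\<lambda>\<omega>. W s \<omega> - W 0 \<omega>) \<Otimes>\<^sub>M distr M borel (\<lambda>\<omega>. W t \<omega> - W s \<omega>)
      = distr M (borel \<Otimes>\<^sub>M borel) (\<lambda>\<omega>. (W s \<omega> - W 0 \<omega>, W t \<omega> - W s \<omega>))"
    by (simp add: indep_var_distribution_eq)
  have inc: "distr M borel (\<lambda>\<omega>. W r' \<omega> - W r \<omega>) = centred_gaussian (r' - r)" if "0 \<le> r" "r < r'" for r r'
  proof -
    have D: "distributed M lborel (\<lambda>\<omega>. W r' \<omega> - W r \<omega>) (\<lambda>z. ennreal (normal_density 0 (sqrt (r' - r)) z))"
      using W that unfolding brownian_motion_def by blast
    have "distr M borel (\<lambda>\<omega>. W r' \<omega> - W r \<omega>) = distr M lborel (\<lambda>\<omega>. W r' \<omega> - W r \<omega>)"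
      by (intro distr_cong) auto
    then show ?thesis using that by (simp add: distributed_distr_eq_density[OF D] centred_gaussian_def)
  qed
  have G: "prob_space (centred_gaussian (t - s))" using s by (intro prob_space_centred_gaussian) simp
  interpret G: prob_space "centred_gaussian (t - s)" by (rule G)
  have f2: "(\<lambda>p. f (fst p) (fst p + snd p)) \<in> borel_measurable (borel \<Otimes>\<^sub>M borel)"
  proof -
    have "(\<lambda>p. (fst p, fst p + snd p)) \<in> measurable (borel \<Otimes>\<^sub>M borel) (borel \<Otimes>\<^sub>M (borel :: real measure))"
      by measurable
    from measurable_compose[OF this f] show ?thesis by simp
  qed
  have "(\<integral>\<^sup>+\<omega>. f (W s \<omega>) (W t \<omega>) \<partial>M) = (\<integral>\<^sup>+\<omega>. (\<lambda>p. f (fst p) (fst p + snd p)) (W s \<omega> - W 0 \<omega>, W t \<omega> - W s \<omega>) \<partial>M)"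
    by (rule nn_integral_cong_AE) (use W0 in auto)
  also have "\<dots> = (\<integral>\<^sup>+p. f (fst p) (fst p + snd p) \<partial>(centred_gaussian s \<Otimes>\<^sub>M centred_gaussian (t - s)))"
    using prod inc[of 0 s] inc[of s t] s f2 by (simp add: nn_integral_distr)
  also have "\<dots> = (\<integral>\<^sup>+z. (\<integral>\<^sup>+w. f z (z + w) \<partial>centred_gaussian (t - s)) \<partial>centred_gaussian s)"
  proof (subst G.nn_integral_fst[symmetric])
    show "(\<lambda>p. f (fst p) (fst p + snd p)) \<in> borel_measurable (centred_gaussian s \<Otimes>\<^sub>M centred_gaussian (t - s))"
      using f2 by (simp cong: measurable_cong_sets sets_pair_measure_cong)
  qed simp
  finally show ?thesis .
qed

lemma normal_density_le_peak: "v > 0 \<Longrightarrow> normal_density 0 (sqrt v) z \<le> 1 / sqrt (2 * pi * v)"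
  by (auto simp: normal_density_def intro!: divide_right_mono)

lemma normal_density_ge:
  assumes "v > 0" "z\<^sup>2 \<le> 2 * v * k"
  shows "normal_density 0 (sqrt v) z \<ge> exp (- k) / sqrt (2 * pi * v)"
  using assms by (auto simp: normal_density_def field_simps intro!: divide_right_mono)

text \<open>One of \<open>s\<close>, \<open>r\<close> is at least \<open>(s + r)/2\<close>, and the corresponding factor is at most its peak value.\<close>

lemma normal_density_product_le:
  assumes s: "s > 0" and r: "r > 0"
  shows "normal_density 0 (sqrt s) z * normal_density 0 (sqrt r) w
       \<le> 1 / sqrt (pi * (s + r)) * (normal_density 0 (sqrt s) z + normal_density 0 (sqrt r) w)"
proof -
  let ?C = "1 / sqrt (pi * (s + r))"
  have le: "normal_density 0 (sqrt v) y \<le> ?C" if "v > 0" "2 * v \<ge> s + r" for v y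
  proof -
    have "sqrt (pi * (s + r)) \<le> sqrt (2 * pi * v)" using that by simp
    then have "1 / sqrt (2 * pi * v) \<le> ?C" using s r that by (intro divide_left_mono) auto
    then show ?thesis using normal_density_le_peak[OF that(1), of y] by linarith
  qed
  have C: "?C \<ge> 0" using s r by simp
  show ?thesis
  proof (cases "s \<ge> r")
    case True
    then have "normal_density 0 (sqrt s) z * normal_density 0 (sqrt r) w \<le> ?C * normal_density 0 (sqrt r) w"
      using s by (intro mult_right_mono le) auto
    also have "\<dots> \<le> ?C * (normal_density 0 (sqrt s) z + normal_density 0 (sqrt r) w)"
      using C by (intro mult_left_mono) auto
    finally show ?thesis .
  next
    case False
    then have "normal_density 0 (sqrt s) z * normal_density 0 (sqrt r) w \<le> normal_density 0 (sqrt s) z * ?C"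
      using r by (intro mult_left_mono le) auto
    also have "\<dots> \<le> ?C * (normal_density 0 (sqrt s) z + normal_density 0 (sqrt r) w)"
      using C by (subst mult.commute) (intro mult_left_mono, auto)
    finally show ?thesis .
  qed
qed

text \<open>A bound that does not degenerate as \<open>s\<close> approaches \<open>0\<close> or \<open>t\<close>. Bounding the joint density, a product
  of two Gaussian densities, by \<open>normal_density_product_le\<close> leaves one Brownian motion running forward
  from \<open>x\<close> and one running backward from the endpoint \<open>y \<in> A\<close>.\<close>

lemma brownian_pinned_expectation_le:
  assumes W: "brownian_motion M W" and s: "0 < s" "s < t"
    and A [measurable]: "A \<in> sets borel" and g [measurable]: "g \<in> borel_measurable borel"
  shows "(\<integral>\<^sup>+\<omega>. indicator A (x + W t \<omega>) * g (x + W s \<omega>) \<partial>M)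
     \<le> ennreal (1 / sqrt (pi * t)) * (\<integral>\<^sup>+y. indicator A y *
          ((\<integral>\<^sup>+z. g (x + z) \<partial>centred_gaussian s) + (\<integral>\<^sup>+z. g (y + z) \<partial>centred_gaussian (t - s))) \<partial>lborel)"
proof -
  let ?p = "\<lambda>v z. normal_density 0 (sqrt v) z"
  let ?r = "t - s"
  let ?C = "1 / sqrt (pi * t)"
  have r: "?r > 0" using s by simp
  have C: "?C \<ge> 0" using s by simp
  have "(\<integral>\<^sup>+\<omega>. indicator A (x + W t \<omega>) * g (x + W s \<omega>) \<partial>M)
      = (\<integral>\<^sup>+z. (\<integral>\<^sup>+w. indicator A (x + (z + w)) * g (x + z) \<partial>centred_gaussian ?r) \<partial>centred_gaussian s)"
    by (rule brownian_two_times[OF W s, of "\<lambda>z w. indicator A (x + w) * g (x + z)"]) measurable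
  also have "\<dots> = (\<integral>\<^sup>+z. ennreal (?p s z) * (\<integral>\<^sup>+w. ennreal (?p ?r w) * (indicator A (x + (z + w)) * g (x + z)) \<partial>lborel) \<partial>lborel)"
    using s r by (simp add: nn_integral_centred_gaussian)
  also have "\<dots> = (\<integral>\<^sup>+z. (\<integral>\<^sup>+y. ennreal (?p s z) * (ennreal (?p ?r (y - (x + z))) * (indicator A y * g (x + z))) \<partial>lborel) \<partial>lborel)"
  proof (intro nn_integral_cong)
    fix z :: real
    have "(\<integral>\<^sup>+y. ennreal (?p s z) * (ennreal (?p ?r (y - (x + z))) * (indicator A y * g (x + z))) \<partial>lborel)
        = ennreal (?p s z) * (\<integral>\<^sup>+y. ennreal (?p ?r (y - (x + z))) * (indicator A y * g (x + z)) \<partial>lborel)"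
      by (rule nn_integral_cmult) measurable
    also have "(\<integral>\<^sup>+y. ennreal (?p ?r (y - (x + z))) * (indicator A y * g (x + z)) \<partial>lborel)
       = (\<integral>\<^sup>+w. ennreal (?p ?r w) * (indicator A (x + (z + w)) * g (x + z)) \<partial>lborel)"
      by (subst nn_integral_real_affine[where c=1 and t="x + z"]) (auto simp: add.assoc)
    finally show "ennreal (?p s z) * (\<integral>\<^sup>+w. ennreal (?p ?r w) * (indicator A (x + (z + w)) * g (x + z)) \<partial>lborel)
      = (\<integral>\<^sup>+y. ennreal (?p s z) * (ennreal (?p ?r (y - (x + z))) * (indicator A y * g (x + z))) \<partial>lborel)" by simp
  qed
  also have "\<dots> = (\<integral>\<^sup>+y. (\<integral>\<^sup>+z. ennreal (?p s z) * (ennreal (?p ?r (y - (x + z))) * (indicator A y * g (x + z))) \<partial>lborel) \<partial>lborel)"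
    by (rule lborel_pair.Fubini') measurable
  also have "\<dots> \<le> (\<integral>\<^sup>+y. (\<integral>\<^sup>+z. ennreal ?C * (indicator A y * (ennreal (?p s z) * g (x + z) + ennreal (?p ?r (y - (x + z))) * g (x + z))) \<partial>lborel) \<partial>lborel)"
  proof (intro nn_integral_mono)
    fix y z :: real
    have "ennreal (?p s z) * (ennreal (?p ?r (y - (x + z))) * (indicator A y * g (x + z)))
       = ennreal (?p s z * ?p ?r (y - (x + z))) * (indicator A y * g (x + z))"
      by (simp add: ennreal_mult mult.assoc)
    also have "\<dots> \<le> ennreal (?C * (?p s z + ?p ?r (y - (x + z)))) * (indicator A y * g (x + z))"
      using normal_density_product_le[OF s(1) r, of z "y - (x + z)"] by (intro mult_right_mono ennreal_leI) auto
    also have "\<dots> = ennreal ?C * (indicator A y * (ennreal (?p s z) * g (x + z) + ennreal (?p ?r (y - (x + z))) * g (x + z)))"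
      using C by (simp only: ennreal_mult ennreal_plus normal_density_nonneg add_nonneg_nonneg) (simp add: algebra_simps)
    finally show "ennreal (?p s z) * (ennreal (?p ?r (y - (x + z))) * (indicator A y * g (x + z)))
      \<le> ennreal ?C * (indicator A y * (ennreal (?p s z) * g (x + z) + ennreal (?p ?r (y - (x + z))) * g (x + z)))" .
  qed
  also have "\<dots> = (\<integral>\<^sup>+y. ennreal ?C * (indicator A y * ((\<integral>\<^sup>+z. g (x + z) \<partial>centred_gaussian s) + (\<integral>\<^sup>+z. g (y + z) \<partial>centred_gaussian ?r))) \<partial>lborel)"
  proof (intro nn_integral_cong)
    fix y :: real
    have "(\<integral>\<^sup>+z. ennreal (?p ?r (y - (x + z))) * g (x + z) \<partial>lborel) = (\<integral>\<^sup>+z. ennreal (?p ?r z) * g (y + z) \<partial>lborel)"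
      by (subst nn_integral_real_affine[where c=1 and t="y - x"]) (auto simp: normal_density_def)
    then show "(\<integral>\<^sup>+z. ennreal ?C * (indicator A y * (ennreal (?p s z) * g (x + z) + ennreal (?p ?r (y - (x + z))) * g (x + z))) \<partial>lborel)
      = ennreal ?C * (indicator A y * ((\<integral>\<^sup>+z. g (x + z) \<partial>centred_gaussian s) + (\<integral>\<^sup>+z. g (y + z) \<partial>centred_gaussian ?r)))"
      using s r by (simp add: nn_integral_cmult nn_integral_add nn_integral_centred_gaussian)
  qed
  also have "\<dots> = ennreal ?C * (\<integral>\<^sup>+y. indicator A y * ((\<integral>\<^sup>+z. g (x + z) \<partial>centred_gaussian s) + (\<integral>\<^sup>+z. g (y + z) \<partial>centred_gaussian ?r)) \<partial>lborel)"
  proof (rule nn_integral_cmult)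
    have "(\<lambda>y. \<integral>\<^sup>+z. ennreal (?p ?r z) * g (y + z) \<partial>lborel) \<in> borel_measurable borel"
      by measurable
    then have [measurable]: "(\<lambda>y. \<integral>\<^sup>+z. g (y + z) \<partial>centred_gaussian ?r) \<in> borel_measurable borel"
      using r by (simp add: nn_integral_centred_gaussian)
    show "(\<lambda>y. indicator A y * ((\<integral>\<^sup>+z. g (x + z) \<partial>centred_gaussian s) + (\<integral>\<^sup>+z. g (y + z) \<partial>centred_gaussian ?r))) \<in> borel_measurable lborel"
      by measurable
  qed
  finally show ?thesis .
qed

lemma centred_gaussian_small_interval:
  assumes v: "v > 0" and r: "r \<ge> 0"
  shows "(\<integral>\<^sup>+z. indicator {-r..r} (x + z) \<partial>centred_gaussian v) \<le> ennreal (2 * r / sqrt (2 * pi * v))"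
proof -
  let ?P = "1 / sqrt (2 * pi * v)"
  have "(\<integral>\<^sup>+z. indicator {-r..r} (x + z) \<partial>centred_gaussian v)
      = (\<integral>\<^sup>+z. ennreal (normal_density 0 (sqrt v) z) * indicator {-r..r} (x + z) \<partial>lborel)"
    using v by (simp add: nn_integral_centred_gaussian)
  also have "\<dots> \<le> (\<integral>\<^sup>+z. ennreal ?P * indicator {-r-x..r-x} z \<partial>lborel)"
  proof (rule nn_integral_mono)
    fix z :: real
    have eq: "indicator {-r..r} (x + z) = (indicator {-r-x..r-x} z :: ennreal)"
      by (auto simp: indicator_def)
    show "ennreal (normal_density 0 (sqrt v) z) * indicator {-r..r} (x + z) \<le> ennreal ?P * indicator {-r-x..r-x} z"
      unfolding eq by (rule mult_right_mono[OF ennreal_leI[OF normal_density_le_peak[OF v]]]) simp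
  qed
  also have "\<dots> = ennreal ?P * emeasure lborel {-r-x..r-x}"
    by (rule nn_integral_cmult_indicator) simp
  also have "\<dots> = ennreal ?P * ennreal (2 * r)"
    using r by simp
  also have "\<dots> = ennreal (?P * (2 * r))"
    by (rule ennreal_mult[symmetric]) (use r v in auto)
  finally show ?thesis by (simp add: mult.commute)
qed


section \<open>The Riemann sums behind the second coordinate\<close>

definition grid :: "real \<Rightarrow> nat \<Rightarrow> nat \<Rightarrow> real" where
  "grid t n i = real i * t / real n"

lemma grid_0 [simp]: "grid t n 0 = 0"
  by (simp add: grid_def)

lemma grid_self [simp]: "n > 0 \<Longrightarrow> grid t n n = t"
  by (simp add: grid_def)

lemma grid_nonneg: "t \<ge> 0 \<Longrightarrow> grid t n i \<ge> 0"
  by (simp add: grid_def)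

lemma grid_step: "grid t n (Suc i) - grid t n i = t / real n"
  by (simp add: grid_def field_simps flip: diff_divide_distrib)

lemma grid_less: "t > 0 \<Longrightarrow> n > 0 \<Longrightarrow> grid t n i < grid t n (Suc i)"
  using grid_step[of t n i] by (smt (verit) divide_pos_pos of_nat_0_less_iff)

lemma mono_grid: "t \<ge> 0 \<Longrightarrow> mono (grid t n)"
  by (auto simp: mono_def grid_def intro!: divide_right_mono mult_right_mono)

definition riemann_sum ::
  "(real \<Rightarrow> 'w \<Rightarrow> real) \<Rightarrow> (real \<Rightarrow> 'w \<Rightarrow> real) \<Rightarrow> real \<Rightarrow> real \<Rightarrow> nat \<Rightarrow> 'w \<Rightarrow> real" where
  "riemann_sum W1 W2 a t n \<omega> =
     (\<Sum>i<n. (a + W1 (grid t n i) \<omega>) * (W2 (grid t n (Suc i)) \<omega> - W2 (grid t n i) \<omega>))"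

text \<open>The variance of the Riemann sum conditionally on \<open>W\<^sub>1\<close>.\<close>

definition riemann_variance :: "(real \<Rightarrow> 'w \<Rightarrow> real) \<Rightarrow> real \<Rightarrow> real \<Rightarrow> nat \<Rightarrow> 'w \<Rightarrow> real" where
  "riemann_variance W1 a t n \<omega> = (\<Sum>i<n. (a + W1 (grid t n i) \<omega>)\<^sup>2 * (t / real n))"

lemma brownian_measurable: "brownian_motion M W \<Longrightarrow> t \<ge> 0 \<Longrightarrow> W t \<in> borel_measurable M"
  by (simp add: brownian_motion_def)

lemma riemann_sum_measurable:
  assumes "brownian_motion M W1" "brownian_motion M W2" "t \<ge> 0"
  shows "riemann_sum W1 W2 a t n \<in> borel_measurable M"
proof -
  have [measurable]: "W1 (grid t n i) \<in> borel_measurable M" "W2 (grid t n i) \<in> borel_measurable M" for i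
    using assms by (auto intro!: brownian_measurable grid_nonneg)
  show ?thesis unfolding riemann_sum_def by measurable
qed

lemma riemann_variance_measurable:
  assumes "brownian_motion M W1" "t \<ge> 0"
  shows "riemann_variance W1 a t n \<in> borel_measurable M"
proof -
  have [measurable]: "W1 (grid t n i) \<in> borel_measurable M" for i
    using assms by (auto intro!: brownian_measurable grid_nonneg)
  show ?thesis unfolding riemann_variance_def by measurable
qed

text \<open>By independence the joint law of the two path vectors is a product measure, so \<open>W\<^sub>1\<close> may be frozen;
  the Riemann sum is then a linear combination of increments of \<open>W\<^sub>2\<close>, whose law is Gaussian. The
  function \<open>h\<close> is any convenient measurable minorant of the conditional probability.\<close>

lemma conditional_gaussian_lower_bound:
  assumes W1: "brownian_motion M W1" and W2: "brownian_motion M W2"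
    and ind: "independent_processes M W1 W2"
    and t: "t > 0" and n: "n > 0"
    and A [measurable]: "A \<in> sets borel" and B [measurable]: "B \<in> sets borel"
    and h [measurable]: "h \<in> borel_measurable borel"
    and hB: "\<And>v. v \<ge> 0 \<Longrightarrow> h v \<le> emeasure (centred_gaussian v) B"
  shows "(\<integral>\<^sup>+\<omega>. indicator A (W1 t \<omega>) * h (riemann_variance W1 a t n \<omega>) \<partial>M)
       \<le> emeasure M {\<omega> \<in> space M. W1 t \<omega> \<in> A \<and> riemann_sum W1 W2 a t n \<omega> \<in> B}"
proof -
  interpret prob_space M using W1 by (simp add: brownian_motion_def)
  let ?P = "Pi\<^sub>M {0::real..} (\<lambda>_. borel :: real measure)"
  let ?V = "\<lambda>\<omega>. \<lambda>s\<in>{0..}. W1 s \<omega>" and ?W = "\<lambda>\<omega>. \<lambda>s\<in>{0..}. W2 s \<omega>"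
  let ?\<tau> = "grid t n"
  have \<tau>: "?\<tau> i \<in> {0..}" for i using t by (simp add: grid_nonneg)
  have tin: "t \<in> {0..}" using t by simp
  have V [measurable]: "?V \<in> measurable M ?P" and W [measurable]: "?W \<in> measurable M ?P"
    and prod: "distr M ?P ?V \<Otimes>\<^sub>M distr M ?P ?W = distr M (?P \<Otimes>\<^sub>M ?P) (\<lambda>\<omega>. (?V \<omega>, ?W \<omega>))"
    using ind unfolding independent_processes_def indep_var_distribution_eq by auto
  interpret DW: prob_space "distr M ?P ?W" by (rule prob_space_distr[OF W])
  have comp [measurable]: "(\<lambda>f. f (?\<tau> i)) \<in> borel_measurable ?P" "(\<lambda>f. f t) \<in> borel_measurable ?P" for i
    using measurable_component_singleton[OF \<tau>, of _ "\<lambda>_. borel"] measurable_component_singleton[OF tin, of "\<lambda>_. borel"] by auto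
  define E where "E = {p \<in> space (?P \<Otimes>\<^sub>M ?P). fst p t \<in> A \<and>
      (\<Sum>i<n. (a + fst p (?\<tau> i)) * (snd p (?\<tau> (Suc i)) - snd p (?\<tau> i))) \<in> B}"
  have [measurable]: "(\<lambda>p. fst p (?\<tau> i)) \<in> borel_measurable (?P \<Otimes>\<^sub>M ?P)"
      "(\<lambda>p. snd p (?\<tau> i)) \<in> borel_measurable (?P \<Otimes>\<^sub>M ?P)"
      "(\<lambda>p. fst p t) \<in> borel_measurable (?P \<Otimes>\<^sub>M ?P)" for i
    by (rule measurable_compose[OF measurable_fst comp(1)] measurable_compose[OF measurable_snd comp(1)]
        measurable_compose[OF measurable_fst comp(2)])+
  have E [measurable]: "E \<in> sets (?P \<Otimes>\<^sub>M ?P)"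
    unfolding E_def by measurable
  have spV: "?V \<omega> \<in> space ?P" and spW: "?W \<omega> \<in> space ?P" if "\<omega> \<in> space M" for \<omega>
    using measurable_space[OF V that] measurable_space[OF W that] by auto
  have "emeasure M {\<omega> \<in> space M. W1 t \<omega> \<in> A \<and> riemann_sum W1 W2 a t n \<omega> \<in> B}
      = emeasure (distr M (?P \<Otimes>\<^sub>M ?P) (\<lambda>\<omega>. (?V \<omega>, ?W \<omega>))) E"
    using \<tau> tin spV spW unfolding E_def riemann_sum_def
    by (subst emeasure_distr) (auto intro!: arg_cong[where f="emeasure M"] simp: space_pair_measure E_def[symmetric])
  also have "\<dots> = emeasure (distr M ?P ?V \<Otimes>\<^sub>M distr M ?P ?W) E"
    by (simp add: prod)
  also have "\<dots> = (\<integral>\<^sup>+f. emeasure (distr M ?P ?W) (Pair f -` E) \<partial>distr M ?P ?V)"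
    by (rule DW.emeasure_pair_measure_alt) (simp add: E)
  also have "\<dots> = (\<integral>\<^sup>+\<omega>. emeasure (distr M ?P ?W) (Pair (?V \<omega>) -` E) \<partial>M)"
  proof (rule nn_integral_distr[OF V])
    have "E \<in> sets (?P \<Otimes>\<^sub>M distr M ?P ?W)"
      using E by (simp cong: sets_pair_measure_cong)
    then show "(\<lambda>f. emeasure (distr M ?P ?W) (Pair f -` E)) \<in> borel_measurable (distr M ?P ?V)"
      using DW.measurable_emeasure_Pair[of E "?P"] by simp
  qed
  also have "\<dots> \<ge> (\<integral>\<^sup>+\<omega>. indicator A (W1 t \<omega>) * h (riemann_variance W1 a t n \<omega>) \<partial>M)"
  proof (rule nn_integral_mono)
    fix \<omega> assume \<omega>: "\<omega> \<in> space M"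
    define b where "b i = a + W1 (?\<tau> i) \<omega>" for i
    show "indicator A (W1 t \<omega>) * h (riemann_variance W1 a t n \<omega>) \<le> emeasure (distr M ?P ?W) (Pair (?V \<omega>) -` E)"
    proof (cases "W1 t \<omega> \<in> A")
      case True
      have [measurable]: "W2 (?\<tau> i) \<in> borel_measurable M" for i
        using W2 \<tau>[of i] by (simp add: brownian_motion_def)
      have var: "riemann_variance W1 a t n \<omega> = (\<Sum>i<n. (b i)\<^sup>2 * (?\<tau> (Suc i) - ?\<tau> i))"
        by (simp add: riemann_variance_def b_def grid_step)
      have "indicator A (W1 t \<omega>) * h (riemann_variance W1 a t n \<omega>)
          \<le> emeasure (centred_gaussian (riemann_variance W1 a t n \<omega>)) B"
        using True t by (auto intro!: hB simp: riemann_variance_def sum_nonneg)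
      also have "\<dots> = emeasure (distr M borel (\<lambda>\<omega>'. \<Sum>i<n. b i * (W2 (?\<tau> (Suc i)) \<omega>' - W2 (?\<tau> i) \<omega>'))) B"
        unfolding var
        by (subst brownian_linear_combination[OF W2]) (use t n in \<open>auto simp: grid_less intro!: mono_grid\<close>)
      also have "\<dots> = emeasure M {\<omega>' \<in> space M. (\<Sum>i<n. b i * (W2 (?\<tau> (Suc i)) \<omega>' - W2 (?\<tau> i) \<omega>')) \<in> B}"
        by (subst emeasure_distr) (auto intro!: arg_cong[where f="emeasure M"])
      also have "\<dots> = emeasure (distr M ?P ?W) (Pair (?V \<omega>) -` E)"
      proof (subst emeasure_distr[OF W])
        show "Pair (?V \<omega>) -` E \<in> sets ?P"
          using sets_Pair1[OF E] .
        show "emeasure M {\<omega>' \<in> space M. (\<Sum>i<n. b i * (W2 (?\<tau> (Suc i)) \<omega>' - W2 (?\<tau> i) \<omega>')) \<in> B}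
            = emeasure M (?W -` (Pair (?V \<omega>) -` E) \<inter> space M)"
          using \<tau> tin True spV[OF \<omega>] spW unfolding E_def b_def
          by (intro arg_cong[where f="emeasure M"]) (auto simp: space_pair_measure)
      qed
      finally show ?thesis .
    qed simp
  qed
  finally show ?thesis .
qed

text \<open>Probabilities of closed intervals are upper semicontinuous under convergence in probability:
  enlarging the interval by \<open>\<epsilon>\<close> accounts for all paths except those on which Riemann sum and Ito integral
  differ by more than \<open>\<epsilon>\<close>; then \<open>\<epsilon> \<rightarrow> 0\<close>.\<close>

lemma riemann_sum_limit:
  assumes W1: "brownian_motion M W1" and W2: "brownian_motion M W2"
    and X: "grushin_diffusion M W1 W2 x X" and t: "t > 0"
    and A [measurable]: "A \<in> sets borel"
    and q: "\<And>m. \<exists>n\<ge>m. n > 0 \<and> q \<le> measure M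
        {\<omega> \<in> space M. fst x + W1 t \<omega> \<in> A \<and> snd x + riemann_sum W1 W2 (fst x) t n \<omega> \<in> {a..b}}"
  shows "q \<le> measure M {\<omega> \<in> space M. fst (X t \<omega>) \<in> A \<and> snd (X t \<omega>) \<in> {a..b}}"
proof -
  interpret prob_space M using W1 by (simp add: brownian_motion_def)
  have [measurable]: "W1 t \<in> borel_measurable M" "riemann_sum W1 W2 (fst x) t n \<in> borel_measurable M" for n
    using W1 W2 t by (auto intro!: brownian_measurable[OF W1] riemann_sum_measurable[OF W1 W2])
  have Xm: "X s \<in> borel_measurable M" if "s \<ge> 0" for s
    using X that by (simp add: grushin_diffusion_def)
  have X1m [measurable]: "(\<lambda>\<omega>. fst (X s \<omega>)) \<in> borel_measurable M" and X2m [measurable]: "(\<lambda>\<omega>. snd (X s \<omega>)) \<in> borel_measurable M"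
    if "s \<ge> 0" for s
    using measurable_compose[OF Xm[OF that] borel_measurable_continuous_onI[OF continuous_on_fst[OF continuous_on_id]]]
      measurable_compose[OF Xm[OF that] borel_measurable_continuous_onI[OF continuous_on_snd[OF continuous_on_id]]] by auto
  have [measurable]: "(\<lambda>\<omega>. fst (X t \<omega>)) \<in> borel_measurable M" "(\<lambda>\<omega>. snd (X t \<omega>)) \<in> borel_measurable M"
    using t X1m X2m by auto
  have X1: "AE \<omega> in M. \<forall>s\<ge>0. fst (X s \<omega>) = fst x + W1 s \<omega>"
    using X by (simp add: grushin_diffusion_def)
  let ?S = "\<lambda>\<epsilon>. {\<omega> \<in> space M. fst (X t \<omega>) \<in> A \<and> snd (X t \<omega>) \<in> {a - \<epsilon>..b + \<epsilon>}}"
  have approx: "q \<le> measure M (?S \<epsilon>) + \<epsilon>" if \<epsilon>: "\<epsilon> > 0" for \<epsilon>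
  proof -
    let ?I = "\<lambda>\<tau> n \<omega>. \<Sum>i<n. fst (X (\<tau> i) \<omega>) * (W2 (\<tau> (Suc i)) \<omega> - W2 (\<tau> i) \<omega>)"
    have "is_ito_integral M (\<lambda>s \<omega>. fst (X s \<omega>)) W2 t (\<lambda>\<omega>. snd (X t \<omega>) - snd x)"
      using X t by (simp add: grushin_diffusion_def)
    then obtain \<delta> where \<delta>: "\<delta> > 0" and ito: "\<And>n \<tau>. \<tau> 0 = 0 \<Longrightarrow> \<tau> n = t \<Longrightarrow>
        (\<forall>i<n. \<tau> i \<le> \<tau> (Suc i) \<and> \<tau> (Suc i) - \<tau> i < \<delta>) \<Longrightarrow>
        measure M {\<omega> \<in> space M. \<bar>?I \<tau> n \<omega> - (snd (X t \<omega>) - snd x)\<bar> > \<epsilon>} < \<epsilon>"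
      unfolding is_ito_integral_def using \<epsilon> by blast
    obtain m :: nat where m: "t / \<delta> < real m" using reals_Archimedean2 by blast
    obtain n where n: "n \<ge> m" "n > 0" and qn: "q \<le> measure M
        {\<omega> \<in> space M. fst x + W1 t \<omega> \<in> A \<and> snd x + riemann_sum W1 W2 (fst x) t n \<omega> \<in> {a..b}}"
      using q by blast
    have "t / \<delta> < real n" using m n by simp
    then have mesh: "t / real n < \<delta>" using \<delta> n t by (simp add: field_simps)
    let ?\<tau> = "grid t n"
    let ?bad = "{\<omega> \<in> space M. \<bar>?I ?\<tau> n \<omega> - (snd (X t \<omega>) - snd x)\<bar> > \<epsilon>}"
    have bad: "measure M ?bad < \<epsilon>"
      by (rule ito) (use n t mesh grid_less[OF t n(2)] in \<open>auto simp: grid_step less_imp_le\<close>)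
    have [measurable]: "(\<lambda>\<omega>. fst (X (?\<tau> i) \<omega>)) \<in> borel_measurable M" "W2 (?\<tau> i) \<in> borel_measurable M" for i
      using t W2 by (auto intro!: X1m brownian_measurable[OF W2] grid_nonneg)
    have badm: "?bad \<in> sets M" by measurable
    have "q \<le> measure M {\<omega> \<in> space M. fst x + W1 t \<omega> \<in> A \<and> snd x + riemann_sum W1 W2 (fst x) t n \<omega> \<in> {a..b}}"
      by (rule qn)
    also have "\<dots> \<le> measure M (?S \<epsilon> \<union> ?bad)"
    proof (rule finite_measure_mono_AE)
      show "AE \<omega> in M. \<omega> \<in> {\<omega> \<in> space M. fst x + W1 t \<omega> \<in> A \<and> snd x + riemann_sum W1 W2 (fst x) t n \<omega> \<in> {a..b}}
          \<longrightarrow> \<omega> \<in> ?S \<epsilon> \<union> ?bad"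
        using X1
      proof eventually_elim
        case (elim \<omega>)
        have "?I ?\<tau> n \<omega> = riemann_sum W1 W2 (fst x) t n \<omega>"
          unfolding riemann_sum_def by (intro sum.cong) (use elim t in \<open>auto simp: grid_nonneg\<close>)
        then show ?case using elim t by (auto simp: abs_le_iff)
      qed
      show "?S \<epsilon> \<union> ?bad \<in> sets M"
        by (intro sets.Un badm) measurable
    qed
    also have "\<dots> \<le> measure M (?S \<epsilon>) + measure M ?bad"
      by (intro measure_Un_le badm) measurable
    finally show ?thesis using bad by simp
  qed
  \<comment> \<open>Let \<open>\<epsilon> = 1/(k + 1)\<close> tend to zero, using continuity from above.\<close>
  let ?e = "\<lambda>k. 1 / real (Suc k)"
  have "(\<lambda>k. measure M (?S (?e k))) \<longlonglongrightarrow> measure M (\<Inter>k. ?S (?e k))"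
  proof (rule finite_Lim_measure_decseq)
    show "range (\<lambda>k. ?S (?e k)) \<subseteq> sets M" by auto
    show "decseq (\<lambda>k. ?S (?e k))"
    proof (rule decseq_SucI)
      fix k
      have "?e (Suc k) \<le> ?e k" by (simp add: field_simps)
      then show "?S (?e (Suc k)) \<subseteq> ?S (?e k)" by (auto intro: order_trans)
    qed
  qed
  also have "(\<Inter>k. ?S (?e k)) = ?S 0"
  proof (intro subset_antisym subsetI)
    fix \<omega> assume \<omega>: "\<omega> \<in> (\<Inter>k. ?S (?e k))"
    have "(\<lambda>k. ?e k) \<longlonglongrightarrow> 0" by (rule LIMSEQ_inverse_real_of_nat[unfolded inverse_eq_divide])
    then have "(\<lambda>k. a - ?e k) \<longlonglongrightarrow> a - 0" "(\<lambda>k. b + ?e k) \<longlonglongrightarrow> b + 0"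
      by (intro tendsto_intros; simp)+
    then have "a - 0 \<le> snd (X t \<omega>)" "snd (X t \<omega>) \<le> b + 0"
      using \<omega> by (auto intro: LIMSEQ_le_const2 LIMSEQ_le_const)
    then show "\<omega> \<in> ?S 0" using \<omega> by auto
  qed (auto intro: order_trans[of "a - _" a] order_trans[of _ b])
  finally have lim: "(\<lambda>k. measure M (?S (?e k)) + ?e k) \<longlonglongrightarrow> measure M (?S 0) + 0"
    by (intro tendsto_add LIMSEQ_inverse_real_of_nat[unfolded inverse_eq_divide])
  have "q \<le> measure M (?S 0) + 0"
    by (rule LIMSEQ_le_const[OF lim], intro exI[of _ 0] allI impI approx) simp
  then show ?thesis by simp
qed


section \<open>Pinned Brownian motion and the conditional variance\<close>

lemma ennreal_le_addD:
  assumes "ennreal a \<le> E + ennreal b" "b \<ge> 0"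
  shows "ennreal (a - b) \<le> E"
proof (cases E)
  case (real e)
  then have "ennreal a \<le> ennreal (e + b)" using assms by simp
  then have "a \<le> e + b" using real assms by (subst (asm) ennreal_le_iff) auto
  then show ?thesis using real by (auto intro: ennreal_leI)
qed simp

lemma one_div_sqrt_pi_le: "t > 0 \<Longrightarrow> 1 / sqrt (pi * t) \<le> 1 / sqrt t"
proof -
  assume t: "t > 0"
  have "1 * t \<le> pi * t" using t pi_ge_two by (intro mult_right_mono) auto
  then have "sqrt t \<le> sqrt (pi * t)" by simp
  then show ?thesis using t by (intro divide_left_mono) auto
qed

lemma brownian_start:
  assumes "brownian_motion M W"
  shows "AE \<omega> in M. W 0 \<omega> = 0"
  using assms by (simp add: brownian_motion_def)

lemma brownian_window_ge:
  assumes W: "brownian_motion M W" and t: "t > 0" and lu: "l \<le> u"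
    and x: "x\<^sup>2 \<le> \<rho> * t" and A: "\<And>y. y \<in> {l..u} \<Longrightarrow> y\<^sup>2 \<le> \<rho> * t"
  shows "ennreal (exp (- (2 * \<rho>)) / sqrt (2 * pi) * ((u - l) / sqrt t)) \<le> (\<integral>\<^sup>+\<omega>. indicator {l..u} (x + W t \<omega>) \<partial>M)"
proof -
  let ?c = "exp (- (2 * \<rho>)) / sqrt (2 * pi * t)"
  have "ennreal (exp (- (2 * \<rho>)) / sqrt (2 * pi) * ((u - l) / sqrt t)) = ennreal (?c * (u - l))"
    by (simp add: real_sqrt_mult)
  also have "\<dots> = ennreal ?c * ennreal (u - l)" using lu t by (intro ennreal_mult) auto
  also have "\<dots> = ennreal ?c * emeasure lborel {l - x..u - x}" using lu by simp
  also have "\<dots> = (\<integral>\<^sup>+z. ennreal ?c * indicator {l - x..u - x} z \<partial>lborel)"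
    by (rule nn_integral_cmult_indicator[symmetric]) simp
  also have "\<dots> \<le> (\<integral>\<^sup>+z. ennreal (normal_density 0 (sqrt t) z) * indicator {l..u} (x + z) \<partial>lborel)"
  proof (rule nn_integral_mono)
    fix z
    show "ennreal ?c * indicator {l - x..u - x} z \<le> ennreal (normal_density 0 (sqrt t) z) * indicator {l..u} (x + z)"
    proof (cases "z \<in> {l - x..u - x}")
      case True
      then have "(x + z)\<^sup>2 \<le> \<rho> * t" by (intro A) auto
      moreover have "z\<^sup>2 \<le> 2 * (x + z)\<^sup>2 + 2 * x\<^sup>2"
        using zero_le_power2[of "2 * x + z"] by (simp add: power2_eq_square algebra_simps)
      ultimately have "z\<^sup>2 \<le> 2 * t * (2 * \<rho>)" using x by (simp add: algebra_simps)
      then have "?c \<le> normal_density 0 (sqrt t) z" using normal_density_ge[OF t, of z "2 * \<rho>"] by simp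
      then show ?thesis using True by (auto simp: indicator_def intro: ennreal_leI)
    qed simp
  qed
  also have "\<dots> = (\<integral>\<^sup>+\<omega>. indicator {l..u} (x + W t \<omega>) \<partial>M)"
    using t by (subst brownian_one_time[OF W t, of "\<lambda>z. indicator {l..u} (x + z)"]) (simp_all add: nn_integral_centred_gaussian)
  finally show ?thesis .
qed

lemma brownian_window_le:
  assumes W: "brownian_motion M W" and t: "t > 0" and lu: "l \<le> u"
  shows "(\<integral>\<^sup>+\<omega>. indicator {l..u} (x + W t \<omega>) \<partial>M) \<le> ennreal ((u - l) / sqrt t)"
proof -
  let ?c = "1 / sqrt (2 * pi * t)"
  have "(\<integral>\<^sup>+\<omega>. indicator {l..u} (x + W t \<omega>) \<partial>M) = (\<integral>\<^sup>+z. ennreal (normal_density 0 (sqrt t) z) * indicator {l..u} (x + z) \<partial>lborel)"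
    using t by (subst brownian_one_time[OF W t, of "\<lambda>z. indicator {l..u} (x + z)"]) (simp_all add: nn_integral_centred_gaussian)
  also have "\<dots> \<le> (\<integral>\<^sup>+z. ennreal (1 / sqrt t) * indicator {l - x..u - x} z \<partial>lborel)"
  proof (rule nn_integral_mono)
    fix z
    have eq: "indicator {l..u} (x + z) = (indicator {l - x..u - x} z :: ennreal)"
      by (auto simp: indicator_def)
    have "sqrt t \<le> sqrt (2 * pi * t)" using t pi_ge_two by simp
    then have "?c \<le> 1 / sqrt t" using t by (intro divide_left_mono) auto
    then have "normal_density 0 (sqrt t) z \<le> 1 / sqrt t"
      using normal_density_le_peak[OF t, of z] by linarith
    then show "ennreal (normal_density 0 (sqrt t) z) * indicator {l..u} (x + z) \<le> ennreal (1 / sqrt t) * indicator {l - x..u - x} z"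
      unfolding eq by (intro mult_right_mono ennreal_leI) auto
  qed
  also have "\<dots> = ennreal (1 / sqrt t) * emeasure lborel {l - x..u - x}"
    by (rule nn_integral_cmult_indicator) simp
  also have "\<dots> = ennreal (1 / sqrt t) * ennreal (u - l)" using lu by simp
  also have "\<dots> = ennreal (1 / sqrt t * (u - l))"
    by (rule ennreal_mult[symmetric]) (use lu t in auto)
  finally show ?thesis by simp
qed

lemma brownian_pinned_expectation_le_const:
  assumes W: "brownian_motion M W" and s: "0 < s" "s < t" and lu: "l \<le> u"
    and g [measurable]: "g \<in> borel_measurable borel" and b: "b \<ge> 0"
    and gx: "(\<integral>\<^sup>+z. g (x + z) \<partial>centred_gaussian s) \<le> ennreal b"
    and gy: "\<And>y. y \<in> {l..u} \<Longrightarrow> (\<integral>\<^sup>+z. g (y + z) \<partial>centred_gaussian (t - s)) \<le> ennreal b"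
  shows "(\<integral>\<^sup>+\<omega>. indicator {l..u} (x + W t \<omega>) * g (x + W s \<omega>) \<partial>M) \<le> ennreal (2 * b * ((u - l) / sqrt t))"
proof -
  have t: "t > 0" using s by simp
  have "(\<integral>\<^sup>+\<omega>. indicator {l..u} (x + W t \<omega>) * g (x + W s \<omega>) \<partial>M)
     \<le> ennreal (1 / sqrt (pi * t)) * (\<integral>\<^sup>+y. indicator {l..u} y *
          ((\<integral>\<^sup>+z. g (x + z) \<partial>centred_gaussian s) + (\<integral>\<^sup>+z. g (y + z) \<partial>centred_gaussian (t - s))) \<partial>lborel)"
    by (rule brownian_pinned_expectation_le[OF W s _ g]) simp
  also have "\<dots> \<le> ennreal (1 / sqrt t) * (\<integral>\<^sup>+y. ennreal (2 * b) * indicator {l..u} y \<partial>lborel)"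
  proof (rule mult_mono[OF _ nn_integral_mono])
    fix y
    show "indicator {l..u} y * ((\<integral>\<^sup>+z. g (x + z) \<partial>centred_gaussian s) + (\<integral>\<^sup>+z. g (y + z) \<partial>centred_gaussian (t - s)))
        \<le> ennreal (2 * b) * indicator {l..u} y"
    proof (cases "y \<in> {l..u}")
      case True
      have "(\<integral>\<^sup>+z. g (x + z) \<partial>centred_gaussian s) + (\<integral>\<^sup>+z. g (y + z) \<partial>centred_gaussian (t - s)) \<le> ennreal b + ennreal b"
        by (rule add_mono[OF gx gy[OF True]])
      also have "\<dots> = ennreal (2 * b)" using b by (simp flip: ennreal_plus)
      finally show ?thesis using True by simp
    qed simp
    show "ennreal (1 / sqrt (pi * t)) \<le> ennreal (1 / sqrt t)"
      by (intro ennreal_leI one_div_sqrt_pi_le t)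
  qed simp_all
  also have "(\<integral>\<^sup>+y. ennreal (2 * b) * indicator {l..u} y \<partial>lborel) = ennreal (2 * b) * emeasure lborel {l..u}"
    by (rule nn_integral_cmult_indicator) simp
  also have "\<dots> = ennreal (2 * b) * ennreal (u - l)" using lu by simp
  also have "\<dots> = ennreal (2 * b * (u - l))" by (rule ennreal_mult[symmetric]) (use lu b in auto)
  also have "ennreal (1 / sqrt t) * ennreal (2 * b * (u - l)) = ennreal (1 / sqrt t * (2 * b * (u - l)))"
    by (rule ennreal_mult[symmetric]) (use lu b t in auto)
  finally show ?thesis by simp
qed

text \<open>The pinned bound with \<open>g(z) = z\<^sup>2\<close>. Averaged over the grid, it shows that the conditional variance is
  rarely much larger than \<open>t\<^sup>2\<close>.\<close>

lemma brownian_pinned_square_le: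
  assumes W: "brownian_motion M W" and s: "0 \<le> s" "s < t" and lu: "l \<le> u"
    and x: "x\<^sup>2 \<le> \<rho> * t" and A: "\<And>y. y \<in> {l..u} \<Longrightarrow> y\<^sup>2 \<le> \<rho> * t"
  shows "(\<integral>\<^sup>+\<omega>. indicator {l..u} (x + W t \<omega>) * ennreal ((x + W s \<omega>)\<^sup>2) \<partial>M)
       \<le> ennreal (4 * (\<rho> + 1) * t * ((u - l) / sqrt t))"
proof (cases "s = 0")
  case True
  have t: "t > 0" using s by simp
  have [measurable]: "W t \<in> borel_measurable M" using W t by (simp add: brownian_motion_def)
  have "(\<integral>\<^sup>+\<omega>. indicator {l..u} (x + W t \<omega>) * ennreal ((x + W s \<omega>)\<^sup>2) \<partial>M)
      = (\<integral>\<^sup>+\<omega>. ennreal (x\<^sup>2) * indicator {l..u} (x + W t \<omega>) \<partial>M)"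
    by (rule nn_integral_cong_AE) (use brownian_start[OF W] True in \<open>auto simp: mult.commute\<close>)
  also have "\<dots> = ennreal (x\<^sup>2) * (\<integral>\<^sup>+\<omega>. indicator {l..u} (x + W t \<omega>) \<partial>M)"
    by (rule nn_integral_cmult) measurable
  also have "\<dots> \<le> ennreal (\<rho> * t) * ennreal ((u - l) / sqrt t)"
    by (intro mult_mono ennreal_leI x brownian_window_le[OF W t lu]) auto
  also have "\<dots> = ennreal (\<rho> * t * ((u - l) / sqrt t))"
    by (rule ennreal_mult[symmetric]) (use lu t x order_trans[OF zero_le_power2 x] in auto)
  also have "\<dots> \<le> ennreal (4 * (\<rho> + 1) * t * ((u - l) / sqrt t))"
  proof (rule ennreal_leI, rule mult_right_mono)
    show "\<rho> * t \<le> 4 * (\<rho> + 1) * t"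
      using t order_trans[OF zero_le_power2 x] by (simp add: algebra_simps)
  qed (use t lu in auto)
  finally show ?thesis .
next
  case False
  then have s': "0 < s" using s by simp
  have t: "t > 0" using s by simp
  have \<rho>t: "0 \<le> \<rho> * t" using order_trans[OF zero_le_power2 x] .
  have "(\<integral>\<^sup>+\<omega>. indicator {l..u} (x + W t \<omega>) * ennreal ((x + W s \<omega>)\<^sup>2) \<partial>M)
      \<le> ennreal (2 * (2 * (\<rho> + 1) * t) * ((u - l) / sqrt t))"
  proof (rule brownian_pinned_expectation_le_const[OF W s' s(2) lu, where g="\<lambda>z. ennreal (z\<^sup>2)"])
    show "0 \<le> 2 * (\<rho> + 1) * t" using t \<rho>t by (simp add: algebra_simps)
    show "(\<integral>\<^sup>+z. ennreal ((x + z)\<^sup>2) \<partial>centred_gaussian s) \<le> ennreal (2 * (\<rho> + 1) * t)"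
      using x s by (intro order_trans[OF shifted_second_moment_centred_gaussian] ennreal_leI) (auto simp: algebra_simps)
    show "(\<integral>\<^sup>+z. ennreal ((y + z)\<^sup>2) \<partial>centred_gaussian (t - s)) \<le> ennreal (2 * (\<rho> + 1) * t)" if "y \<in> {l..u}" for y
      using A[OF that] s by (intro order_trans[OF shifted_second_moment_centred_gaussian] ennreal_leI) (auto simp: algebra_simps)
  qed simp
  moreover have "2 * (2 * (\<rho> + 1) * t) * ((u - l) / sqrt t) = 4 * (\<rho> + 1) * t * ((u - l) / sqrt t)" by simp
  ultimately show ?thesis by (simp only:)
qed

text \<open>In the middle half of \<open>[0, t]\<close> the pinned path is rarely within \<open>\<eta>\<surd>t\<close> of the degeneracy line
  \<open>x\<^sub>1 = 0\<close>; this keeps the conditional variance from being much smaller than \<open>t\<^sup>2\<close>.\<close>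

lemma brownian_pinned_near_zero_le:
  assumes W: "brownian_motion M W" and s: "t / 4 \<le> s" "s \<le> 3 * t / 4" and t: "t > 0" and lu: "l \<le> u" and \<eta>: "\<eta> \<ge> 0"
  shows "(\<integral>\<^sup>+\<omega>. indicator {l..u} (x + W t \<omega>) * indicator {-(\<eta> * sqrt t)..\<eta> * sqrt t} (x + W s \<omega>) \<partial>M)
       \<le> ennreal (4 * \<eta> * ((u - l) / sqrt t))"
proof -
  have small: "(\<integral>\<^sup>+z. indicator {-(\<eta> * sqrt t)..\<eta> * sqrt t} (y + z) \<partial>centred_gaussian v) \<le> ennreal (2 * \<eta>)"
    if v: "v \<ge> t / 4" for y v
  proof -
    have "t \<le> 2 * pi * (t / 4)" using t pi_ge_two by simp
    also have "\<dots> \<le> 2 * pi * v" using v by (intro mult_left_mono) auto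
    finally have "sqrt t \<le> sqrt (2 * pi * v)" by simp
    then have "2 * (\<eta> * sqrt t) / sqrt (2 * pi * v) \<le> 2 * (\<eta> * sqrt t) / sqrt t"
      using t \<eta> by (intro divide_left_mono) (auto intro: order_less_le_trans)
    also have "\<dots> = 2 * \<eta>" using t by simp
    finally show ?thesis using t \<eta> v
      by (intro order_trans[OF centred_gaussian_small_interval] ennreal_leI) auto
  qed
  have "(\<integral>\<^sup>+\<omega>. indicator {l..u} (x + W t \<omega>) * indicator {-(\<eta> * sqrt t)..\<eta> * sqrt t} (x + W s \<omega>) \<partial>M)
      \<le> ennreal (2 * (2 * \<eta>) * ((u - l) / sqrt t))"
    by (rule brownian_pinned_expectation_le_const[OF W _ _ lu]) (use s t \<eta> small in auto)
  then show ?thesis by simp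
qed

text \<open>If \<open>V\<close> misses the window, then either it is above \<open>bt\<^sup>2\<close>, or at least half of the \<open>2m\<close> middle points
  are within \<open>\<eta>\<surd>t\<close> of zero: otherwise the remaining middle points, at least \<open>m\<close> of them, contribute at
  least \<open>m \<cdot> \<eta>\<^sup>2t \<cdot> t/(4m)\<close> to \<open>V\<close>. This is Markov's inequality for both alternatives, before taking
  expectations.\<close>

lemma variance_window_pointwise:
  fixes Z :: "nat \<Rightarrow> real"
  assumes m: "m > 0" and t: "t > 0" and \<eta>: "\<eta> > 0" and b: "b > 0"
  defines "V \<equiv> (\<Sum>i<4 * m. (Z i)\<^sup>2 * (t / real (4 * m)))"
  shows "1 \<le> indicator {\<eta>\<^sup>2 * t\<^sup>2 / 4..b * t\<^sup>2} V + ennreal (1 / (b * t\<^sup>2)) * ennreal V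
            + ennreal (1 / real m) * (\<Sum>i\<in>{m..<3 * m}. indicator {-(\<eta> * sqrt t)..\<eta> * sqrt t} (Z i))"
proof -
  let ?N = "{i \<in> {m..<3 * m}. Z i \<in> {-(\<eta> * sqrt t)..\<eta> * sqrt t}}"
  have V0: "V \<ge> 0" unfolding V_def using t by (intro sum_nonneg) auto
  have D: "(\<Sum>i\<in>{m..<3 * m}. indicator {-(\<eta> * sqrt t)..\<eta> * sqrt t} (Z i)) = (of_nat (card ?N) :: ennreal)"
    by (simp add: indicator_def sum.If_cases Int_def of_nat_def[symmetric])
  consider "V > b * t\<^sup>2" | "V \<le> b * t\<^sup>2" "card ?N \<ge> m" | "V \<le> b * t\<^sup>2" "card ?N < m" by linarith
  then show ?thesis
  proof cases
    case 1
    then have "ennreal 1 \<le> ennreal (1 / (b * t\<^sup>2) * V)"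
      using b t by (intro ennreal_leI) (simp add: field_simps)
    also have "\<dots> = ennreal (1 / (b * t\<^sup>2)) * ennreal V" using b t V0 by (intro ennreal_mult) auto
    finally show ?thesis by (simp add: add_increasing add_increasing2)
  next
    case 2
    then have "ennreal 1 \<le> ennreal (1 / real m * real (card ?N))"
      using m by (intro ennreal_leI) (simp add: field_simps)
    also have "\<dots> = ennreal (1 / real m) * of_nat (card ?N)"
      using m by (subst ennreal_mult) (auto simp: ennreal_of_nat_eq_real_of_nat)
    finally show ?thesis unfolding D by (simp add: add_increasing)
  next
    case 3
    let ?G = "{m..<3 * m} - ?N"
    have "card ?N \<le> card {m..<3 * m}" by (intro card_mono) auto
    moreover have "card ?G = card {m..<3 * m} - card ?N" by (rule card_Diff_subset) auto
    ultimately have G: "real m \<le> real (card ?G)" using 3 m by simp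
    have "\<eta>\<^sup>2 * t\<^sup>2 / 4 = real m * (\<eta>\<^sup>2 * t * (t / real (4 * m)))"
      using m by (simp add: power2_eq_square field_simps)
    also have "\<dots> \<le> real (card ?G) * (\<eta>\<^sup>2 * t * (t / real (4 * m)))"
      using G t by (intro mult_right_mono) auto
    also have "\<dots> = (\<Sum>i\<in>?G. \<eta>\<^sup>2 * t * (t / real (4 * m)))" by simp
    also have "\<dots> \<le> (\<Sum>i\<in>?G. (Z i)\<^sup>2 * (t / real (4 * m)))"
    proof (intro sum_mono mult_right_mono)
      fix i assume "i \<in> ?G"
      then have "\<bar>\<eta> * sqrt t\<bar> \<le> \<bar>Z i\<bar>" using \<eta> t by (auto simp: abs_mult)
      then have "(\<eta> * sqrt t)\<^sup>2 \<le> (Z i)\<^sup>2" by (simp add: abs_le_square_iff)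
      then show "\<eta>\<^sup>2 * t \<le> (Z i)\<^sup>2" using t by (simp add: power_mult_distrib)
    qed (use t in auto)
    also have "\<dots> \<le> V" unfolding V_def
      using t by (intro sum_mono2) auto
    finally show ?thesis using 3 by (simp add: add_increasing2)
  qed
qed

text \<open>The probability that \<open>x + W\<^sub>t\<close> lies in \<open>[l, u]\<close> is at least \<open>c (u - l)/\<surd>t\<close>. The constants \<open>\<eta>\<close> and
  \<open>b\<close> are chosen such that each of the two failure terms takes away at most a quarter of this.\<close>

lemma variance_window_probability:
  assumes W: "brownian_motion M W" and t: "t > 0" and m: "m > 0" and lu: "l \<le> u" and \<rho>: "\<rho> \<ge> 0"
    and x: "x\<^sup>2 \<le> \<rho> * t" and A: "\<And>y. y \<in> {l..u} \<Longrightarrow> y\<^sup>2 \<le> \<rho> * t"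
  defines "c \<equiv> exp (- (2 * \<rho>)) / sqrt (2 * pi)"
  defines "\<eta> \<equiv> c / 32" and "b \<equiv> 16 * (\<rho> + 1) / c"
  shows "ennreal (c / 2 * ((u - l) / sqrt t)) \<le> (\<integral>\<^sup>+\<omega>. indicator {l..u} (x + W t \<omega>) *
            indicator {\<eta>\<^sup>2 * t\<^sup>2 / 4..b * t\<^sup>2} (riemann_variance W x t (4 * m) \<omega>) \<partial>M)"
proof -
  have c: "c > 0" by (simp add: c_def)
  have \<eta>: "\<eta> > 0" and b: "b > 0" using c \<rho> by (auto simp: \<eta>_def b_def)
  let ?q = "(u - l) / sqrt t"
  have q: "?q \<ge> 0" using lu t by simp
  let ?\<tau> = "grid t (4 * m)"
  let ?V = "riemann_variance W x t (4 * m)"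
  let ?A = "\<lambda>\<omega>. indicator {l..u} (x + W t \<omega>) :: ennreal"
  let ?G = "\<lambda>\<omega>. indicator {\<eta>\<^sup>2 * t\<^sup>2 / 4..b * t\<^sup>2} (?V \<omega>) :: ennreal"
  let ?D = "\<lambda>i \<omega>. indicator {-(\<eta> * sqrt t)..\<eta> * sqrt t} (x + W (?\<tau> i) \<omega>) :: ennreal"
  have [measurable]: "W t \<in> borel_measurable M" "W (?\<tau> i) \<in> borel_measurable M" for i
    using t by (auto intro!: brownian_measurable[OF W] grid_nonneg)
  have [measurable]: "?V \<in> borel_measurable M"
    using t by (intro riemann_variance_measurable[OF W]) auto
  have V: "(\<integral>\<^sup>+\<omega>. ?A \<omega> * ennreal (?V \<omega>) \<partial>M) \<le> ennreal (4 * (\<rho> + 1) * t\<^sup>2 * ?q)"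
  proof -
    have "(\<integral>\<^sup>+\<omega>. ?A \<omega> * ennreal (?V \<omega>) \<partial>M)
        = (\<integral>\<^sup>+\<omega>. (\<Sum>i<4 * m. ennreal (t / real (4 * m)) * (?A \<omega> * ennreal ((x + W (?\<tau> i) \<omega>)\<^sup>2))) \<partial>M)"
    proof (rule nn_integral_cong)
      fix \<omega>
      have "ennreal (?V \<omega>) = (\<Sum>i<4 * m. ennreal ((x + W (?\<tau> i) \<omega>)\<^sup>2 * (t / real (4 * m))))"
        unfolding riemann_variance_def using t by (intro sum_ennreal[symmetric]) auto
      also have "\<dots> = (\<Sum>i<4 * m. ennreal ((x + W (?\<tau> i) \<omega>)\<^sup>2) * ennreal (t / real (4 * m)))"
        using t by (intro sum.cong ennreal_mult) auto
      finally show "?A \<omega> * ennreal (?V \<omega>) = (\<Sum>i<4 * m. ennreal (t / real (4 * m)) * (?A \<omega> * ennreal ((x + W (?\<tau> i) \<omega>)\<^sup>2)))"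
        by (simp add: sum_distrib_left mult_ac)
    qed
    also have "\<dots> = (\<Sum>i<4 * m. \<integral>\<^sup>+\<omega>. ennreal (t / real (4 * m)) * (?A \<omega> * ennreal ((x + W (?\<tau> i) \<omega>)\<^sup>2)) \<partial>M)"
      by (rule nn_integral_sum) measurable
    also have "\<dots> = (\<Sum>i<4 * m. ennreal (t / real (4 * m)) * (\<integral>\<^sup>+\<omega>. ?A \<omega> * ennreal ((x + W (?\<tau> i) \<omega>)\<^sup>2) \<partial>M))"
      by (intro sum.cong refl nn_integral_cmult) measurable
    also have "\<dots> \<le> (\<Sum>i<4 * m. ennreal (t / real (4 * m)) * ennreal (4 * (\<rho> + 1) * t * ?q))"
    proof (intro sum_mono mult_left_mono brownian_pinned_square_le[OF W _ _ lu x A])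
      fix i assume "i \<in> {..<4 * m}"
      then show "?\<tau> i < t" using t m by (simp add: grid_def field_simps)
      show "0 \<le> ?\<tau> i" using t by (simp add: grid_nonneg)
    qed auto
    also have "\<dots> = (\<Sum>i<4 * m. ennreal (t / real (4 * m) * (4 * (\<rho> + 1) * t * ?q)))"
      by (intro sum.cong refl ennreal_mult[symmetric] mult_nonneg_nonneg[OF _ q]) (use t \<rho> in auto)
    also have "\<dots> = ennreal (\<Sum>i<4 * m. t / real (4 * m) * (4 * (\<rho> + 1) * t * ?q))"
    proof (rule sum_ennreal)
      have "0 \<le> t / real (4 * m)" "0 \<le> 4 * (\<rho> + 1) * t" using t \<rho> by auto
      then show "0 \<le> t / real (4 * m) * (4 * (\<rho> + 1) * t * ?q)"
        by (rule mult_nonneg_nonneg[OF _ mult_nonneg_nonneg[OF _ q]])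
    qed
    also have "(\<Sum>i<4 * m. t / real (4 * m) * (4 * (\<rho> + 1) * t * ?q)) = 4 * (\<rho> + 1) * t\<^sup>2 * ?q"
      using m by (simp add: power2_eq_square)
    finally show ?thesis .
  qed
  have D: "(\<integral>\<^sup>+\<omega>. (\<Sum>i\<in>{m..<3 * m}. ?A \<omega> * ?D i \<omega>) \<partial>M) \<le> ennreal (real m * (8 * \<eta> * ?q))"
  proof -
    have "(\<integral>\<^sup>+\<omega>. (\<Sum>i\<in>{m..<3 * m}. ?A \<omega> * ?D i \<omega>) \<partial>M) = (\<Sum>i\<in>{m..<3 * m}. \<integral>\<^sup>+\<omega>. ?A \<omega> * ?D i \<omega> \<partial>M)"
      by (rule nn_integral_sum) measurable
    also have "\<dots> \<le> (\<Sum>i\<in>{m..<3 * m}. ennreal (4 * \<eta> * ?q))"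
    proof (intro sum_mono brownian_pinned_near_zero_le[OF W _ _ t lu])
      fix i assume "i \<in> {m..<3 * m}"
      then have "real m \<le> real i" "real i \<le> 3 * real m" by auto
      then have "real m * t \<le> real i * t" "real i * t \<le> 3 * real m * t"
        using t by (intro mult_right_mono; simp)+
      then show "t / 4 \<le> ?\<tau> i" "?\<tau> i \<le> 3 * t / 4"
        using m by (simp_all add: grid_def field_simps)
    qed (use \<eta> in auto)
    also have "\<dots> = ennreal (\<Sum>i\<in>{m..<3 * m}. 4 * \<eta> * ?q)"
      by (intro sum_ennreal mult_nonneg_nonneg[OF _ q]) (use \<eta> in auto)
    also have "(\<Sum>i\<in>{m..<3 * m}. 4 * \<eta> * ?q) = real m * (8 * \<eta> * ?q)" by (simp add: of_nat_diff)
    finally show ?thesis .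
  qed
  have "ennreal (c * ?q) \<le> (\<integral>\<^sup>+\<omega>. ?A \<omega> \<partial>M)"
    unfolding c_def by (rule brownian_window_ge[OF W t lu x A])
  also have "\<dots> \<le> (\<integral>\<^sup>+\<omega>. ?A \<omega> * ?G \<omega> + ennreal (1 / (b * t\<^sup>2)) * (?A \<omega> * ennreal (?V \<omega>))
         + ennreal (1 / real m) * (\<Sum>i\<in>{m..<3 * m}. ?A \<omega> * ?D i \<omega>) \<partial>M)"
  proof (rule nn_integral_mono)
    fix \<omega>
    have "?A \<omega> * 1 \<le> ?A \<omega> * (?G \<omega> + ennreal (1 / (b * t\<^sup>2)) * ennreal (?V \<omega>) + ennreal (1 / real m) * (\<Sum>i\<in>{m..<3 * m}. ?D i \<omega>))"
      unfolding riemann_variance_def by (intro mult_left_mono variance_window_pointwise m t \<eta> b) simp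
    also have "\<dots> = ?A \<omega> * ?G \<omega> + ennreal (1 / (b * t\<^sup>2)) * (?A \<omega> * ennreal (?V \<omega>))
         + ennreal (1 / real m) * (\<Sum>i\<in>{m..<3 * m}. ?A \<omega> * ?D i \<omega>)"
      by (simp only: distrib_left sum_distrib_left mult_ac)
    finally show "?A \<omega> \<le> ?A \<omega> * ?G \<omega> + ennreal (1 / (b * t\<^sup>2)) * (?A \<omega> * ennreal (?V \<omega>))
         + ennreal (1 / real m) * (\<Sum>i\<in>{m..<3 * m}. ?A \<omega> * ?D i \<omega>)" by simp
  qed
  also have "\<dots> = (\<integral>\<^sup>+\<omega>. ?A \<omega> * ?G \<omega> \<partial>M) + ennreal (1 / (b * t\<^sup>2)) * (\<integral>\<^sup>+\<omega>. ?A \<omega> * ennreal (?V \<omega>) \<partial>M)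
         + ennreal (1 / real m) * (\<integral>\<^sup>+\<omega>. (\<Sum>i\<in>{m..<3 * m}. ?A \<omega> * ?D i \<omega>) \<partial>M)"
    by (simp add: nn_integral_add nn_integral_cmult)
  also have "\<dots> \<le> (\<integral>\<^sup>+\<omega>. ?A \<omega> * ?G \<omega> \<partial>M) + ennreal (1 / (b * t\<^sup>2)) * ennreal (4 * (\<rho> + 1) * t\<^sup>2 * ?q)
         + ennreal (1 / real m) * ennreal (real m * (8 * \<eta> * ?q))"
    by (intro add_mono mult_left_mono V D order_refl) auto
  also have "ennreal (1 / (b * t\<^sup>2)) * ennreal (4 * (\<rho> + 1) * t\<^sup>2 * ?q) = ennreal (1 / (b * t\<^sup>2) * (4 * (\<rho> + 1) * t\<^sup>2 * ?q))"
    by (intro ennreal_mult[symmetric] mult_nonneg_nonneg[OF _ q]) (use b t \<rho> in auto)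
  also have "1 / (b * t\<^sup>2) * (4 * (\<rho> + 1) * t\<^sup>2 * ?q) = c / 4 * ?q"
  proof -
    have "1 / (b * t\<^sup>2) * (4 * (\<rho> + 1) * t\<^sup>2 * ?q) = 4 * (\<rho> + 1) / b * ?q" using t by simp
    also have "4 * (\<rho> + 1) / b = c / 4" using c \<rho> by (simp add: b_def divide_simps)
    finally show ?thesis .
  qed
  also have "ennreal (1 / real m) * ennreal (real m * (8 * \<eta> * ?q)) = ennreal (1 / real m * (real m * (8 * \<eta> * ?q)))"
    by (intro ennreal_mult[symmetric] mult_nonneg_nonneg[OF _ q] mult_nonneg_nonneg[OF _ mult_nonneg_nonneg[OF _ q]]) (use m \<eta> in auto)
  also have "1 / real m * (real m * (8 * \<eta> * ?q)) = c / 4 * ?q" using m by (simp add: \<eta>_def)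
  finally have "ennreal (c * ?q) \<le> (\<integral>\<^sup>+\<omega>. ?A \<omega> * ?G \<omega> \<partial>M) + ennreal (c / 4 * ?q) + ennreal (c / 4 * ?q)" .
  moreover have nn: "0 \<le> c / 4 * ?q" by (rule mult_nonneg_nonneg[OF _ q]) (use c in simp)
  ultimately have "ennreal (c * ?q - c / 4 * ?q - c / 4 * ?q) \<le> (\<integral>\<^sup>+\<omega>. ?A \<omega> * ?G \<omega> \<partial>M)"
    by (intro ennreal_le_addD[OF ennreal_le_addD[OF _ nn] nn])
  moreover have "c * r - c / 4 * r - c / 4 * r = c / 2 * r" for r :: real by simp
  ultimately show ?thesis by (simp only:)
qed


section \<open>Lower bounds for the heat kernel\<close>

text \<open>Boxes adapted to the Grushin scaling: \<open>x\<^sub>2\<close> scales like time and \<open>x\<^sub>1\<close> like its square root.\<close>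

definition parabolic_box :: "real \<Rightarrow> (real \<times> real) set" where
  "parabolic_box r = {-sqrt r..sqrt r} \<times> {-r..r}"

lemma parabolic_box_borel [measurable]: "parabolic_box r \<in> sets borel"
  unfolding parabolic_box_def by (intro borel_closed closed_Times) auto

lemma parabolic_box_mono: "r \<le> r' \<Longrightarrow> parabolic_box r \<subseteq> parabolic_box r'"
  unfolding parabolic_box_def by (intro Sigma_mono) auto

lemma in_parabolic_box_mono:
  "x \<in> parabolic_box r \<Longrightarrow> r \<le> r' \<Longrightarrow> x \<in> parabolic_box r'"
  using parabolic_box_mono by blast

lemma in_some_parabolic_box: "\<exists>n::nat. y \<in> parabolic_box (real n)"
proof -
  obtain n :: nat where n: "max ((fst y)\<^sup>2) \<bar>snd y\<bar> \<le> real n" using real_arch_simple by blast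
  then have "\<bar>fst y\<bar> \<le> sqrt (real n)" using real_le_rsqrt[of "\<bar>fst y\<bar>"] by simp
  then have "y \<in> parabolic_box (real n)"
    using n by (auto simp: parabolic_box_def mem_Times_iff abs_le_iff)
  then show ?thesis by blast
qed

lemma emeasure_lborel_rect:
  fixes l u l' u' :: real
  assumes "l \<le> u" "l' \<le> u'"
  shows "emeasure lborel ({l..u} \<times> {l'..u'}) = ennreal ((u - l) * (u' - l'))"
  using assms
  by (simp add: lborel_prod[symmetric] lborel.emeasure_pair_measure_Times ennreal_mult[symmetric])

lemma emeasure_parabolic_box: "r \<ge> 0 \<Longrightarrow> emeasure lborel (parabolic_box r) = ennreal (4 * r * sqrt r)"
  unfolding parabolic_box_def by (subst emeasure_lborel_rect) (auto simp: mult_ac)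

lemma gaussian_interval_ge:
  assumes v: "\<kappa> * t\<^sup>2 \<le> v" "v \<le> b * t\<^sup>2" and \<kappa>: "\<kappa> > 0" and t: "t > 0" and lu: "l \<le> u"
    and x: "\<bar>x\<bar> \<le> \<rho> * t" and B: "\<And>y. y \<in> {l..u} \<Longrightarrow> \<bar>y\<bar> \<le> \<rho> * t"
  shows "ennreal (exp (- (2 * \<rho>\<^sup>2 / \<kappa>)) / sqrt (2 * pi * b) / t * (u - l)) \<le> emeasure (centred_gaussian v) {z. x + z \<in> {l..u}}"
proof -
  have v0: "v > 0" using v(1) \<kappa> t by (smt (verit) mult_pos_pos zero_less_power)
  have b: "b > 0" using v0 v(2) t by (smt (verit) mult_nonpos_nonneg zero_le_power2)
  let ?k = "2 * \<rho>\<^sup>2 / \<kappa>"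
  let ?c = "exp (- ?k) / sqrt (2 * pi * b) / t"
  have c0: "?c \<ge> 0" using t b by simp
  have eq: "{z. x + z \<in> {l..u}} = {l - x..u - x}" by auto
  have "ennreal (?c * (u - l)) = ennreal ?c * ennreal (u - l)" using lu c0 by (intro ennreal_mult) auto
  also have "\<dots> = ennreal ?c * emeasure lborel {l - x..u - x}" using lu by simp
  also have "\<dots> = (\<integral>\<^sup>+z. ennreal ?c * indicator {l - x..u - x} z \<partial>lborel)"
    by (rule nn_integral_cmult_indicator[symmetric]) simp
  also have "\<dots> \<le> (\<integral>\<^sup>+z. ennreal (normal_density 0 (sqrt v) z) * indicator {l - x..u - x} z \<partial>lborel)"
  proof (rule nn_integral_mono)
    fix z
    show "ennreal ?c * indicator {l - x..u - x} z \<le> ennreal (normal_density 0 (sqrt v) z) * indicator {l - x..u - x} z"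
    proof (cases "z \<in> {l - x..u - x}")
      case True
      then have "\<bar>x + z\<bar> \<le> \<rho> * t" by (intro B) auto
      then have "\<bar>z\<bar> \<le> \<bar>2 * \<rho> * t\<bar>" using x by linarith
      then have "z\<^sup>2 \<le> (2 * \<rho> * t)\<^sup>2" by (simp only: abs_le_square_iff)
      also have "\<dots> = 2 * (\<kappa> * t\<^sup>2) * ?k" using \<kappa> by (simp add: power2_eq_square)
      also have "\<dots> \<le> 2 * v * ?k" using v \<kappa> by (intro mult_right_mono) auto
      finally have "exp (- ?k) / sqrt (2 * pi * v) \<le> normal_density 0 (sqrt v) z" by (rule normal_density_ge[OF v0])
      moreover have "?c \<le> exp (- ?k) / sqrt (2 * pi * v)"
      proof -
        have "2 * pi * v \<le> 2 * pi * b * t\<^sup>2" using v by simp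
        then have "sqrt (2 * pi * v) \<le> sqrt (2 * pi * b * t\<^sup>2)" by (rule real_sqrt_le_mono)
        also have "\<dots> = sqrt (2 * pi * b) * t" using t by (simp add: real_sqrt_mult)
        finally have "exp (- ?k) / (sqrt (2 * pi * b) * t) \<le> exp (- ?k) / sqrt (2 * pi * v)"
          using v0 b t by (intro divide_left_mono) auto
        then show ?thesis by (simp only: divide_divide_eq_left)
      qed
      ultimately show ?thesis by (intro mult_right_mono ennreal_leI) auto
    qed simp
  qed
  also have "\<dots> = emeasure (centred_gaussian v) {z. x + z \<in> {l..u}}"
    using v0 unfolding eq by (simp add: centred_gaussian_def emeasure_density)
  finally show ?thesis .
qed

text \<open>On the event that the conditional variance lies in \<open>[\<kappa>t\<^sup>2, bt\<^sup>2]\<close>, the conditional Gaussian density is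
  at least of order \<open>1/t\<close> at points whose distance is of order \<open>t\<close>. The event, together with the
  first coordinate lying in \<open>[l, u]\<close>, has probability at least of order \<open>(u - l)/\<surd>t\<close> by
  \<open>variance_window_probability\<close>.\<close>

lemma diffusion_box_probability_ge:
  assumes W1: "brownian_motion M W1" and W2: "brownian_motion M W2"
    and ind: "independent_processes M W1 W2" and X: "\<And>x. grushin_diffusion M W1 W2 x (X x)"
    and \<rho>: "\<rho> \<ge> 0"
  obtains c where "c > 0" and "\<And>t x l u l' u'. t > 0 \<Longrightarrow> x \<in> parabolic_box (\<rho> * t) \<Longrightarrow> l \<le> u \<Longrightarrow> l' \<le> u' \<Longrightarrow>
      {l..u} \<times> {l'..u'} \<subseteq> parabolic_box (\<rho> * t) \<Longrightarrow>
      c / (t * sqrt t) * ((u - l) * (u' - l'))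
        \<le> measure M {\<omega> \<in> space M. fst (X x t \<omega>) \<in> {l..u} \<and> snd (X x t \<omega>) \<in> {l'..u'}}"
proof -
  interpret prob_space M using W1 by (simp add: brownian_motion_def)
  define c where "c = exp (- (2 * \<rho>)) / sqrt (2 * pi)"
  define \<eta> where "\<eta> = c / 32"
  define b where "b = 16 * (\<rho> + 1) / c"
  define \<kappa> where "\<kappa> = \<eta>\<^sup>2 / 4"
  define d where "d = exp (- (2 * \<rho>\<^sup>2 / \<kappa>)) / sqrt (2 * pi * b)"
  have c: "c > 0" by (simp add: c_def)
  have pos: "\<eta> > 0" "b > 0" "\<kappa> > 0" "d > 0" using c \<rho> by (auto simp: \<eta>_def b_def \<kappa>_def d_def)
  have "c / 2 * d / (t * sqrt t) * ((u - l) * (u' - l'))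
        \<le> measure M {\<omega> \<in> space M. fst (X x t \<omega>) \<in> {l..u} \<and> snd (X x t \<omega>) \<in> {l'..u'}}"
    if t: "t > 0" and x: "x \<in> parabolic_box (\<rho> * t)" and lu: "l \<le> u" "l' \<le> u'"
      and box: "{l..u} \<times> {l'..u'} \<subseteq> parabolic_box (\<rho> * t)" for t x l u l' u'
  proof (rule riemann_sum_limit[OF W1 W2 X t])
    have sq: "y\<^sup>2 \<le> \<rho> * t" if "y \<in> {-sqrt (\<rho> * t)..sqrt (\<rho> * t)}" for y
    proof -
      have "\<bar>y\<bar> \<le> \<bar>sqrt (\<rho> * t)\<bar>" using that by auto
      then have "y\<^sup>2 \<le> (sqrt (\<rho> * t))\<^sup>2" by (simp only: abs_le_square_iff)
      then show ?thesis using \<rho> t by simp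
    qed
    have x1: "(fst x)\<^sup>2 \<le> \<rho> * t" and x2: "\<bar>snd x\<bar> \<le> \<rho> * t"
      using x sq[of "fst x"] by (auto simp: parabolic_box_def)
    have A: "y\<^sup>2 \<le> \<rho> * t" if "y \<in> {l..u}" for y
    proof -
      have "(y, l') \<in> parabolic_box (\<rho> * t)" using that lu box by auto
      then show ?thesis by (intro sq) (auto simp: parabolic_box_def)
    qed
    have B: "\<bar>y\<bar> \<le> \<rho> * t" if "y \<in> {l'..u'}" for y
    proof -
      have "(l, y) \<in> parabolic_box (\<rho> * t)" using that lu box by auto
      then show ?thesis by (auto simp: parabolic_box_def)
    qed
    fix m0 :: nat
    define m where "m = Suc m0"
    have m: "m > 0" "4 * m \<ge> m0" by (auto simp: m_def)
    let ?A = "{w. fst x + w \<in> {l..u}}" and ?B = "{z. snd x + z \<in> {l'..u'}}"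
    let ?h = "\<lambda>v. ennreal (d / t * (u' - l')) * indicator {\<kappa> * t\<^sup>2..b * t\<^sup>2} v"
    have [measurable]: "W1 t \<in> borel_measurable M" "riemann_variance W1 (fst x) t (4 * m) \<in> borel_measurable M"
      using t by (auto intro!: brownian_measurable[OF W1] riemann_variance_measurable[OF W1])
    \<comment> \<open>The window estimate is available for numbers of steps divisible by four.\<close>
    have "ennreal (c / 2 * ((u - l) / sqrt t)) \<le> (\<integral>\<^sup>+\<omega>. indicator {l..u} (fst x + W1 t \<omega>) *
            indicator {\<kappa> * t\<^sup>2..b * t\<^sup>2} (riemann_variance W1 (fst x) t (4 * m) \<omega>) \<partial>M)"
      using variance_window_probability[OF W1 t m(1) lu(1) \<rho> x1 A]
      unfolding c_def[symmetric] \<eta>_def[symmetric] b_def[symmetric] \<kappa>_def by simp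
    then have "ennreal (d / t * (u' - l')) * ennreal (c / 2 * ((u - l) / sqrt t)) \<le> ennreal (d / t * (u' - l')) *
         (\<integral>\<^sup>+\<omega>. indicator {l..u} (fst x + W1 t \<omega>) *
            indicator {\<kappa> * t\<^sup>2..b * t\<^sup>2} (riemann_variance W1 (fst x) t (4 * m) \<omega>) \<partial>M)"
      by (intro mult_left_mono) auto
    also have "\<dots> = (\<integral>\<^sup>+\<omega>. ennreal (d / t * (u' - l')) * (indicator {l..u} (fst x + W1 t \<omega>) *
            indicator {\<kappa> * t\<^sup>2..b * t\<^sup>2} (riemann_variance W1 (fst x) t (4 * m) \<omega>)) \<partial>M)"
      by (rule nn_integral_cmult[symmetric]) measurable
    also have "\<dots> = (\<integral>\<^sup>+\<omega>. indicator ?A (W1 t \<omega>) * ?h (riemann_variance W1 (fst x) t (4 * m) \<omega>) \<partial>M)"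
      by (intro nn_integral_cong) (auto simp: indicator_def)
    also have "\<dots> \<le> emeasure M {\<omega> \<in> space M. W1 t \<omega> \<in> ?A \<and> riemann_sum W1 W2 (fst x) t (4 * m) \<omega> \<in> ?B}"
    proof (rule conditional_gaussian_lower_bound[OF W1 W2 ind t])
      have "?A = {l - fst x..u - fst x}" "?B = {l' - snd x..u' - snd x}" by auto
      then show "?A \<in> sets borel" "?B \<in> sets borel" by simp_all
      show "?h v \<le> emeasure (centred_gaussian v) ?B" for v
      proof (cases "v \<in> {\<kappa> * t\<^sup>2..b * t\<^sup>2}")
        case True
        then show ?thesis
          using gaussian_interval_ge[of \<kappa> t v b l' u' "snd x" \<rho>] pos t lu x2 B by (simp add: d_def)
      qed simp
    qed (use m in auto)
    also have "ennreal (d / t * (u' - l')) * ennreal (c / 2 * ((u - l) / sqrt t)) = ennreal (d / t * (u' - l') * (c / 2 * ((u - l) / sqrt t)))"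
      using pos c t lu by (intro ennreal_mult[symmetric]) auto
    also have "d / t * (u' - l') * (c / 2 * ((u - l) / sqrt t)) = c / 2 * d / (t * sqrt t) * ((u - l) * (u' - l'))"
      by (simp add: mult_ac)
    finally have "c / 2 * d / (t * sqrt t) * ((u - l) * (u' - l')) \<le> measure M
        {\<omega> \<in> space M. fst x + W1 t \<omega> \<in> {l..u} \<and> snd x + riemann_sum W1 W2 (fst x) t (4 * m) \<omega> \<in> {l'..u'}}"
      by (simp add: emeasure_eq_measure)
    then show "\<exists>n\<ge>m0. n > 0 \<and> c / 2 * d / (t * sqrt t) * ((u - l) * (u' - l')) \<le> measure M
        {\<omega> \<in> space M. fst x + W1 t \<omega> \<in> {l..u} \<and> snd x + riemann_sum W1 W2 (fst x) t n \<omega> \<in> {l'..u'}}"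
      using m by (intro exI[of _ "4 * m"]) auto
  qed simp
  moreover have "c / 2 * d > 0" using c pos by simp
  ultimately show ?thesis using that by blast
qed

lemma heat_kernel_measure:
  assumes K: "grushin_heat_kernel M W1 W2 X K" and t: "t > 0" and [measurable]: "A \<in> sets borel" "B \<in> sets borel"
  shows "(\<integral>\<^sup>+y. ennreal (K t x y) * indicator (A \<times> B) y \<partial>lborel)
       = ennreal (measure M {\<omega> \<in> space M. fst (X x t \<omega>) \<in> A \<and> snd (X x t \<omega>) \<in> B})"
proof -
  have "brownian_motion M W1" using K by (simp add: grushin_heat_kernel_def)
  then interpret prob_space M by (simp add: brownian_motion_def)
  have D: "distributed M lborel (X x t) (\<lambda>y. ennreal (K t x y))"
    using K t unfolding grushin_heat_kernel_def by blast
  have "A \<times> B \<in> sets (lborel :: (real \<times> real) measure)"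
    by (simp add: borel_prod[symmetric])
  from distributed_emeasure[OF D this]
  have "(\<integral>\<^sup>+y. ennreal (K t x y) * indicator (A \<times> B) y \<partial>lborel) = emeasure M (X x t -` (A \<times> B) \<inter> space M)" by simp
  also have "X x t -` (A \<times> B) \<inter> space M = {\<omega> \<in> space M. fst (X x t \<omega>) \<in> A \<and> snd (X x t \<omega>) \<in> B}"
    by (auto simp: mem_Times_iff)
  finally show ?thesis by (simp add: emeasure_eq_measure)
qed

lemma heat_kernel_continuous:
  assumes K: "grushin_heat_kernel M W1 W2 X K" and t: "t > 0"
  shows "continuous_on UNIV (K t x)"
proof -
  have "continuous_on ({0<..} \<times> UNIV \<times> UNIV) (\<lambda>(t, x, y). K t x y)"
    using K by (simp add: grushin_heat_kernel_def)
  moreover have "continuous_on UNIV (\<lambda>y. (t, x, y))"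
    by (intro continuous_on_Pair continuous_on_const continuous_on_id)
  ultimately have "continuous_on UNIV (\<lambda>y. (\<lambda>(t, x, y). K t x y) (t, x, y))"
    by (rule continuous_on_compose2) (use t in auto)
  then show ?thesis by simp
qed

lemma heat_kernel_measurable:
  assumes "grushin_heat_kernel M W1 W2 X K" "t > 0"
  shows "K t x \<in> borel_measurable borel"
  by (rule borel_measurable_continuous_onI[OF heat_kernel_continuous[OF assms]])

text \<open>The probabilities of small boxes around \<open>y\<close> bound the continuous density at \<open>y\<close> from below. Boxes
  around a boundary point of \<open>B(\<rho>t)\<close> stick out, so the box estimate is used for \<open>4\<rho>\<close>.\<close>

lemma heat_kernel_lower_bound:
  assumes K: "grushin_heat_kernel M W1 W2 X K" and \<rho>: "\<rho> > 0"
  obtains c where "c > 0" and "\<And>t x y. t > 0 \<Longrightarrow> x \<in> parabolic_box (\<rho> * t) \<Longrightarrow> y \<in> parabolic_box (\<rho> * t) \<Longrightarrow>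
      c / (t * sqrt t) \<le> K t x y"
proof -
  have W1: "brownian_motion M W1" and W2: "brownian_motion M W2" and ind: "independent_processes M W1 W2"
    and X: "\<And>x. grushin_diffusion M W1 W2 x (X x)" and K0: "\<And>t x y. t > 0 \<Longrightarrow> K t x y \<ge> 0"
    using K by (auto simp: grushin_heat_kernel_def)
  interpret prob_space M using W1 by (simp add: brownian_motion_def)
  have "4 * \<rho> \<ge> 0" using \<rho> by simp
  from diffusion_box_probability_ge[OF W1 W2 ind X this]
  obtain c where c: "c > 0" and box: "\<And>t x l u l' u'. t > 0 \<Longrightarrow> x \<in> parabolic_box (4 * \<rho> * t) \<Longrightarrow> l \<le> u \<Longrightarrow> l' \<le> u' \<Longrightarrow>
      {l..u} \<times> {l'..u'} \<subseteq> parabolic_box (4 * \<rho> * t) \<Longrightarrow>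
      c / (t * sqrt t) * ((u - l) * (u' - l'))
        \<le> measure M {\<omega> \<in> space M. fst (X x t \<omega>) \<in> {l..u} \<and> snd (X x t \<omega>) \<in> {l'..u'}}" by blast
  have "c / (t * sqrt t) \<le> K t x y" if t: "t > 0" and x: "x \<in> parabolic_box (\<rho> * t)" and y: "y \<in> parabolic_box (\<rho> * t)" for t x y
  proof (rule ccontr)
    assume neg: "\<not> ?thesis"
    then obtain k where k: "K t x y < k" "k < c / (t * sqrt t)" using dense by (meson not_le)
    have k0: "k \<ge> 0" using k K0[OF t, of x y] by simp
    have "isCont (K t x) y"
      using heat_kernel_continuous[OF K t, of x] unfolding continuous_on_eq_continuous_at[OF open_UNIV] by blast
    from continuous_at_eps_delta[THEN iffD1, rule_format, OF this, of "k - K t x y"] k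
    obtain \<delta> where \<delta>: "\<delta> > 0" and near: "\<And>z. dist z y < \<delta> \<Longrightarrow> \<bar>K t x z - K t x y\<bar> < k - K t x y"
      by (auto simp: dist_real_def)
    \<comment> \<open>Small enough for continuity at \<open>y\<close>, and for the box around \<open>y\<close> to stay inside \<open>B(4\<rho>t)\<close>.\<close>
    define \<epsilon> where "\<epsilon> = min (\<delta> / 4) (min (sqrt (\<rho> * t)) (\<rho> * t))"
    have \<epsilon>: "\<epsilon> > 0" "\<epsilon> \<le> \<delta> / 4" "\<epsilon> \<le> sqrt (\<rho> * t)" "\<epsilon> \<le> \<rho> * t" using \<delta> \<rho> t by (auto simp: \<epsilon>_def)
    obtain y1 y2 where y12: "y = (y1, y2)" by (cases y)
    let ?B = "{y1 - \<epsilon>..y1 + \<epsilon>} \<times> {y2 - \<epsilon>..y2 + \<epsilon>}"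
    have sqrt4: "sqrt (4 * \<rho> * t) = 2 * sqrt (\<rho> * t)" by (simp add: real_sqrt_mult)
    have inB: "?B \<subseteq> parabolic_box (4 * \<rho> * t)"
      using y y12 \<epsilon> unfolding parabolic_box_def sqrt4 by auto
    have xB: "x \<in> parabolic_box (4 * \<rho> * t)"
      using x parabolic_box_mono[of "\<rho> * t" "4 * \<rho> * t"] \<rho> t by auto
    have "ennreal (c / (t * sqrt t) * ((2 * \<epsilon>) * (2 * \<epsilon>)))
        \<le> ennreal (measure M {\<omega> \<in> space M. fst (X x t \<omega>) \<in> {y1 - \<epsilon>..y1 + \<epsilon>} \<and> snd (X x t \<omega>) \<in> {y2 - \<epsilon>..y2 + \<epsilon>}})"
      using box[OF t xB _ _ inB] \<epsilon> by (intro ennreal_leI) simp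
    also have "\<dots> = (\<integral>\<^sup>+z. ennreal (K t x z) * indicator ?B z \<partial>lborel)"
      by (rule heat_kernel_measure[OF K t, symmetric]) auto
    also have "\<dots> \<le> (\<integral>\<^sup>+z. ennreal k * indicator ?B z \<partial>lborel)"
    proof (rule nn_integral_mono)
      fix z
      show "ennreal (K t x z) * indicator ?B z \<le> ennreal k * indicator ?B z"
      proof (cases "z \<in> ?B")
        case True
        obtain z1 z2 where z: "z = (z1, z2)" by (cases z)
        have "dist z y \<le> dist z1 y1 + dist z2 y2"
          unfolding z y12 dist_Pair_Pair by (rule sqrt_sum_squares_le_sum_abs[THEN order_trans]) auto
        also have "\<dots> \<le> \<epsilon> + \<epsilon>" using True z by (intro add_mono) (auto simp: dist_real_def)
        also have "\<dots> < \<delta>" using \<epsilon> \<delta> by simp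
        finally have "K t x z \<le> k" using near[of z] by (simp add: abs_less_iff)
        then show ?thesis by (intro mult_right_mono ennreal_leI) auto
      qed simp
    qed
    also have "\<dots> = ennreal k * emeasure lborel ?B"
      by (rule nn_integral_cmult_indicator) (simp add: borel_prod[symmetric])
    also have "\<dots> = ennreal (k * ((2 * \<epsilon>) * (2 * \<epsilon>)))"
      using \<epsilon> k0 by (subst emeasure_lborel_rect) (auto simp: ennreal_mult)
    finally have "c / (t * sqrt t) * ((2 * \<epsilon>) * (2 * \<epsilon>)) \<le> k * ((2 * \<epsilon>) * (2 * \<epsilon>))"
      using k0 \<epsilon> by (subst (asm) ennreal_le_iff) auto
    then have "c / (t * sqrt t) \<le> k" by (rule mult_right_le_imp_le) (use \<epsilon> in auto)
    then show False using k by simp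
  qed
  with c show ?thesis using that by blast
qed

text \<open>Any two points lie in \<open>B(\<rho>t)\<close> when \<open>\<rho>\<close> is large.\<close>

lemma heat_kernel_pos:
  assumes K: "grushin_heat_kernel M W1 W2 X K" and t: "t > 0"
  shows "K t x y > 0"
proof -
  obtain n m :: nat where n: "x \<in> parabolic_box (real n)" and m: "y \<in> parabolic_box (real m)"
    using in_some_parabolic_box by metis
  define \<rho> where "\<rho> = (real n + real m + 1) / t"
  have \<rho>: "\<rho> > 0" using t by (simp add: \<rho>_def)
  have "\<rho> * t = real n + real m + 1" using t by (simp add: \<rho>_def)
  then have in_box: "x \<in> parabolic_box (\<rho> * t)" "y \<in> parabolic_box (\<rho> * t)"
    using n m by (auto elim!: in_parabolic_box_mono)
  obtain c where "c > 0" "\<And>t x y. t > 0 \<Longrightarrow> x \<in> parabolic_box (\<rho> * t) \<Longrightarrow> y \<in> parabolic_box (\<rho> * t) \<Longrightarrow>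
      c / (t * sqrt t) \<le> K t x y"
    using heat_kernel_lower_bound[OF K \<rho>] by blast
  then have "0 < c / (t * sqrt t)" "c / (t * sqrt t) \<le> K t x y" using t in_box by auto
  then show ?thesis by linarith
qed

lemma brownian_square_le:
  assumes W: "brownian_motion M W" and s: "0 \<le> s"
  shows "(\<integral>\<^sup>+\<omega>. ennreal ((x + W s \<omega>)\<^sup>2) \<partial>M) \<le> ennreal (2 * x\<^sup>2 + 2 * s)"
proof (cases "s = 0")
  case True
  interpret prob_space M using W by (simp add: brownian_motion_def)
  have "(\<integral>\<^sup>+\<omega>. ennreal ((x + W s \<omega>)\<^sup>2) \<partial>M) = (\<integral>\<^sup>+\<omega>. ennreal (x\<^sup>2) \<partial>M)"
    by (rule nn_integral_cong_AE) (use brownian_start[OF W] True in auto)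
  then show ?thesis using True by (simp add: emeasure_space_1 ennreal_leI)
next
  case False
  then have "(\<integral>\<^sup>+\<omega>. ennreal ((x + W s \<omega>)\<^sup>2) \<partial>M) = (\<integral>\<^sup>+z. ennreal ((x + z)\<^sup>2) \<partial>centred_gaussian s)"
    using s by (intro brownian_one_time[OF W]) auto
  then show ?thesis using shifted_second_moment_centred_gaussian[OF s, of x] by simp
qed

lemma riemann_variance_expectation_le:
  assumes W: "brownian_motion M W" and t: "t > 0" and n: "n > 0"
  shows "(\<integral>\<^sup>+\<omega>. ennreal (riemann_variance W x t n \<omega>) \<partial>M) \<le> ennreal (t * (2 * x\<^sup>2 + 2 * t))"
proof -
  let ?\<tau> = "grid t n"
  have [measurable]: "W (?\<tau> i) \<in> borel_measurable M" for i
    using t by (auto intro!: brownian_measurable[OF W] grid_nonneg)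
  have "(\<integral>\<^sup>+\<omega>. ennreal (riemann_variance W x t n \<omega>) \<partial>M)
      = (\<integral>\<^sup>+\<omega>. (\<Sum>i<n. ennreal (t / real n) * ennreal ((x + W (?\<tau> i) \<omega>)\<^sup>2)) \<partial>M)"
  proof (rule nn_integral_cong)
    fix \<omega>
    have "ennreal (riemann_variance W x t n \<omega>) = (\<Sum>i<n. ennreal ((x + W (?\<tau> i) \<omega>)\<^sup>2 * (t / real n)))"
      unfolding riemann_variance_def using t by (intro sum_ennreal[symmetric]) auto
    also have "\<dots> = (\<Sum>i<n. ennreal (t / real n) * ennreal ((x + W (?\<tau> i) \<omega>)\<^sup>2))"
      using t by (intro sum.cong refl) (subst mult.commute, intro ennreal_mult, auto)
    finally show "ennreal (riemann_variance W x t n \<omega>) = (\<Sum>i<n. ennreal (t / real n) * ennreal ((x + W (?\<tau> i) \<omega>)\<^sup>2))" .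
  qed
  also have "\<dots> = (\<Sum>i<n. ennreal (t / real n) * (\<integral>\<^sup>+\<omega>. ennreal ((x + W (?\<tau> i) \<omega>)\<^sup>2) \<partial>M))"
    by (simp add: nn_integral_sum nn_integral_cmult)
  also have "\<dots> \<le> (\<Sum>i<n. ennreal (t / real n) * ennreal (2 * x\<^sup>2 + 2 * t))"
  proof (intro sum_mono mult_left_mono order_trans[OF brownian_square_le[OF W]] ennreal_leI)
    fix i assume "i \<in> {..<n}"
    then have "real i * t \<le> real n * t" using t by (intro mult_right_mono) auto
    then have "?\<tau> i \<le> t" using n by (simp add: grid_def field_simps)
    then show "2 * x\<^sup>2 + 2 * ?\<tau> i \<le> 2 * x\<^sup>2 + 2 * t" by simp
    show "0 \<le> ?\<tau> i" using t by (simp add: grid_nonneg)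
  qed auto
  also have "\<dots> = (\<Sum>i<n. ennreal (t / real n * (2 * x\<^sup>2 + 2 * t)))"
    using t by (intro sum.cong refl ennreal_mult[symmetric]) auto
  also have "\<dots> = ennreal (\<Sum>i<n. t / real n * (2 * x\<^sup>2 + 2 * t))"
    using t by (intro sum_ennreal) auto
  also have "(\<Sum>i<n. t / real n * (2 * x\<^sup>2 + 2 * t)) = t * (2 * x\<^sup>2 + 2 * t)"
    using n by simp
  finally show ?thesis .
qed

text \<open>The first coordinate stays by a one-sided Gaussian estimate. Given its path, so does the second,
  because the expected conditional variance is at most \<open>t(2x\<^sub>1\<^sup>2 + 2t)\<close>, which for \<open>t \<le> T/16\<close> is at most
  \<open>17/128\<close> of \<open>T\<^sup>2\<close>.\<close>

lemma riemann_stay_probability: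
  assumes W1: "brownian_motion M W1" and W2: "brownian_motion M W2"
    and ind: "independent_processes M W1 W2" and n: "n > 0"
    and T: "T > 0" and x: "x \<in> parabolic_box T" and t: "0 < t" "t \<le> T / 16"
  shows "ennreal (1 / 16) \<le> emeasure M {\<omega> \<in> space M. fst x + W1 t \<omega> \<in> {-sqrt T..sqrt T}
           \<and> snd x + riemann_sum W1 W2 (fst x) t n \<omega> \<in> {-T..T}}"
proof -
  have x1: "fst x \<in> {-sqrt T..sqrt T}" and x2: "snd x \<in> {-T..T}"
    using x by (auto simp: parabolic_box_def)
  have "\<bar>fst x\<bar> \<le> \<bar>sqrt T\<bar>" using x1 by auto
  then have "(fst x)\<^sup>2 \<le> (sqrt T)\<^sup>2" by (simp only: abs_le_square_iff)
  then have x1sq: "(fst x)\<^sup>2 \<le> T" using T by simp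
  let ?A = "{w. fst x + w \<in> {-sqrt T..sqrt T}}" and ?B = "{z. snd x + z \<in> {-T..T}}"
  have "?A = {-sqrt T - fst x..sqrt T - fst x}" "?B = {-T - snd x..T - snd x}" by auto
  then have [measurable]: "?A \<in> sets borel" "?B \<in> sets borel" by simp_all
  have subA: "{-sqrt T..0} \<subseteq> ?A \<or> {0..sqrt T} \<subseteq> ?A" using x1 by (cases "fst x \<ge> 0") auto
  have subB: "{-T..0} \<subseteq> ?B \<or> {0..T} \<subseteq> ?B" using x2 by (cases "snd x \<ge> 0") auto
  let ?V = "riemann_variance W1 (fst x) t n"
  let ?h = "\<lambda>v. ennreal ((1 - v / T\<^sup>2) / 2)"
  have [measurable]: "W1 t \<in> borel_measurable M" "?V \<in> borel_measurable M"
    using t by (auto intro!: brownian_measurable[OF W1] riemann_variance_measurable[OF W1])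
  let ?E = "\<integral>\<^sup>+\<omega>. indicator ?A (W1 t \<omega>) * ?h (?V \<omega>) \<partial>M"
  have "ennreal (15 / 32) \<le> ennreal ((1 - t / (sqrt T)\<^sup>2) / 2)"
    using t T by (intro ennreal_leI) (simp add: field_simps)
  also have "\<dots> \<le> emeasure (centred_gaussian t) ?A"
    by (rule centred_gaussian_one_sided[OF _ _ _ subA]) (use t T in auto)
  also have "\<dots> = (\<integral>\<^sup>+\<omega>. indicator ?A (W1 t \<omega>) \<partial>M)"
    using t by (subst brownian_one_time[OF W1]) (auto simp: nn_integral_indicator)
  also have "\<dots> \<le> (\<integral>\<^sup>+\<omega>. ennreal 2 * (indicator ?A (W1 t \<omega>) * ?h (?V \<omega>)) + ennreal (1 / T\<^sup>2) * ennreal (?V \<omega>) \<partial>M)"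
  proof (rule nn_integral_mono)
    fix \<omega>
    have V0: "?V \<omega> \<ge> 0" unfolding riemann_variance_def using t by (intro sum_nonneg) auto
    show "indicator ?A (W1 t \<omega>) \<le> ennreal 2 * (indicator ?A (W1 t \<omega>) * ?h (?V \<omega>)) + ennreal (1 / T\<^sup>2) * ennreal (?V \<omega>)"
    proof (cases "W1 t \<omega> \<in> ?A")
      case True
      have m: "ennreal (1 / T\<^sup>2) * ennreal (?V \<omega>) = ennreal (?V \<omega> / T\<^sup>2)"
        using V0 by (subst ennreal_mult[symmetric]) auto
      show ?thesis
      proof (cases "?V \<omega> / T\<^sup>2 \<le> 1")
        case le: True
        then have "ennreal 2 * ?h (?V \<omega>) = ennreal (2 * ((1 - ?V \<omega> / T\<^sup>2) / 2))"
          by (intro ennreal_mult[symmetric]) auto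
        then have "ennreal 2 * ?h (?V \<omega>) + ennreal (?V \<omega> / T\<^sup>2) = ennreal (2 * ((1 - ?V \<omega> / T\<^sup>2) / 2) + ?V \<omega> / T\<^sup>2)"
          using le V0 by (simp only:) (intro ennreal_plus[symmetric], auto)
        moreover have "2 * ((1 - r) / 2) + r = 1" for r :: real by (simp add: field_simps)
        ultimately have "ennreal 2 * ?h (?V \<omega>) + ennreal (?V \<omega> / T\<^sup>2) = 1" by (simp only: ennreal_1)
        then show ?thesis using True m by (simp del: ennreal_numeral)
      next
        case False
        then have "ennreal 1 \<le> ennreal (?V \<omega> / T\<^sup>2)" by (intro ennreal_leI) auto
        then show ?thesis using True m by (simp add: add_increasing)
      qed
    qed simp
  qed
  also have "\<dots> = ennreal 2 * ?E + ennreal (1 / T\<^sup>2) * (\<integral>\<^sup>+\<omega>. ennreal (?V \<omega>) \<partial>M)"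
    by (simp add: nn_integral_add nn_integral_cmult)
  also have "\<dots> \<le> ennreal 2 * ?E + ennreal (17 / 128)"
  proof (rule add_left_mono)
    have "ennreal (1 / T\<^sup>2) * (\<integral>\<^sup>+\<omega>. ennreal (?V \<omega>) \<partial>M) \<le> ennreal (1 / T\<^sup>2) * ennreal (t * (2 * (fst x)\<^sup>2 + 2 * t))"
      by (intro mult_left_mono riemann_variance_expectation_le[OF W1 t(1) n]) auto
    also have "\<dots> = ennreal (1 / T\<^sup>2 * (t * (2 * (fst x)\<^sup>2 + 2 * t)))"
      using t by (intro ennreal_mult[symmetric]) auto
    also have "\<dots> \<le> ennreal (17 / 128)"
    proof (rule ennreal_leI)
      have "t * (2 * (fst x)\<^sup>2 + 2 * t) \<le> (T / 16) * (2 * T + 2 * (T / 16))"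
        using t x1sq T by (intro mult_mono add_mono) auto
      also have "\<dots> = 17 / 128 * T\<^sup>2" by (simp add: power2_eq_square)
      finally show "1 / T\<^sup>2 * (t * (2 * (fst x)\<^sup>2 + 2 * t)) \<le> 17 / 128"
        using T by (simp add: divide_le_eq)
    qed
    finally show "ennreal (1 / T\<^sup>2) * (\<integral>\<^sup>+\<omega>. ennreal (?V \<omega>) \<partial>M) \<le> ennreal (17 / 128)" .
  qed
  finally have "ennreal (15 / 32 - 17 / 128) \<le> ennreal 2 * ?E"
    by (intro ennreal_le_addD) auto
  then have "ennreal (1 / 2) * ennreal (15 / 32 - 17 / 128) \<le> ennreal (1 / 2) * (ennreal 2 * ?E)"
    by (intro mult_left_mono) auto
  also have "\<dots> = ennreal (1 / 2 * 2) * ?E" by (subst ennreal_mult) (auto simp: mult.assoc)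
  also have "\<dots> = ?E" by simp
  finally have "ennreal (1 / 2 * (15 / 32 - 17 / 128)) \<le> ?E" by (subst ennreal_mult) auto
  moreover have "ennreal (1 / 16) \<le> ennreal (1 / 2 * (15 / 32 - 17 / 128))" by (intro ennreal_leI) simp
  ultimately have "ennreal (1 / 16) \<le> ?E" by (rule order_trans[rotated])
  also have "?E \<le> emeasure M {\<omega> \<in> space M. W1 t \<omega> \<in> ?A \<and> riemann_sum W1 W2 (fst x) t n \<omega> \<in> ?B}"
  proof (rule conditional_gaussian_lower_bound[OF W1 W2 ind t(1) n])
    show "?h v \<le> emeasure (centred_gaussian v) ?B" if "v \<ge> 0" for v
      by (rule centred_gaussian_one_sided[OF that T _ subB]) measurable
  qed measurable
  finally show ?thesis by simp
qed

lemma heat_kernel_stay: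
  assumes K: "grushin_heat_kernel M W1 W2 X K" and T: "T > 0" and x: "x \<in> parabolic_box T"
    and t: "0 < t" "t \<le> T / 16"
  shows "ennreal (1 / 16) \<le> (\<integral>\<^sup>+y. ennreal (K t x y) * indicator (parabolic_box T) y \<partial>lborel)"
proof -
  have W1: "brownian_motion M W1" and W2: "brownian_motion M W2" and ind: "independent_processes M W1 W2"
    and X: "\<And>x. grushin_diffusion M W1 W2 x (X x)"
    using K by (auto simp: grushin_heat_kernel_def)
  interpret prob_space M using W1 by (simp add: brownian_motion_def)
  have "1 / 16 \<le> measure M {\<omega> \<in> space M. fst (X x t \<omega>) \<in> {-sqrt T..sqrt T} \<and> snd (X x t \<omega>) \<in> {-T..T}}"
  proof (rule riemann_sum_limit[OF W1 W2 X t(1)])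
    fix m :: nat
    have "ennreal (1 / 16) \<le> emeasure M {\<omega> \<in> space M. fst x + W1 t \<omega> \<in> {-sqrt T..sqrt T}
           \<and> snd x + riemann_sum W1 W2 (fst x) t (Suc m) \<omega> \<in> {-T..T}}"
      by (rule riemann_stay_probability[OF W1 W2 ind _ T x t]) simp
    then have "1 / 16 \<le> measure M {\<omega> \<in> space M. fst x + W1 t \<omega> \<in> {-sqrt T..sqrt T}
           \<and> snd x + riemann_sum W1 W2 (fst x) t (Suc m) \<omega> \<in> {-T..T}}"
      by (simp only: emeasure_eq_measure) (subst (asm) ennreal_le_iff, auto)
    then show "\<exists>n\<ge>m. 0 < n \<and> 1 / 16 \<le> measure M {\<omega> \<in> space M. fst x + W1 t \<omega> \<in> {-sqrt T..sqrt T}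
           \<and> snd x + riemann_sum W1 W2 (fst x) t n \<omega> \<in> {-T..T}}"
      by (intro exI[of _ "Suc m"]) auto
  qed simp
  then have "ennreal (1 / 16) \<le> ennreal (measure M {\<omega> \<in> space M. fst (X x t \<omega>) \<in> {-sqrt T..sqrt T} \<and> snd (X x t \<omega>) \<in> {-T..T}})"
    by (rule ennreal_leI)
  also have "\<dots> = (\<integral>\<^sup>+y. ennreal (K t x y) * indicator (parabolic_box T) y \<partial>lborel)"
    unfolding parabolic_box_def by (rule heat_kernel_measure[OF K t(1), symmetric]) auto
  finally show ?thesis .
qed

lemma heat_kernel_mass:
  assumes K: "grushin_heat_kernel M W1 W2 X K" and t: "t > 0"
  shows "(\<integral>\<^sup>+y. ennreal (K t x y) \<partial>lborel) = 1"
proof -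
  have "brownian_motion M W1" using K by (simp add: grushin_heat_kernel_def)
  then interpret prob_space M by (simp add: brownian_motion_def)
  show ?thesis using heat_kernel_measure[OF K t, of UNIV UNIV x] by (simp add: prob_space)
qed


section \<open>Doubling in finite time\<close>

lemma ennpowr_ge:
  assumes "ennreal a \<le> z" "a \<ge> 0" "p > 0"
  shows "ennreal (a powr p) \<le> ennpowr z p"
proof (cases z)
  case (real r)
  then have "a \<le> r" using assms by simp
  then show ?thesis using real assms by (auto simp: ennpowr_def intro!: ennreal_leI powr_mono2)
qed (simp add: ennpowr_def)

lemma ennpowr_measurable [measurable]: "(\<lambda>z. ennpowr z p) \<in> borel_measurable borel"
  unfolding ennpowr_def by measurable

text \<open>The step behind each doubling: a level \<open>m\<close> held on \<open>B\<close> during \<open>(a, t)\<close> feeds at least \<open>c m^p\<close> per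
  unit of time into the Duhamel integral at \<open>(t, x)\<close>.\<close>

lemma duhamel_lower_bound:
  assumes Km [measurable]: "\<And>t. t > 0 \<Longrightarrow> K t x \<in> borel_measurable borel"
    and B [measurable]: "B \<in> sets borel" and p: "p > 0" and c: "c \<ge> 0" and m: "m \<ge> 0" and a: "0 \<le> a" "a \<le> t"
    and stay: "\<And>s. a < s \<Longrightarrow> s < t \<Longrightarrow> ennreal c \<le> (\<integral>\<^sup>+y. ennreal (K (t - s) x y) * indicator B y \<partial>lborel)"
    and lower: "\<And>s y. a < s \<Longrightarrow> s < t \<Longrightarrow> y \<in> B \<Longrightarrow> ennreal m \<le> u s y"
  shows "ennreal (c * m powr p * (t - a))
      \<le> (\<integral>\<^sup>+s\<in>{0<..<t}. (\<integral>\<^sup>+y. ennreal (K (t - s) x y) * ennpowr (u s y) p \<partial>lborel) \<partial>lborel)"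
proof -
  have "ennreal (c * m powr p * (t - a)) = ennreal (c * m powr p) * emeasure lborel {a<..<t}"
    using a c by (simp add: ennreal_mult)
  also have "\<dots> = (\<integral>\<^sup>+s. ennreal (c * m powr p) * indicator {a<..<t} s \<partial>lborel)"
    by (rule nn_integral_cmult_indicator[symmetric]) simp
  also have "\<dots> \<le> (\<integral>\<^sup>+s\<in>{0<..<t}. (\<integral>\<^sup>+y. ennreal (K (t - s) x y) * ennpowr (u s y) p \<partial>lborel) \<partial>lborel)"
  proof (rule nn_integral_mono)
    fix s
    show "ennreal (c * m powr p) * indicator {a<..<t} s
        \<le> (\<integral>\<^sup>+y. ennreal (K (t - s) x y) * ennpowr (u s y) p \<partial>lborel) * indicator {0<..<t} s"
    proof (cases "s \<in> {a<..<t}")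
      case True
      then have s: "a < s" "s < t" by auto
      have [measurable]: "K (t - s) x \<in> borel_measurable borel" using s by (intro Km) simp
      have "ennreal (c * m powr p) = ennreal (m powr p) * ennreal c"
        using c by (subst ennreal_mult[symmetric]) (auto simp: mult.commute)
      also have "\<dots> \<le> ennreal (m powr p) * (\<integral>\<^sup>+y. ennreal (K (t - s) x y) * indicator B y \<partial>lborel)"
        by (intro mult_left_mono stay s) auto
      also have "\<dots> = (\<integral>\<^sup>+y. ennreal (m powr p) * (ennreal (K (t - s) x y) * indicator B y) \<partial>lborel)"
        by (rule nn_integral_cmult[symmetric]) measurable
      also have "\<dots> \<le> (\<integral>\<^sup>+y. ennreal (K (t - s) x y) * ennpowr (u s y) p \<partial>lborel)"
      proof (rule nn_integral_mono)
        fix y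
        show "ennreal (m powr p) * (ennreal (K (t - s) x y) * indicator B y) \<le> ennreal (K (t - s) x y) * ennpowr (u s y) p"
        proof (cases "y \<in> B")
          case True
          then have "ennreal (m powr p) \<le> ennpowr (u s y) p" by (intro ennpowr_ge lower s m p)
          then show ?thesis using True by (subst mult.commute) (simp add: mult_left_mono)
        qed simp
      qed
      finally show ?thesis using s a by simp
    qed simp
  qed
  finally show ?thesis .
qed

text \<open>If \<open>u \<ge> 2^k m\<close> on \<open>B\<close>, the next doubling takes time \<open>(2/c) (2^k m)^(1-p)\<close>, a geometric sequence with
  ratio \<open>2^(1-p) < 1\<close>. Each step uses the Duhamel formula from time zero and keeps the part of the time
  integral after the previous level has been reached.\<close>

lemma doubling_blow_up:
  assumes Km: "\<And>t x. t > 0 \<Longrightarrow> K t x \<in> borel_measurable borel"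
    and B: "B \<in> sets borel" and p: "p > 1" and c: "c > 0" and m: "m > 0" and T: "T \<ge> 0"
    and duhamel: "\<And>t x. t > 0 \<Longrightarrow>
        (\<integral>\<^sup>+s\<in>{0<..<t}. (\<integral>\<^sup>+y. ennreal (K (t - s) x y) * ennpowr (u s y) p \<partial>lborel) \<partial>lborel) \<le> u t x"
    and stay: "\<And>t x. 0 < t \<Longrightarrow> t \<le> \<delta> \<Longrightarrow> x \<in> B \<Longrightarrow> ennreal c \<le> (\<integral>\<^sup>+y. ennreal (K t x y) * indicator B y \<partial>lborel)"
    and init: "\<And>t x. T < t \<Longrightarrow> t \<le> T + \<delta> \<Longrightarrow> x \<in> B \<Longrightarrow> ennreal m \<le> u t x"
    and time: "2 / c * m powr (1 - p) / (1 - 2 powr (1 - p)) \<le> \<delta>'"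
    and t: "T + \<delta>' \<le> t" "t \<le> T + \<delta>" and x: "x \<in> B"
  shows "u t x = \<infinity>"
proof -
  define r where "r = (2::real) powr (1 - p)"
  have r: "0 < r" "r < 1" using p by (auto simp: r_def powr_less_one)
  define h where "h = 2 / c * m powr (1 - p)"
  have h: "h > 0" using c m by (simp add: h_def)
  define S where "S k = (\<Sum>j<k. h * r ^ j)" for k
  have S0: "S k \<ge> 0" for k unfolding S_def using h r by (intro sum_nonneg) auto
  have S_le: "S k \<le> \<delta>'" for k
  proof -
    have "S k = h * ((1 - r ^ k) / (1 - r))"
      unfolding S_def sum_distrib_left[symmetric] using r by (subst sum_gp_strict) auto
    also have "\<dots> \<le> h * (1 / (1 - r))"
      using h r by (intro mult_left_mono divide_right_mono) auto
    also have "\<dots> \<le> \<delta>'" using time by (simp add: h_def r_def)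
    finally show ?thesis .
  qed
  have level: "ennreal (2 ^ k * m) \<le> u t x" if "T < t" "T + S k \<le> t" "t \<le> T + \<delta>" "x \<in> B" for k t x
    using that
  proof (induction k arbitrary: t x)
    case 0
    then show ?case using init by simp
  next
    case (Suc k)
    let ?a = "T + S k" and ?m = "2 ^ k * m"
    have SSuc: "S (Suc k) = S k + h * r ^ k" by (simp add: S_def)
    have hr: "h * r ^ k > 0" using h r by simp
    have a: "0 \<le> ?a" "?a \<le> t" "?a \<ge> T" using T S0[of k] Suc.prems SSuc hr by auto
    have "2 ^ Suc k * m \<le> c * ?m powr p * (t - ?a)"
    proof -
      have "r ^ k = (2 ^ k) powr (1 - p)"
        by (simp add: r_def powr_realpow[symmetric] powr_powr powr_power mult.commute)
      then have "h * r ^ k = 2 / c * ?m powr (1 - p)" using m by (simp add: h_def powr_mult)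
      then have "c * ?m powr p * (h * r ^ k) = 2 * (?m powr p * ?m powr (1 - p))" using c by simp
      also have "\<dots> = 2 ^ Suc k * m" using m by (simp add: powr_add[symmetric])
      finally have "2 ^ Suc k * m = c * ?m powr p * (h * r ^ k)" by simp
      also have "\<dots> \<le> c * ?m powr p * (t - ?a)"
        using Suc.prems SSuc c by (intro mult_left_mono) auto
      finally show ?thesis .
    qed
    then have "ennreal (2 ^ Suc k * m) \<le> ennreal (c * ?m powr p * (t - ?a))" by (rule ennreal_leI)
    also have "\<dots> \<le> (\<integral>\<^sup>+s\<in>{0<..<t}. (\<integral>\<^sup>+y. ennreal (K (t - s) x y) * ennpowr (u s y) p \<partial>lborel) \<partial>lborel)"
    proof (rule duhamel_lower_bound[where B=B])
      show "ennreal c \<le> (\<integral>\<^sup>+y. ennreal (K (t - s) x y) * indicator B y \<partial>lborel)" if "?a < s" "s < t" for s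
        using that Suc.prems a by (intro stay) auto
      show "ennreal ?m \<le> u s y" if "?a < s" "s < t" "y \<in> B" for s y
        using that Suc.prems a by (intro Suc.IH) auto
    qed (use Km B p c m a in auto)
    also have "\<dots> \<le> u t x" using Suc.prems T by (intro duhamel) auto
    finally show ?case .
  qed
  have "S 1 > 0" using h by (simp add: S_def)
  then have "\<delta>' > 0" using S_le[of 1] by simp
  then have "ennreal (2 ^ k * m) \<le> u t x" for k
    using t x S_le[of k] by (intro level) auto
  note lev = this
  show ?thesis
  proof (rule ccontr)
    assume "u t x \<noteq> \<infinity>"
    then obtain v where v: "u t x = ennreal v" "v \<ge> 0" by (cases "u t x") auto
    obtain k where "v / m < 2 ^ k" using real_arch_pow[of 2 "v / m"] by auto
    then have "v < 2 ^ k * m" using m by (simp add: field_simps)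
    moreover have "2 ^ k * m \<le> v" using lev[of k] v by simp
    ultimately show False by simp
  qed
qed

lemma cauchy_solution_duhamel:
  assumes "cauchy_solution K p u0 u" "t > 0"
  shows "(\<integral>\<^sup>+ s\<in>{0<..<t}. (\<integral>\<^sup>+ y. ennreal (K (t - s) x y) * ennpowr (u s y) p \<partial>lborel) \<partial>lborel) \<le> u t x"
proof -
  have "u t x = (\<integral>\<^sup>+ y. ennreal (K t x y) * ennreal (u0 y) \<partial>lborel)
              + (\<integral>\<^sup>+ s\<in>{0<..<t}. (\<integral>\<^sup>+ y. ennreal (K (t - s) x y) * ennpowr (u s y) p \<partial>lborel) \<partial>lborel)"
    using assms unfolding cauchy_solution_def by blast
  then show ?thesis by simp
qed

lemma uniformly_positive_blow_up:
  assumes K: "grushin_heat_kernel M W1 W2 X K" and p: "1 < p"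
    and \<mu>: "\<mu> > 0" "\<And>x. \<mu> \<le> u0 x" and u: "cauchy_solution K p u0 u"
  shows "blows_up_in_finite_time u"
proof -
  define T where "T = 2 * \<mu> powr (1 - p) / (1 - 2 powr (1 - p))"
  have "2 powr (1 - p) < 1" using p by (simp add: powr_less_one)
  then have T: "T > 0" using \<mu> by (simp add: T_def)
  have base: "ennreal \<mu> \<le> u t x" if t: "t > 0" for t x
  proof -
    have [measurable]: "K t x \<in> borel_measurable borel" by (rule heat_kernel_measurable[OF K t])
    have "ennreal \<mu> = (\<integral>\<^sup>+ y. ennreal (K t x y) \<partial>lborel) * ennreal \<mu>"
      using heat_kernel_mass[OF K t, of x] by simp
    also have "\<dots> = (\<integral>\<^sup>+ y. ennreal (K t x y) * ennreal \<mu> \<partial>lborel)"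
      by (rule nn_integral_multc[symmetric]) measurable
    also have "\<dots> \<le> (\<integral>\<^sup>+ y. ennreal (K t x y) * ennreal (u0 y) \<partial>lborel)"
      by (intro nn_integral_mono mult_left_mono ennreal_leI \<mu>) simp
    also have "\<dots> \<le> u t x"
    proof -
      have "u t x = (\<integral>\<^sup>+ y. ennreal (K t x y) * ennreal (u0 y) \<partial>lborel)
              + (\<integral>\<^sup>+ s\<in>{0<..<t}. (\<integral>\<^sup>+ y. ennreal (K (t - s) x y) * ennpowr (u s y) p \<partial>lborel) \<partial>lborel)"
        using u t unfolding cauchy_solution_def by blast
      then show ?thesis by simp
    qed
    finally show ?thesis .
  qed
  have "u t x = \<infinity>" if t: "t > T" for t x
  proof (rule doubling_blow_up[where B=UNIV and c=1 and m=\<mu> and T=0 and \<delta>=t and \<delta>'=T and K=K and p=p])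
    show "ennreal 1 \<le> (\<integral>\<^sup>+y. ennreal (K s z y) * indicator UNIV y \<partial>lborel)" if "0 < s" for s z
      using heat_kernel_mass[OF K that, of z] by simp
  qed (use p \<mu> T t in \<open>auto simp: T_def intro: heat_kernel_measurable[OF K] cauchy_solution_duhamel[OF u] base\<close>)
  then show ?thesis unfolding blows_up_in_finite_time_def using T by blast
qed


section \<open>The Fujita range\<close>

lemma kernel_scale_antimono:
  fixes c :: real
  assumes "c \<ge> 0" "0 < s" "s \<le> t"
  shows "c / (t * sqrt t) \<le> c / (s * sqrt s)"
  using assms by (intro divide_left_mono mult_mono) auto

lemma times_sqrt_eq_powr:
  fixes s :: real
  assumes "s \<ge> 0"
  shows "s * sqrt s = s powr (3 / 2)"
proof -
  have "s powr (1 + 1 / 2) = s powr 1 * s powr (1 / 2)" by (rule powr_add)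
  then show ?thesis using assms by (simp add: powr_half_sqrt)
qed

text \<open>For \<open>s \<le> t/2\<close> and \<open>y \<in> B(s)\<close> the kernel \<open>K(t - s, x, y)\<close> is at least of order \<open>t^(-3/2)\<close>. Integrating
  the \<open>p\<close>-th power of the assumed lower bound over \<open>B(s)\<close> gives \<open>s^(3/2 - 3p/2)\<close> up to constants, and for
  \<open>p \<le> 5/3\<close> and \<open>s \<ge> 1\<close> this is at least \<open>1/s\<close>.\<close>

lemma logarithmic_gain:
  assumes p: "p > 1" "p \<le> 5 / 3" and c: "c > 0" and a: "a > 0" and t1: "t1 \<ge> 1"
    and K: "\<And>t x y. t > 0 \<Longrightarrow> x \<in> parabolic_box (2 * t) \<Longrightarrow> y \<in> parabolic_box (2 * t) \<Longrightarrow> c / (t * sqrt t) \<le> K t x y"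
    and duhamel: "\<And>t x. t > 0 \<Longrightarrow>
        (\<integral>\<^sup>+s\<in>{0<..<t}. (\<integral>\<^sup>+y. ennreal (K (t - s) x y) * ennpowr (u s y) p \<partial>lborel) \<partial>lborel) \<le> u t x"
    and init: "\<And>t x. t1 \<le> t \<Longrightarrow> x \<in> parabolic_box t \<Longrightarrow> ennreal (a / (t * sqrt t)) \<le> u t x"
    and t: "2 * t1 \<le> t" and x: "x \<in> parabolic_box t"
  shows "ennreal (4 * c * a powr p * ln (t / (2 * t1)) / (t * sqrt t)) \<le> u t x"
proof -
  define C where "C = 4 * c * a powr p / (t * sqrt t)"
  have t0: "t > 0" using t t1 by simp
  have C0: "C \<ge> 0" using c t0 by (simp add: C_def)
  have "ln (t / (2 * t1)) = ln ((t / 2) / t1)" by simp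
  also have "\<dots> = ln (t / 2) - ln t1" using t1 t0 by (subst ln_divide_pos) auto
  finally have "4 * c * a powr p * ln (t / (2 * t1)) / (t * sqrt t) = C * (ln (t / 2) - ln t1)"
    by (simp add: C_def)
  then have "ennreal (4 * c * a powr p * ln (t / (2 * t1)) / (t * sqrt t)) = ennreal (C * ln (t / 2) - C * ln t1)"
    by (simp only: right_diff_distrib)
  also have "\<dots> = (\<integral>\<^sup>+s. ennreal (C / s) * indicator {t1..t / 2} s \<partial>lborel)"
  proof (rule nn_integral_FTC_Icc[symmetric])
    show "((\<lambda>s. C * ln s) has_real_derivative C / s) (at s)" if "s \<in> {t1..t / 2}" for s
      using that t1 by (auto intro!: derivative_eq_intros)
    show "0 \<le> C / s" if "s \<in> {t1..t / 2}" for s using that t1 C0 by simp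
    show "t1 \<le> t / 2" using t by simp
  qed measurable
  also have "\<dots> \<le> (\<integral>\<^sup>+s\<in>{0<..<t}. (\<integral>\<^sup>+y. ennreal (K (t - s) x y) * ennpowr (u s y) p \<partial>lborel) \<partial>lborel)"
  proof (rule nn_integral_mono)
    fix s
    show "ennreal (C / s) * indicator {t1..t / 2} s
        \<le> (\<integral>\<^sup>+y. ennreal (K (t - s) x y) * ennpowr (u s y) p \<partial>lborel) * indicator {0<..<t} s"
    proof (cases "s \<in> {t1..t / 2}")
      case True
      then have s: "t1 \<le> s" "s \<le> t / 2" "1 \<le> s" "0 < s" "s < t" using t1 t0 by auto
      let ?k = "c / (t * sqrt t)" and ?v = "a powr p / (s\<^sup>2 * sqrt s)"
      have "ennreal (C / s) = ennreal (?k * ?v * (4 * s * sqrt s))"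
        using s by (simp add: C_def power2_eq_square mult_ac)
      also have "\<dots> = ennreal (?k * ?v) * emeasure lborel (parabolic_box s)"
        using s c t0 by (subst emeasure_parabolic_box) (auto simp del: times_divide_eq_left times_divide_eq_right intro!: ennreal_mult)
      also have "\<dots> = (\<integral>\<^sup>+y. ennreal (?k * ?v) * indicator (parabolic_box s) y \<partial>lborel)"
        by (rule nn_integral_cmult_indicator[symmetric]) simp
      also have "\<dots> \<le> (\<integral>\<^sup>+y. ennreal (K (t - s) x y) * ennpowr (u s y) p \<partial>lborel)"
      proof (rule nn_integral_mono)
        fix y
        show "ennreal (?k * ?v) * indicator (parabolic_box s) y \<le> ennreal (K (t - s) x y) * ennpowr (u s y) p"
        proof (cases "y \<in> parabolic_box s")
          case True
          have "?k \<le> c / ((t - s) * sqrt (t - s))" using s c by (intro kernel_scale_antimono) auto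
          also have "\<dots> \<le> K (t - s) x y"
            using s x True by (intro K) (auto elim!: in_parabolic_box_mono)
          finally have k: "ennreal ?k \<le> ennreal (K (t - s) x y)" by (rule ennreal_leI)
          have "s * sqrt s = s powr (3 / 2)" using s by (intro times_sqrt_eq_powr) simp
          then have "(s * sqrt s) powr p = s powr (3 / 2 * p)" by (simp add: powr_powr)
          also have "\<dots> \<le> s powr (2 + 1 / 2)" using p s by (intro powr_mono) auto
          also have "\<dots> = s powr 2 * s powr (1 / 2)" by (rule powr_add)
          also have "\<dots> = s\<^sup>2 * sqrt s" using s by (simp add: powr_half_sqrt)
          finally have "?v \<le> a powr p / (s * sqrt s) powr p" using s by (intro divide_left_mono) auto
          also have "\<dots> = (a / (s * sqrt s)) powr p" using a s by (subst powr_divide) auto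
          finally have "ennreal ?v \<le> ennreal ((a / (s * sqrt s)) powr p)" by (rule ennreal_leI)
          also have "\<dots> \<le> ennpowr (u s y) p"
            using init[OF s(1) True] a s p by (intro ennpowr_ge) auto
          finally have "ennreal ?k * ennreal ?v \<le> ennreal (K (t - s) x y) * ennpowr (u s y) p"
            using k by (intro mult_mono) auto
          moreover have "ennreal (?k * ?v) = ennreal ?k * ennreal ?v"
            using c t0 s by (intro ennreal_mult) auto
          ultimately show ?thesis using True by simp
        qed simp
      qed
      finally show ?thesis using s by simp
    qed simp
  qed
  also have "\<dots> \<le> u t x" by (rule duhamel[OF t0])
  finally show ?thesis .
qed

lemma nonzero_integral_on_box:
  assumes f [measurable]: "f \<in> borel_measurable borel" and "(\<integral>\<^sup>+y. f y \<partial>lborel) \<noteq> 0"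
  obtains n :: nat where "(\<integral>\<^sup>+y. f y * indicator (parabolic_box (real n)) y \<partial>lborel) \<noteq> 0"
proof (rule ccontr)
  assume "\<not> thesis"
  then have "(\<integral>\<^sup>+y. f y * indicator (parabolic_box (real n)) y \<partial>lborel) = 0" for n :: nat using that by blast
  then have "AE y in lborel. f y * indicator (parabolic_box (real n)) y = 0" for n :: nat
    by (subst (asm) nn_integral_0_iff_AE) auto
  then have "AE y in lborel. \<forall>n::nat. f y * indicator (parabolic_box (real n)) y = 0"
    unfolding AE_all_countable by blast
  then have "AE y in lborel. f y = 0"
  proof eventually_elim
    case (elim y)
    then show ?case using in_some_parabolic_box[of y] by (auto simp: indicator_def split: if_splits)
  qed
  then have "(\<integral>\<^sup>+y. f y \<partial>lborel) = 0" by (subst nn_integral_0_iff_AE) auto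
  then show False using assms by simp
qed

lemma continuous_positive_integral:
  fixes f :: "real \<times> real \<Rightarrow> real"
  assumes f: "continuous_on UNIV f" and x: "f x > 0"
  shows "(\<integral>\<^sup>+y. ennreal (f y) \<partial>lborel) \<noteq> 0"
proof
  assume "(\<integral>\<^sup>+y. ennreal (f y) \<partial>lborel) = 0"
  moreover have [measurable]: "f \<in> borel_measurable borel" by (rule borel_measurable_continuous_onI[OF f])
  ultimately have "AE y in lborel. ennreal (f y) = 0" by (subst (asm) nn_integral_0_iff_AE) auto
  then have "AE y in lborel. y \<notin> {y. f y > 0}" by eventually_elim (auto simp: ennreal_eq_0_iff)
  moreover have op: "open {y. f y > 0}"
    using open_Collect_less[OF continuous_on_const f] .
  ultimately have "{y. f y > 0} \<in> null_sets lborel"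
    by (subst AE_iff_null_sets) auto
  then have "negligible {y. f y > 0}"
    by (simp add: negligible_iff_null_sets null_sets_completionI)
  then show False using open_not_negligible[OF op] x by blast
qed

lemma positive_ennreal_real: "z \<noteq> 0 \<Longrightarrow> \<exists>r>0. ennreal r \<le> z"
proof (cases z)
  case (real r)
  moreover assume "z \<noteq> 0"
  ultimately show ?thesis by (intro exI[of _ r]) auto
next
  case top
  then show ?thesis by (intro exI[of _ 1]) auto
qed

text \<open>If \<open>u\<^sub>0\<close> is somewhere positive, its mass on a large box spreads out with the kernel. If \<open>u\<^sub>0 = 0\<close> but
  the solution is nontrivial, its Duhamel term must be positive at some
  \<open>(t\<^sub>0, x\<^sub>0)\<close>, so \<open>u^p\<close> has positive space-time mass on \<open>(0, t\<^sub>0)\<close> times a large box, and this mass spreads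
  in the same way.\<close>

lemma solution_initial_bound:
  assumes u: "cauchy_solution K p u0 u" and u0: "continuous_on UNIV u0" "\<And>x. u0 x \<ge> 0" and nt: "nontrivial u"
    and c: "c > 0"
    and K: "\<And>t x y. t > 0 \<Longrightarrow> x \<in> parabolic_box (2 * t) \<Longrightarrow> y \<in> parabolic_box (2 * t) \<Longrightarrow> c / (t * sqrt t) \<le> K t x y"
  obtains a t1 where "a > 0" "t1 \<ge> 1" "\<And>t x. t1 \<le> t \<Longrightarrow> x \<in> parabolic_box t \<Longrightarrow> ennreal (a / (t * sqrt t)) \<le> u t x"
proof -
  have sol: "u t x = (\<integral>\<^sup>+ y. ennreal (K t x y) * ennreal (u0 y) \<partial>lborel)
              + (\<integral>\<^sup>+ s\<in>{0<..<t}. (\<integral>\<^sup>+ y. ennreal (K (t - s) x y) * ennpowr (u s y) p \<partial>lborel) \<partial>lborel)"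
    if "t > 0" for t x using u that unfolding cauchy_solution_def by blast
  have init: "u 0 x = ennreal (u0 x)" for x using u unfolding cauchy_solution_def by blast
  have [measurable]: "u0 \<in> borel_measurable borel" by (rule borel_measurable_continuous_onI[OF u0(1)])
  show ?thesis
  proof (cases "\<exists>x. u0 x > 0")
    case True
    then have "(\<integral>\<^sup>+y. ennreal (u0 y) \<partial>lborel) \<noteq> 0" using continuous_positive_integral[OF u0(1)] by blast
    then obtain n :: nat where "(\<integral>\<^sup>+y. ennreal (u0 y) * indicator (parabolic_box (real n)) y \<partial>lborel) \<noteq> 0"
      by (rule nonzero_integral_on_box[rotated]) auto
    then obtain r where r: "r > 0" "ennreal r \<le> (\<integral>\<^sup>+y. ennreal (u0 y) * indicator (parabolic_box (real n)) y \<partial>lborel)"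
      using positive_ennreal_real by blast
    have "ennreal (c * r / (t * sqrt t)) \<le> u t x" if t: "max 1 (real n) \<le> t" and x: "x \<in> parabolic_box t" for t x
    proof -
      let ?k = "c / (t * sqrt t)"
      have t0: "t > 0" using t by simp
      have "ennreal (c * r / (t * sqrt t)) = ennreal ?k * ennreal r"
        using c r t0 by (subst ennreal_mult[symmetric]) auto
      also have "\<dots> \<le> ennreal ?k * (\<integral>\<^sup>+y. ennreal (u0 y) * indicator (parabolic_box (real n)) y \<partial>lborel)"
        by (intro mult_left_mono r) simp
      also have "\<dots> = (\<integral>\<^sup>+y. ennreal ?k * (ennreal (u0 y) * indicator (parabolic_box (real n)) y) \<partial>lborel)"
        by (rule nn_integral_cmult[symmetric]) measurable
      also have "\<dots> \<le> (\<integral>\<^sup>+ y. ennreal (K t x y) * ennreal (u0 y) \<partial>lborel)"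
      proof (rule nn_integral_mono)
        fix y
        show "ennreal ?k * (ennreal (u0 y) * indicator (parabolic_box (real n)) y) \<le> ennreal (K t x y) * ennreal (u0 y)"
        proof (cases "y \<in> parabolic_box (real n)")
          case True
          then have "?k \<le> K t x y" using t t0 x by (intro K) (auto elim!: in_parabolic_box_mono)
          then show ?thesis using True by (simp add: mult_right_mono ennreal_leI)
        qed simp
      qed
      also have "\<dots> \<le> u t x" unfolding sol[OF t0] by simp
      finally show ?thesis .
    qed
    then show ?thesis using that[of "c * r" "max 1 (real n)"] c r by simp
  next
    case False
    then have zero: "u0 x = 0" for x using u0(2)[of x] by (metis antisym not_less)
    obtain t0 x0 where tx: "t0 \<ge> 0" "u t0 x0 \<noteq> 0" using nt by (auto simp: nontrivial_def)
    then have t0: "t0 > 0" using init[of x0] zero[of x0] by (cases "t0 = 0") auto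
    define g where "g = (\<lambda>(s, y). indicator {0<..<t0} s * ennpowr (u s y) p)"
    have g [measurable]: "g \<in> borel_measurable (borel \<Otimes>\<^sub>M borel)"
    proof -
      have "(\<lambda>(t, x). u t x) \<in> borel_measurable (restrict_space borel ({0..} \<times> UNIV))"
        using u by (simp add: cauchy_solution_def)
      moreover have "{0..} \<times> UNIV \<in> sets (borel :: (real \<times> real \<times> real) measure)"
        by (intro borel_closed closed_Times) auto
      ultimately have "(\<lambda>q. (\<lambda>(t, x). u t x) q * indicator ({0..} \<times> UNIV) q) \<in> borel_measurable borel"
        by (subst (asm) borel_measurable_restrict_space_iff_ennreal) auto
      then have [measurable]: "(\<lambda>q. (\<lambda>(t, x). u t x) q * indicator ({0..} \<times> UNIV) q) \<in> borel_measurable (borel \<Otimes>\<^sub>M borel)"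
        by (simp add: borel_prod)
      have "g = (\<lambda>q. indicator {0<..<t0} (fst q) * ennpowr ((\<lambda>(t, x). u t x) q * indicator ({0..} \<times> UNIV) q) p)"
        by (auto simp: g_def fun_eq_iff indicator_def)
      then show ?thesis by simp
    qed
    have gs [measurable]: "(\<lambda>y. g (s, y)) \<in> borel_measurable borel" for s by measurable
    let ?I = "\<lambda>n::nat. \<integral>\<^sup>+s. (\<integral>\<^sup>+y. g (s, y) * indicator (parabolic_box (real n)) y \<partial>lborel) \<partial>lborel"
    have "\<exists>n. ?I n \<noteq> 0"
    proof (rule ccontr)
      assume "\<not> (\<exists>n. ?I n \<noteq> 0)"
      then have I0: "?I n = 0" for n by blast
      have "AE s in lborel. (\<integral>\<^sup>+y. g (s, y) * indicator (parabolic_box (real n)) y \<partial>lborel) = 0" for n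
      proof -
        have "(\<lambda>s. \<integral>\<^sup>+y. g (s, y) * indicator (parabolic_box (real n)) y \<partial>lborel) \<in> borel_measurable lborel"
          by measurable
        then show ?thesis using I0[of n] by (simp add: nn_integral_0_iff_AE)
      qed
      then have "AE s in lborel. \<forall>n::nat. (\<integral>\<^sup>+y. g (s, y) * indicator (parabolic_box (real n)) y \<partial>lborel) = 0"
        unfolding AE_all_countable by blast
      then have "AE s in lborel. (\<integral>\<^sup>+ y. ennreal (K (t0 - s) x0 y) * ennpowr (u s y) p \<partial>lborel) * indicator {0<..<t0} s = 0"
      proof eventually_elim
        case (elim s)
        have "(\<integral>\<^sup>+y. g (s, y) \<partial>lborel) = 0"
          using nonzero_integral_on_box[OF gs] elim by blast
        then have ae: "AE y in lborel. g (s, y) = 0" by (simp add: nn_integral_0_iff_AE)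
        show ?case
        proof (cases "s \<in> {0<..<t0}")
          case True
          have "(\<integral>\<^sup>+ y. ennreal (K (t0 - s) x0 y) * ennpowr (u s y) p \<partial>lborel) = (\<integral>\<^sup>+ y. 0 \<partial>(lborel :: (real \<times> real) measure))"
            by (rule nn_integral_cong_AE) (use ae in eventually_elim, use True in \<open>auto simp: g_def\<close>)
          then show ?thesis by simp
        qed simp
      qed
      then have "(\<integral>\<^sup>+ s\<in>{0<..<t0}. (\<integral>\<^sup>+ y. ennreal (K (t0 - s) x0 y) * ennpowr (u s y) p \<partial>lborel) \<partial>lborel) = (\<integral>\<^sup>+s. 0 \<partial>(lborel :: real measure))"
        by (rule nn_integral_cong_AE)
      then have "u t0 x0 = 0" using sol[OF t0, of x0] zero by simp
      then show False using tx by simp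
    qed
    then obtain n where "?I n \<noteq> 0" by blast
    then obtain r where r: "r > 0" "ennreal r \<le> ?I n" using positive_ennreal_real by blast
    have "ennreal (c * r / (t * sqrt t)) \<le> u t x" if t: "max 1 (max (real n) (2 * t0)) \<le> t" and x: "x \<in> parabolic_box t" for t x
    proof -
      let ?k = "c / (t * sqrt t)"
      have tp: "t > 0" using t by simp
      have "ennreal (c * r / (t * sqrt t)) = ennreal ?k * ennreal r"
        using c r tp by (subst ennreal_mult[symmetric]) auto
      also have "\<dots> \<le> ennreal ?k * ?I n" by (intro mult_left_mono r) simp
      also have "\<dots> = (\<integral>\<^sup>+s. ennreal ?k * (\<integral>\<^sup>+y. g (s, y) * indicator (parabolic_box (real n)) y \<partial>lborel) \<partial>lborel)"
        by (rule nn_integral_cmult[symmetric]) measurable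
      also have "\<dots> = (\<integral>\<^sup>+s. (\<integral>\<^sup>+y. ennreal ?k * (g (s, y) * indicator (parabolic_box (real n)) y) \<partial>lborel) \<partial>lborel)"
        by (intro nn_integral_cong nn_integral_cmult[symmetric]) measurable
      also have "\<dots> \<le> (\<integral>\<^sup>+ s\<in>{0<..<t}. (\<integral>\<^sup>+ y. ennreal (K (t - s) x y) * ennpowr (u s y) p \<partial>lborel) \<partial>lborel)"
      proof (rule nn_integral_mono)
        fix s
        show "(\<integral>\<^sup>+y. ennreal ?k * (g (s, y) * indicator (parabolic_box (real n)) y) \<partial>lborel)
          \<le> (\<integral>\<^sup>+ y. ennreal (K (t - s) x y) * ennpowr (u s y) p \<partial>lborel) * indicator {0<..<t} s"
        proof (cases "s \<in> {0<..<t0}")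
          case True
          then have s: "0 < s" "s < t0" "s < t" "t \<le> 2 * (t - s)" using t by auto
          have "(\<integral>\<^sup>+y. ennreal ?k * (g (s, y) * indicator (parabolic_box (real n)) y) \<partial>lborel)
            \<le> (\<integral>\<^sup>+ y. ennreal (K (t - s) x y) * ennpowr (u s y) p \<partial>lborel)"
          proof (rule nn_integral_mono)
            fix y
            show "ennreal ?k * (g (s, y) * indicator (parabolic_box (real n)) y) \<le> ennreal (K (t - s) x y) * ennpowr (u s y) p"
            proof (cases "y \<in> parabolic_box (real n)")
              case True
              have "?k \<le> c / ((t - s) * sqrt (t - s))" using s c by (intro kernel_scale_antimono) auto
              also have "\<dots> \<le> K (t - s) x y"
                using s t x True by (intro K) (auto elim!: in_parabolic_box_mono)
              finally show ?thesis using True s by (simp add: g_def mult_right_mono ennreal_leI)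
            qed simp
          qed
          then show ?thesis using s by simp
        qed (simp add: g_def)
      qed
      also have "\<dots> \<le> u t x" unfolding sol[OF tp] by simp
      finally show ?thesis .
    qed
    then show ?thesis using that[of "c * r" "max 1 (max (real n) (2 * t0))"] c r by simp
  qed
qed

text \<open>The Duhamel integral at \<open>(t, x)\<close> contains \<open>\<infinity>\<close> times a positive kernel, integrated over a set of
  positive space-time measure.\<close>

lemma infinite_on_box_propagates:
  assumes K: "grushin_heat_kernel M W1 W2 X K" and u: "cauchy_solution K p u0 u"
    and r: "r > 0" and ab: "0 \<le> a" "a < b"
    and inf: "\<And>s y. a < s \<Longrightarrow> s < b \<Longrightarrow> y \<in> parabolic_box r \<Longrightarrow> u s y = \<infinity>"
    and t: "b < t"
  shows "u t x = \<infinity>"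
proof -
  have t0: "t > 0" using ab t by simp
  have "(\<integral>\<^sup>+ s\<in>{0<..<t}. (\<integral>\<^sup>+ y. ennreal (K (t - s) x y) * ennpowr (u s y) p \<partial>lborel) \<partial>lborel)
     \<ge> (\<integral>\<^sup>+ s. \<infinity> * indicator {a<..<b} s \<partial>lborel)"
  proof (rule nn_integral_mono)
    fix s
    show "\<infinity> * indicator {a<..<b} s \<le> (\<integral>\<^sup>+ y. ennreal (K (t - s) x y) * ennpowr (u s y) p \<partial>lborel) * indicator {0<..<t} s"
    proof (cases "s \<in> {a<..<b}")
      case True
      then have s: "0 < s" "s < t" "a < s" "s < b" using ab t by auto
      have "(\<integral>\<^sup>+ y. ennreal (K (t - s) x y) * ennpowr (u s y) p \<partial>lborel) \<ge> (\<integral>\<^sup>+ y. \<infinity> * indicator (parabolic_box r) y \<partial>lborel)"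
      proof (rule nn_integral_mono)
        fix y
        have "K (t - s) x y > 0" using s by (intro heat_kernel_pos[OF K]) simp
        then show "\<infinity> * indicator (parabolic_box r) y \<le> ennreal (K (t - s) x y) * ennpowr (u s y) p"
          using inf[OF s(3,4)] by (auto simp: indicator_def ennpowr_def ennreal_mult_top)
      qed
      moreover have "(\<integral>\<^sup>+ y. \<infinity> * indicator (parabolic_box r) y \<partial>lborel) = \<infinity> * emeasure lborel (parabolic_box r)"
        by (rule nn_integral_cmult_indicator) simp
      moreover have "\<dots> = \<infinity>" using r by (simp add: emeasure_parabolic_box ennreal_top_mult)
      ultimately have "(\<integral>\<^sup>+ y. ennreal (K (t - s) x y) * ennpowr (u s y) p \<partial>lborel) = \<infinity>"
        by (simp add: top_unique)
      then show ?thesis using s by simp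
    qed simp
  qed
  moreover have "(\<integral>\<^sup>+ s. \<infinity> * indicator {a<..<b} s \<partial>lborel) = \<infinity> * emeasure lborel {a<..<b}"
    by (rule nn_integral_cmult_indicator) simp
  moreover have "\<dots> = \<infinity>" using ab by (simp add: ennreal_top_mult)
  ultimately have "\<infinity> \<le> (\<integral>\<^sup>+ s\<in>{0<..<t}. (\<integral>\<^sup>+ y. ennreal (K (t - s) x y) * ennpowr (u s y) p \<partial>lborel) \<partial>lborel)"
    by simp
  also have "\<dots> \<le> u t x" by (rule cauchy_solution_duhamel[OF u t0])
  finally show ?thesis by (simp add: top_unique)
qed

lemma fujita_blow_up:
  assumes K: "grushin_heat_kernel M W1 W2 X K" and p: "1 < p" "p \<le> 1 + 2 / 3"
    and u0: "continuous_on UNIV u0" "\<And>x. u0 x \<ge> 0"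
    and u: "cauchy_solution K p u0 u" and nt: "nontrivial u"
  shows "blows_up_in_finite_time u"
proof -
  have two: "(2::real) > 0" by simp
  from heat_kernel_lower_bound[OF K two]
  obtain c where c: "c > 0" and lb: "\<And>t x y. t > 0 \<Longrightarrow> x \<in> parabolic_box (2 * t) \<Longrightarrow> y \<in> parabolic_box (2 * t) \<Longrightarrow>
      c / (t * sqrt t) \<le> K t x y" by blast
  obtain a t1 where a: "a > 0" and t1: "t1 \<ge> 1"
    and start: "\<And>t x. t1 \<le> t \<Longrightarrow> x \<in> parabolic_box t \<Longrightarrow> ennreal (a / (t * sqrt t)) \<le> u t x"
    using solution_initial_bound[OF u u0 nt c lb] by blast
  have p': "p \<le> 5 / 3" using p by simp
  \<comment> \<open>With this \<open>\<kappa>\<close>, the bound \<open>m^(1-p) \<le> \<kappa>T\<close> makes the total doubling time for \<open>c = 1/16\<close> at most \<open>T/32\<close>.\<close>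
  define \<kappa> where "\<kappa> = (1 - 2 powr (1 - p)) / 1024"
  have pw: "2 powr (1 - p) < 1" using p by (simp add: powr_less_one)
  then have \<kappa>: "\<kappa> > 0" by (simp add: \<kappa>_def)
  define C where "C = \<kappa> powr (1 / (1 - p))"
  have C: "C > 0" using \<kappa> by (simp add: C_def)
  have C\<kappa>: "C powr (1 - p) = \<kappa>" using \<kappa> p by (simp add: C_def powr_powr)
  \<comment> \<open>From time \<open>T\<close> on, the logarithmic gain is at least \<open>4C\<close>; the factor \<open>4\<close> pays for \<open>t^(3/2) \<le> 4 T^(3/2)\<close> during the window.\<close>
  define T where "T = 2 * t1 * exp (4 * C / (4 * c * a powr p))"
  have "exp (4 * C / (4 * c * a powr p)) \<ge> 1" using C c by simp
  then have T: "2 * t1 \<le> T" unfolding T_def using t1 by (simp add: mult_le_cancel_left1)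
  then have T1: "T \<ge> 1" using t1 by simp
  have high: "ennreal (4 * C / (t * sqrt t)) \<le> u t x" if t: "T \<le> t" and x: "x \<in> parabolic_box t" for t x
  proof -
    have "exp (4 * C / (4 * c * a powr p)) \<le> t / (2 * t1)"
      using t t1 by (simp add: T_def field_simps)
    then have "4 * C / (4 * c * a powr p) \<le> ln (t / (2 * t1))"
      using t T t1 by (subst ln_ge_iff) auto
    then have "4 * C \<le> ln (t / (2 * t1)) * (4 * c * a powr p)"
      using c a by (subst (asm) pos_divide_le_eq) auto
    then have "4 * C / (t * sqrt t) \<le> 4 * c * a powr p * ln (t / (2 * t1)) / (t * sqrt t)"
      using t T1 by (intro divide_right_mono) (auto simp: mult_ac)
    then have "ennreal (4 * C / (t * sqrt t)) \<le> ennreal (4 * c * a powr p * ln (t / (2 * t1)) / (t * sqrt t))"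
      by (rule ennreal_leI)
    also have "\<dots> \<le> u t x"
    proof (rule logarithmic_gain[OF p(1) p' c a t1 lb cauchy_solution_duhamel[OF u] start _ x])
      show "2 * t1 \<le> t" using T t by (rule order_trans)
    qed
    finally show ?thesis .
  qed
  define m where "m = C / (T * sqrt T)"
  have m: "m > 0" using C T1 by (simp add: m_def)
  have mpow: "m powr (1 - p) \<le> \<kappa> * T"
  proof -
    have sqrt_T: "T * sqrt T = T powr (3 / 2)" using T1 by (intro times_sqrt_eq_powr) simp
    have "m powr (1 - p) = C powr (1 - p) / (T * sqrt T) powr (1 - p)"
      unfolding m_def by (rule powr_divide)
    also have "\<dots> = \<kappa> / (T powr (3 / 2)) powr (1 - p)"
      by (simp only: C\<kappa> sqrt_T)
    also have "\<dots> = \<kappa> * T powr (- (3 / 2 * (1 - p)))"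
      by (simp only: powr_powr powr_minus_divide times_divide_eq_right mult_1_right)
    also have "\<dots> \<le> \<kappa> * T powr 1"
      using \<kappa> T1 p by (intro mult_left_mono powr_mono) auto
    finally show ?thesis using T1 by simp
  qed
  have inf: "u t x = \<infinity>" if "T + T / 32 \<le> t" "t \<le> T + T / 16" "x \<in> parabolic_box T" for t x
  proof (rule doubling_blow_up[where B="parabolic_box T" and c="1 / 16" and m=m and T=T and \<delta>="T / 16" and \<delta>'="T / 32" and K=K and p=p])
    show "ennreal m \<le> u t x" if t: "T < t" "t \<le> T + T / 16" and x: "x \<in> parabolic_box T" for t x
    proof -
      have "sqrt t \<le> sqrt (4 * T)" using t T1 by (intro real_sqrt_le_mono) auto
      then have "t * sqrt t \<le> (2 * T) * (2 * sqrt T)"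
        using t T1 by (intro mult_mono) (auto simp: real_sqrt_mult)
      then have "4 * C / ((2 * T) * (2 * sqrt T)) \<le> 4 * C / (t * sqrt t)"
        using C T1 t by (intro divide_left_mono) auto
      then have "ennreal m \<le> ennreal (4 * C / (t * sqrt t))"
        by (intro ennreal_leI) (simp add: m_def)
      also have "\<dots> \<le> u t x" using t x by (intro high) (auto elim!: in_parabolic_box_mono)
      finally show ?thesis .
    qed
    show "2 / (1 / 16) * m powr (1 - p) / (1 - 2 powr (1 - p)) \<le> T / 32"
    proof -
      have "32 * m powr (1 - p) \<le> 32 * (\<kappa> * T)" using mpow by simp
      also have "\<dots> = T / 32 * (1 - 2 powr (1 - p))" by (simp add: \<kappa>_def)
      finally show ?thesis using pw by (simp add: pos_divide_le_eq)
    qed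
    show "ennreal (1 / 16) \<le> (\<integral>\<^sup>+y. ennreal (K t x y) * indicator (parabolic_box T) y \<partial>lborel)"
      if "0 < t" "t \<le> T / 16" "x \<in> parabolic_box T" for t x
      using that T1 by (intro heat_kernel_stay[OF K]) auto
  qed (use p m T1 that in \<open>auto intro: heat_kernel_measurable[OF K] cauchy_solution_duhamel[OF u]\<close>)
  have "u t x = \<infinity>" if "t > T + T / 16" for t x
    by (rule infinite_on_box_propagates[OF K u, of T "T + T / 32" "T + T / 16"]) (use T1 inf that in auto)
  then show ?thesis unfolding blows_up_in_finite_time_def using T1 by (intro exI[of _ "T + T / 16"]) auto
qed


section \<open>Global solutions in the sublinear case\<close>

lemma ennpowr_mono: "z \<le> w \<Longrightarrow> p > 0 \<Longrightarrow> ennpowr z p \<le> ennpowr w p"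
proof (cases z)
  case (real r)
  moreover assume "z \<le> w" "p > 0"
  ultimately have "ennreal (r powr p) \<le> ennpowr w p" by (intro ennpowr_ge) auto
  then show ?thesis using real by (simp add: ennpowr_def)
qed (simp add: ennpowr_def top_unique)

text \<open>Finiteness of the supremum reduces this to continuity of \<open>z \<mapsto> z^p\<close> on \<open>[0, \<infinity>)\<close>.\<close>

lemma ennpowr_SUP:
  assumes z: "incseq z" and fin: "(SUP n. z n) \<noteq> \<infinity>" and p: "p > 0"
  shows "ennpowr (SUP n. z n) p = (SUP n. ennpowr (z n) p)"
proof -
  have zn: "z n \<noteq> \<infinity>" for n
    using fin SUP_upper[of n UNIV z] by (metis UNIV_I infinity_ennreal_def top_unique)
  have "z \<longlonglongrightarrow> ennreal (enn2real (SUP n. z n))" 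
  proof -
    have "ennreal (enn2real (SUP n. z n)) = (SUP n. z n)"
      by (rule ennreal_enn2real) (use fin in \<open>simp only: less_top infinity_ennreal_def\<close>)
    then show ?thesis using LIMSEQ_SUP[OF z] by simp
  qed
  then have "(\<lambda>n. enn2real (z n)) \<longlonglongrightarrow> enn2real (SUP n. z n)"
    by (rule tendsto_enn2real) simp
  then have "(\<lambda>n. enn2real (z n) powr p) \<longlonglongrightarrow> enn2real (SUP n. z n) powr p"
    by (intro tendsto_powr') (use p in auto)
  then have "(\<lambda>n. ennpowr (z n) p) \<longlonglongrightarrow> ennpowr (SUP n. z n) p"
    using fin zn by (auto simp: ennpowr_def intro!: tendsto_ennrealI)
  moreover have "incseq (\<lambda>n. ennpowr (z n) p)"
    using z p by (auto simp: incseq_def intro!: ennpowr_mono)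
  ultimately show ?thesis using LIMSEQ_SUP LIMSEQ_unique by blast
qed

definition duhamel_term ::
  "(real \<Rightarrow> real \<times> real \<Rightarrow> real \<times> real \<Rightarrow> real) \<Rightarrow> real \<Rightarrow> (real \<Rightarrow> real \<times> real \<Rightarrow> ennreal) \<Rightarrow>
   real \<Rightarrow> real \<times> real \<Rightarrow> ennreal" where
  "duhamel_term K p v t x =
     (\<integral>\<^sup>+ s\<in>{0<..<t}. (\<integral>\<^sup>+ y. ennreal (K (t - s) x y) * ennpowr (v s y) p \<partial>lborel) \<partial>lborel)"

text \<open>Prescribing a value also for \<open>t < 0\<close> makes the iterates measurable on the whole line.\<close>

fun picard ::
  "(real \<Rightarrow> real \<times> real \<Rightarrow> real \<times> real \<Rightarrow> real) \<Rightarrow> real \<Rightarrow> (real \<times> real \<Rightarrow> real) \<Rightarrow>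
   nat \<Rightarrow> real \<Rightarrow> real \<times> real \<Rightarrow> ennreal" where
  "picard K p u0 0 t x = 0"
| "picard K p u0 (Suc n) t x =
     (if t \<le> 0 then ennreal (u0 x)
      else (\<integral>\<^sup>+ y. ennreal (K t x y) * ennreal (u0 y) \<partial>lborel) + duhamel_term K p (picard K p u0 n) t x)"

lemma duhamel_term_mono:
  assumes "\<And>s y. v s y \<le> w s y" "p > 0"
  shows "duhamel_term K p v t x \<le> duhamel_term K p w t x"
  unfolding duhamel_term_def
  by (intro nn_integral_mono mult_right_mono mult_left_mono ennpowr_mono assms) auto

lemma picard_incseq: "p > 0 \<Longrightarrow> incseq (\<lambda>n. picard K p u0 n t x)"
proof (rule incseq_SucI)
  fix n assume p: "p > 0"
  show "picard K p u0 n t x \<le> picard K p u0 (Suc n) t x"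
  proof (induction n arbitrary: t x)
    case (Suc n)
    then show ?case unfolding picard.simps(2) using p
      by (auto intro!: add_left_mono duhamel_term_mono simp del: picard.simps)
  qed simp
qed

text \<open>Continuity gives measurability only for positive times, hence the cut-off factor.\<close>

lemma heat_kernel_jointly_measurable:
  assumes K: "grushin_heat_kernel M W1 W2 X K"
    and [measurable]: "\<tau> \<in> borel_measurable N" "\<xi> \<in> borel_measurable N" "\<eta> \<in> borel_measurable N"
  shows "(\<lambda>q. indicator {0<..} (\<tau> q) * ennreal (K (\<tau> q) (\<xi> q) (\<eta> q))) \<in> borel_measurable N"
proof -
  let ?S = "{0<..} \<times> UNIV \<times> UNIV :: (real \<times> (real \<times> real) \<times> (real \<times> real)) set"
  let ?f = "\<lambda>(t, x, y). K t x y"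
  have "continuous_on ?S ?f" using K unfolding grushin_heat_kernel_def by blast
  moreover have "?S \<in> sets borel" by (intro borel_open open_Times) auto
  ultimately have [measurable]: "(\<lambda>q. indicator ?S q *\<^sub>R ?f q) \<in> borel_measurable borel"
    by (rule borel_measurable_continuous_on_indicator[rotated])
  have "(\<lambda>q. (\<tau> q, \<xi> q, \<eta> q)) \<in> borel_measurable N" by measurable
  moreover have "(\<lambda>q. ennreal (indicator ?S q *\<^sub>R ?f q)) \<in> borel_measurable borel" by measurable
  ultimately have "(\<lambda>q. (\<lambda>q. ennreal (indicator ?S q *\<^sub>R ?f q)) (\<tau> q, \<xi> q, \<eta> q)) \<in> borel_measurable N"
    by (rule measurable_compose)
  then have "(\<lambda>q. ennreal (indicator ?S (\<tau> q, \<xi> q, \<eta> q) *\<^sub>R K (\<tau> q) (\<xi> q) (\<eta> q))) \<in> borel_measurable N"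
    by (simp only: prod.case)
  also have "(\<lambda>q. ennreal (indicator ?S (\<tau> q, \<xi> q, \<eta> q) *\<^sub>R K (\<tau> q) (\<xi> q) (\<eta> q)))
      = (\<lambda>q. indicator {0<..} (\<tau> q) * ennreal (K (\<tau> q) (\<xi> q) (\<eta> q)))"
    by (auto simp: fun_eq_iff indicator_def)
  finally show ?thesis .
qed

lemma duhamel_inner_measurable:
  assumes K: "grushin_heat_kernel M W1 W2 X K"
    and v: "(\<lambda>(t, x). v t x) \<in> borel_measurable (borel \<Otimes>\<^sub>M borel)"
    and [measurable]: "\<tau> \<in> borel_measurable N" "\<xi> \<in> borel_measurable N" "\<sigma> \<in> borel_measurable N"
  shows "(\<lambda>q. (\<integral>\<^sup>+ y. ennreal (K (\<tau> q - \<sigma> q) (\<xi> q) y) * ennpowr (v (\<sigma> q) y) p \<partial>lborel) * indicator {0<..<\<tau> q} (\<sigma> q))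
      \<in> borel_measurable N"
proof -
  have [measurable]: "(\<lambda>q. indicator {0<..} (\<tau> (fst q) - \<sigma> (fst q)) * ennreal (K (\<tau> (fst q) - \<sigma> (fst q)) (\<xi> (fst q)) (snd q)))
      \<in> borel_measurable (N \<Otimes>\<^sub>M lborel)"
    by (rule heat_kernel_jointly_measurable[OF K]) measurable
  have "(\<lambda>q. (\<sigma> (fst q), snd q)) \<in> measurable (N \<Otimes>\<^sub>M lborel) (borel \<Otimes>\<^sub>M borel)" by measurable
  from measurable_compose[OF this v]
  have [measurable]: "(\<lambda>q. v (\<sigma> (fst q)) (snd q)) \<in> borel_measurable (N \<Otimes>\<^sub>M lborel)" by simp
  have [measurable]: "(\<lambda>q. \<integral>\<^sup>+ y. indicator {0<..} (\<tau> q - \<sigma> q) * ennreal (K (\<tau> q - \<sigma> q) (\<xi> q) y) * ennpowr (v (\<sigma> q) y) p \<partial>lborel) \<in> borel_measurable N"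
    using lborel.borel_measurable_nn_integral[of "\<lambda>q y. indicator {0<..} (\<tau> q - \<sigma> q) * ennreal (K (\<tau> q - \<sigma> q) (\<xi> q) y) * ennpowr (v (\<sigma> q) y) p" N]
    by (simp add: case_prod_beta)
  have eq: "(\<lambda>q. (\<integral>\<^sup>+ y. ennreal (K (\<tau> q - \<sigma> q) (\<xi> q) y) * ennpowr (v (\<sigma> q) y) p \<partial>lborel) * indicator {0<..<\<tau> q} (\<sigma> q))
    = (\<lambda>q. (\<integral>\<^sup>+ y. indicator {0<..} (\<tau> q - \<sigma> q) * ennreal (K (\<tau> q - \<sigma> q) (\<xi> q) y) * ennpowr (v (\<sigma> q) y) p \<partial>lborel)
        * (if 0 < \<sigma> q \<and> \<sigma> q < \<tau> q then 1 else 0))"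
    by (auto simp: fun_eq_iff)
  show ?thesis unfolding eq by measurable
qed

lemma picard_measurable:
  assumes K: "grushin_heat_kernel M W1 W2 X K" and u0 [measurable]: "u0 \<in> borel_measurable borel"
  shows "(\<lambda>(t, x). picard K p u0 n t x) \<in> borel_measurable (borel \<Otimes>\<^sub>M borel)"
proof (induction n)
  case (Suc n)
  let ?N = "(borel :: real measure) \<Otimes>\<^sub>M (borel :: (real \<times> real) measure)"
  have [measurable]: "(\<lambda>q. indicator {0<..} (fst (fst q)) * ennreal (K (fst (fst q)) (snd (fst q)) (snd q))) \<in> borel_measurable (?N \<Otimes>\<^sub>M lborel)"
    by (rule heat_kernel_jointly_measurable[OF K]) measurable
  have [measurable]: "(\<lambda>q. \<integral>\<^sup>+ y. indicator {0<..} (fst q) * ennreal (K (fst q) (snd q) y) * ennreal (u0 y) \<partial>lborel) \<in> borel_measurable ?N"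
    using lborel.borel_measurable_nn_integral[of "\<lambda>q y. indicator {0<..} (fst q) * ennreal (K (fst q) (snd q) y) * ennreal (u0 y)" ?N]
    by (simp add: case_prod_beta)
  have "(\<lambda>r. (\<integral>\<^sup>+ y. ennreal (K (fst (fst r) - snd r) (snd (fst r)) y) * ennpowr (picard K p u0 n (snd r) y) p \<partial>lborel)
      * indicator {0<..<fst (fst r)} (snd r)) \<in> borel_measurable (?N \<Otimes>\<^sub>M lborel)"
    by (rule duhamel_inner_measurable[OF K Suc.IH]) measurable
  then have [measurable]: "(\<lambda>q. duhamel_term K p (picard K p u0 n) (fst q) (snd q)) \<in> borel_measurable ?N"
    unfolding duhamel_term_def
    using lborel.borel_measurable_nn_integral[of "\<lambda>q s. (\<integral>\<^sup>+ y. ennreal (K (fst q - s) (snd q) y) * ennpowr (picard K p u0 n s y) p \<partial>lborel)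
      * indicator {0<..<fst q} s" ?N]
    by (simp add: case_prod_beta)
  have eq: "(\<lambda>(t, x). picard K p u0 (Suc n) t x) = (\<lambda>q. if fst q \<le> 0 then ennreal (u0 (snd q))
      else (\<integral>\<^sup>+ y. indicator {0<..} (fst q) * ennreal (K (fst q) (snd q) y) * ennreal (u0 y) \<partial>lborel)
           + duhamel_term K p (picard K p u0 n) (fst q) (snd q))"
    by (auto simp: fun_eq_iff)
  show ?case unfolding eq by measurable
qed simp

text \<open>The function \<open>A e^t\<close> with \<open>A = B + 1\<close> is a supersolution: its values are at least \<open>1\<close>, so \<open>z^p \<le> z\<close>
  there, and \<open>B\<close> plus the integral of \<open>A e^s\<close> over \<open>[0, t]\<close> is \<open>A e^t - 1\<close>.\<close>

lemma picard_bound: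
  assumes K: "grushin_heat_kernel M W1 W2 X K" and p: "0 < p" "p < 1"
    and u0: "\<And>x. u0 x \<le> B" and B: "B \<ge> 0" and t: "t \<ge> 0"
  shows "picard K p u0 n t x \<le> ennreal ((B + 1) * exp t)"
  using t
proof (induction n arbitrary: t x)
  case (Suc n)
  show ?case
  proof (cases "t = 0")
    case True
    then show ?thesis using u0[of x] by (auto intro: ennreal_leI)
  next
    case False
    then have t: "t > 0" using Suc.prems by simp
    have mass: "(\<integral>\<^sup>+ y. ennreal (K s x y) * ennreal m \<partial>lborel) = ennreal m" if s: "s > 0" for s m
    proof -
      have [measurable]: "K s x \<in> borel_measurable borel"
        by (rule heat_kernel_measurable[OF K s])
      show ?thesis using heat_kernel_mass[OF K s, of x] by (simp add: nn_integral_multc)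
    qed
    have "(\<integral>\<^sup>+ y. ennreal (K t x y) * ennreal (u0 y) \<partial>lborel) \<le> (\<integral>\<^sup>+ y. ennreal (K t x y) * ennreal B \<partial>lborel)"
      by (intro nn_integral_mono mult_left_mono ennreal_leI u0) simp
    also have "\<dots> = ennreal B" by (rule mass[OF t])
    finally have 1: "(\<integral>\<^sup>+ y. ennreal (K t x y) * ennreal (u0 y) \<partial>lborel) \<le> ennreal B" .
    have "duhamel_term K p (picard K p u0 n) t x \<le> (\<integral>\<^sup>+ s. ennreal ((B + 1) * exp s) * indicator {0..t} s \<partial>lborel)"
      unfolding duhamel_term_def
    proof (rule nn_integral_mono)
      fix s
      show "(\<integral>\<^sup>+ y. ennreal (K (t - s) x y) * ennpowr (picard K p u0 n s y) p \<partial>lborel) * indicator {0<..<t} s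
          \<le> ennreal ((B + 1) * exp s) * indicator {0..t} s"
      proof (cases "s \<in> {0<..<t}")
        case True
        then have s: "0 < s" "s < t" by auto
        have ge1: "(B + 1) * exp s \<ge> 1" using B s mult_mono[of 1 "B + 1" 1 "exp s"] by simp
        have "(\<integral>\<^sup>+ y. ennreal (K (t - s) x y) * ennpowr (picard K p u0 n s y) p \<partial>lborel)
          \<le> (\<integral>\<^sup>+ y. ennreal (K (t - s) x y) * ennreal ((B + 1) * exp s) \<partial>lborel)"
        proof (intro nn_integral_mono mult_left_mono)
          fix y
          have "ennpowr (picard K p u0 n s y) p \<le> ennpowr (ennreal ((B + 1) * exp s)) p"
            using s by (intro ennpowr_mono Suc.IH p) auto
          also have "\<dots> = ennreal (((B + 1) * exp s) powr p)" using ge1 by (simp add: ennpowr_def)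
          also have "\<dots> \<le> ennreal ((B + 1) * exp s)"
            using powr_mono[of p 1 "(B + 1) * exp s"] p ge1 by (intro ennreal_leI) simp
          finally show "ennpowr (picard K p u0 n s y) p \<le> ennreal ((B + 1) * exp s)" .
        qed simp
        also have "\<dots> = ennreal ((B + 1) * exp s)" by (rule mass) (use s in simp)
        finally show ?thesis using s by simp
      qed simp
    qed
    also have "\<dots> = ennreal ((B + 1) * exp t - (B + 1) * exp 0)"
      by (rule nn_integral_FTC_Icc) (use t B in \<open>auto intro!: derivative_eq_intros\<close>)
    finally have "picard K p u0 (Suc n) t x \<le> ennreal B + ennreal ((B + 1) * exp t - (B + 1) * exp 0)"
      using 1 t by (simp add: add_mono del: exp_zero)
    also have "\<dots> = ennreal (B + ((B + 1) * exp t - (B + 1) * exp 0))"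
      using B t by (intro ennreal_plus[symmetric]) (auto simp: mult_le_cancel_left1)
    also have "\<dots> \<le> ennreal ((B + 1) * exp t)" by (intro ennreal_leI) simp
    finally show ?thesis .
  qed
qed simp

lemma sublinear_global_solution:
  assumes K: "grushin_heat_kernel M W1 W2 X K" and p: "0 < p" "p < 1"
    and u0: "continuous_on UNIV u0" and bdd: "bounded (range u0)"
  shows "\<exists>u. cauchy_solution K p u0 u \<and> finite_everywhere u"
proof -
  have u0m [measurable]: "u0 \<in> borel_measurable borel" by (rule borel_measurable_continuous_onI[OF u0])
  obtain B where B: "\<And>x. u0 x \<le> B" "B \<ge> 0"
  proof -
    obtain b where "\<And>x. \<bar>u0 x\<bar> \<le> b" using bdd by (auto simp: bounded_iff)
    then have "u0 x \<le> \<bar>b\<bar>" for x by (meson abs_ge_self order_trans)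
    then show ?thesis using that[of "\<bar>b\<bar>"] by simp
  qed
  let ?v = "\<lambda>n. picard K p u0 n"
  define u where "u t x = (SUP n. ?v n t x)" for t x
  have inc: "incseq (\<lambda>n. ?v n t x)" for t x by (rule picard_incseq[OF p(1)])
  have Sucs: "u t x = (SUP n. ?v (Suc n) t x)" for t x
    unfolding u_def using LIMSEQ_unique[OF LIMSEQ_SUP[OF inc, THEN LIMSEQ_Suc] LIMSEQ_SUP[OF incseq_SucI]] inc
    by (metis incseq_SucD)
  have fin: "u t x \<le> ennreal ((B + 1) * exp t)" if "t \<ge> 0" for t x
    unfolding u_def using that by (intro SUP_least picard_bound[OF K p B])
  have meas: "(\<lambda>(t, x). u t x) \<in> borel_measurable (borel \<Otimes>\<^sub>M borel)"
  proof -
    have "(\<lambda>q. SUP n. (\<lambda>(t, x). ?v n t x) q) \<in> borel_measurable (borel \<Otimes>\<^sub>M borel)"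
      by (intro borel_measurable_SUP) (auto intro: picard_measurable[OF K u0m])
    then show ?thesis by (simp add: u_def case_prod_beta)
  qed
  have duhamel: "duhamel_term K p u t x = (SUP n. duhamel_term K p (?v n) t x)" if t: "t > 0" for t x
  proof -
    let ?g = "\<lambda>n s. (\<integral>\<^sup>+ y. ennreal (K (t - s) x y) * ennpowr (?v n s y) p \<partial>lborel) * indicator {0<..<t} s"
    have inner: "(\<integral>\<^sup>+ y. ennreal (K (t - s) x y) * ennpowr (u s y) p \<partial>lborel) * indicator {0<..<t} s = (SUP n. ?g n s)" for s
    proof (cases "s \<in> {0<..<t}")
      case True
      then have s: "0 < s" "s < t" by auto
      have [measurable]: "K (t - s) x \<in> borel_measurable borel"
        by (rule heat_kernel_measurable[OF K]) (use s in simp)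
      have vm [measurable]: "(\<lambda>y. ?v n s y) \<in> borel_measurable borel" for n
        using measurable_compose[OF measurable_Pair1' picard_measurable[OF K u0m, of p n], of s] by simp
      have "(\<integral>\<^sup>+ y. ennreal (K (t - s) x y) * ennpowr (u s y) p \<partial>lborel)
          = (\<integral>\<^sup>+ y. (SUP n. ennreal (K (t - s) x y) * ennpowr (?v n s y) p) \<partial>lborel)"
      proof (rule nn_integral_cong)
        fix y
        have "u s y \<noteq> \<infinity>" using fin[of s y] s by (auto simp: top_unique)
        then have "ennpowr (u s y) p = (SUP n. ennpowr (?v n s y) p)"
          unfolding u_def by (rule ennpowr_SUP[OF inc _ p(1)])
        then show "ennreal (K (t - s) x y) * ennpowr (u s y) p = (SUP n. ennreal (K (t - s) x y) * ennpowr (?v n s y) p)"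
          by (simp add: SUP_mult_left_ennreal)
      qed
      also have "\<dots> = (SUP n. \<integral>\<^sup>+ y. ennreal (K (t - s) x y) * ennpowr (?v n s y) p \<partial>lborel)"
      proof (rule nn_integral_monotone_convergence_SUP)
        show "incseq (\<lambda>n y. ennreal (K (t - s) x y) * ennpowr (?v n s y) p)"
          using inc p by (auto simp: incseq_def le_fun_def intro!: mult_left_mono ennpowr_mono)
      qed measurable
      finally show ?thesis using s by simp
    qed simp
    have gm: "?g n \<in> borel_measurable lborel" for n
      using duhamel_inner_measurable[OF K picard_measurable[OF K u0m, of p n], of "\<lambda>_. t" lborel "\<lambda>_. x" "\<lambda>s. s"] by simp
    have "duhamel_term K p u t x = (\<integral>\<^sup>+ s. (SUP n. ?g n s) \<partial>lborel)"
      unfolding duhamel_term_def by (intro nn_integral_cong inner)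
    also have "\<dots> = (SUP n. \<integral>\<^sup>+ s. ?g n s \<partial>lborel)"
    proof (rule nn_integral_monotone_convergence_SUP[OF _ gm])
      show "incseq ?g"
        using inc p by (auto simp: incseq_def le_fun_def intro!: mult_right_mono mult_left_mono nn_integral_mono ennpowr_mono)
    qed
    finally show ?thesis by (simp add: duhamel_term_def)
  qed
  have "cauchy_solution K p u0 u"
    unfolding cauchy_solution_def
  proof (intro conjI allI impI)
    show "(\<lambda>(t, x). u t x) \<in> borel_measurable (restrict_space borel ({0..} \<times> UNIV))"
      using meas by (intro measurable_restrict_space1) (simp add: borel_prod)
    show "u 0 x = ennreal (u0 x)" for x unfolding Sucs by simp
    fix t :: real and x assume t: "t > 0"
    let ?h = "\<integral>\<^sup>+ y. ennreal (K t x y) * ennreal (u0 y) \<partial>lborel"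
    have "u t x = (SUP n. ?h + duhamel_term K p (?v n) t x)"
      unfolding Sucs using t by simp
    also have "\<dots> = ?h + (SUP n. duhamel_term K p (?v n) t x)"
      by (rule ennreal_SUP_add_right[symmetric]) simp
    also have "\<dots> = ?h + duhamel_term K p u t x" by (simp add: duhamel[OF t])
    finally show "u t x = ?h + (\<integral>\<^sup>+ s\<in>{0<..<t}. (\<integral>\<^sup>+ y. ennreal (K (t - s) x y) * ennpowr (u s y) p \<partial>lborel) \<partial>lborel)"
      by (simp add: duhamel_term_def)
  qed
  moreover have "finite_everywhere u"
    unfolding finite_everywhere_def infinity_ennreal_def
    by (intro allI impI order_le_less_trans[OF fin]) (simp_all add: less_top[symmetric])
  ultimately show ?thesis by blast
qed


section \<open>Existence and blow-up\<close>

theorem theorem2p1: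
  fixes M :: "'w measure"
    and W1 W2 :: "real \<Rightarrow> 'w \<Rightarrow> real"
    and X :: "real \<times> real \<Rightarrow> real \<Rightarrow> 'w \<Rightarrow> real \<times> real"
    and K :: "real \<Rightarrow> real \<times> real \<Rightarrow> real \<times> real \<Rightarrow> real"
    and p :: real
    and u0 :: "real \<times> real \<Rightarrow> real"
  assumes kernel: "grushin_heat_kernel M W1 W2 X K"
    and p_pos: "p > 0"
    and u0_nonneg: "\<And>x. u0 x \<ge> 0"
    and u0_cont: "continuous_on UNIV u0"
    and u0_bounded: "bounded (range u0)"
  shows "(p < 1 \<longrightarrow> (\<exists>u. cauchy_solution K p u0 u \<and> finite_everywhere u)) \<and>
         (1 < p \<and> p \<le> 1 + 2 / 3 \<longrightarrow>
            (\<forall>u. cauchy_solution K p u0 u \<and> nontrivial u \<longrightarrow> blows_up_in_finite_time u)) \<and>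
         (1 < p \<longrightarrow>
            (\<forall>\<mu>>0. (INF x. u0 x) \<ge> \<mu> \<longrightarrow>
               (\<forall>u. cauchy_solution K p u0 u \<longrightarrow> blows_up_in_finite_time u)))"
proof (intro conjI impI allI)
  assume "p < 1"
  then show "\<exists>u. cauchy_solution K p u0 u \<and> finite_everywhere u"
    by (rule sublinear_global_solution[OF kernel p_pos _ u0_cont u0_bounded])
next
  fix u assume "1 < p \<and> p \<le> 1 + 2 / 3" "cauchy_solution K p u0 u \<and> nontrivial u"
  then show "blows_up_in_finite_time u"
    using fujita_blow_up[OF kernel _ _ u0_cont u0_nonneg] by blast
next
  fix \<mu> :: real and u
  assume p: "1 < p" and \<mu>: "0 < \<mu>" "\<mu> \<le> (INF x. u0 x)" and u: "cauchy_solution K p u0 u"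
  have "\<mu> \<le> u0 x" for x
  proof -
    have "bdd_below (range u0)" by (rule bdd_belowI[of _ 0]) (use u0_nonneg in auto)
    then have "(INF x. u0 x) \<le> u0 x" by (rule cINF_lower) simp
    then show ?thesis using \<mu> by simp
  qed
  then show "blows_up_in_finite_time u"
    by (rule uniformly_positive_blow_up[OF kernel p \<mu>(1) _ u])
qed

end
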